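(* For an epigroup variety $\mathcal V$, the following are equivalent: (a) $\mathcal V$ is a neutral element of the lattice $\mathbf{EPI}$; (b) $\mathcal V$ is a costandard element of the lattice $\mathbf{EPI}$; (c) $\mathcal V$ is simultaneously a lower-modular and an upper-modular element of the lattice $\mathbf{EPI}$; (d) $\mathcal V$ coincides with one of the varieties $\mathcal T$, $\mathcal{SL}$, $\mathcal{ZM}$ or $\mathcal{SL}\vee\mathcal{ZM}$.
   Context: An epigroup is a semigroup $S$ such that for every $x\in S$ some power $x^n$ ($n\ge 1$) lies in a subgroup of $S$. For $x\in S$ some power of $x$ lies in a maximal subgroup $G_x$ of $S$; its unit is denoted $x^\omega$. Then $xx^\omega=x^\omega x\in G_x$, and the pseudoinverse $\overline{x}$ of $x$ is the inverse of $xx^\omega$ in $G_x$. Epigroups are considered as algebras with multiplication and the unary operation $x\mapsto\overline{x}$; an epigroup variety is a variety of such algebras consisting of epigroups. $\mathbf{EPI}$ is the lattice of all epigroup varieties under inclusion: $\wedge$ is intersection, and $\mathcal X\vee\mathcal Y$ is the least epigroup variety containing $\mathcal X$ and $\mathcal Y$. Periodic semigroup varieties are identified with periodic epigroup varieties (in periodic epigroups pseudoinversion is expressible through multiplication). $\mathcal T$ is the trivial variety, $\mathcal{SL}$ the variety of all semilattices (commutative idempotent semigroups), $\mathcal{ZM}$ the variety of all semigroups with zero multiplication. An element $x$ of a lattice $\langle L;\vee,\wedge\rangle$ is: neutral if $(x\vee y)\wedge(y\vee z)\wedge(z\vee x)=(x\wedge y)\vee(y\wedge z)\vee(z\wedge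 x)$ for all $y,z\in L$; costandard if $(x\wedge y)\vee z=(x\vee z)\wedge(y\vee z)$ for all $y,z\in L$; upper-modular if $(z\vee y)\wedge x=(z\wedge x)\vee y$ for all $y,z\in L$ with $y\le x$; lower-modular if $(z\wedge y)\vee x=(z\vee x)\wedge y$ for all $y,z\in L$ with $x\le y$. *)

theory Defs
  imports "HOL-Algebra.Group" "HOL-Library.Infinite_Typeclass"
begin

record 'a unary_alg = "'a partial_object" +
  mul :: "'a \<Rightarrow> 'a \<Rightarrow> 'a"
  bar :: "'a \<Rightarrow> 'a"

definition algebra_21 :: "'a unary_alg \<Rightarrow> bool" where
  "algebra_21 S \<longleftrightarrow> carrier S \<noteq> {} \<and>
     (\<forall>x\<in>carrier S. \<forall>y\<in>carrier S. mul S x y \<in> carrier S) \<and>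
     (\<forall>x\<in>carrier S. bar S x \<in> carrier S)"

definition semigroup_21 :: "'a unary_alg \<Rightarrow> bool" where
  "semigroup_21 S \<longleftrightarrow> algebra_21 S \<and>
     (\<forall>x\<in>carrier S. \<forall>y\<in>carrier S. \<forall>z\<in>carrier S.
        mul S (mul S x y) z = mul S x (mul S y z))"

text \<open>A semigroup has only positive powers: \<open>pow_Suc S x n\<close> is $x^{n+1}$.\<close>

primrec pow_Suc :: "'a unary_alg \<Rightarrow> 'a \<Rightarrow> nat \<Rightarrow> 'a" where
  "pow_Suc S x 0 = x"
| "pow_Suc S x (Suc n) = mul S (pow_Suc S x n) x"

definition restrict_to :: "'a unary_alg \<Rightarrow> 'a set \<Rightarrow> 'a \<Rightarrow> 'a monoid" where
  "restrict_to S G e = \<lparr>carrier = G, mult = mul S, one = e\<rparr>"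

definition subgroup_with_unit :: "'a unary_alg \<Rightarrow> 'a set \<Rightarrow> 'a \<Rightarrow> bool" where
  "subgroup_with_unit S G e \<longleftrightarrow> G \<subseteq> carrier S \<and> group (restrict_to S G e)"

definition subgroup_of :: "'a unary_alg \<Rightarrow> 'a set \<Rightarrow> bool" where
  "subgroup_of S G \<longleftrightarrow> (\<exists>e. subgroup_with_unit S G e)"

definition maximal_subgroup :: "'a unary_alg \<Rightarrow> 'a set \<Rightarrow> bool" where
  "maximal_subgroup S G \<longleftrightarrow> subgroup_of S G \<and>
     (\<forall>H. subgroup_of S H \<and> G \<subseteq> H \<longrightarrow> H = G)"

definition is_epigroup :: "'a unary_alg \<Rightarrow> bool" where
  "is_epigroup S \<longleftrightarrow> semigroup_21 S \<and>
     (\<forall>x\<in>carrier S. \<exists>n G. subgroup_of S G \<and> pow_Suc S x n \<in> G)"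

text \<open>
  In an epigroup, distinct maximal subgroups are disjoint and all the powers of $x$ that lie
  in subgroups lie in one and the same maximal subgroup, so the descriptions below are
  uniquely satisfied.
\<close>

definition max_subgroup_of_elem :: "'a unary_alg \<Rightarrow> 'a \<Rightarrow> 'a set" where
  "max_subgroup_of_elem S x = (THE G. maximal_subgroup S G \<and> (\<exists>n. pow_Suc S x n \<in> G))"

definition omega :: "'a unary_alg \<Rightarrow> 'a \<Rightarrow> 'a" where
  "omega S x = (THE e. subgroup_with_unit S (max_subgroup_of_elem S x) e)"

definition pseudoinverse :: "'a unary_alg \<Rightarrow> 'a \<Rightarrow> 'a" where
  "pseudoinverse S x =
     inv\<^bsub>restrict_to S (max_subgroup_of_elem S x) (omega S x)\<^esub> (mul S x (omega S x))"

definition epigroup_algebra :: "'a unary_alg \<Rightarrow> bool" where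
  "epigroup_algebra S \<longleftrightarrow> is_epigroup S \<and> (\<forall>x\<in>carrier S. bar S x = pseudoinverse S x)"

datatype uterm = Var nat | Mul uterm uterm | Bar uterm

primrec eval_term :: "'a unary_alg \<Rightarrow> (nat \<Rightarrow> 'a) \<Rightarrow> uterm \<Rightarrow> 'a" where
  "eval_term S v (Var i) = v i"
| "eval_term S v (Mul s t) = mul S (eval_term S v s) (eval_term S v t)"
| "eval_term S v (Bar t) = bar S (eval_term S v t)"

definition satisfies :: "'a unary_alg \<Rightarrow> uterm \<times> uterm \<Rightarrow> bool" where
  "satisfies S p \<longleftrightarrow>
     (\<forall>v. (\<forall>i. v i \<in> carrier S) \<longrightarrow> eval_term S v (fst p) = eval_term S v (snd p))"

definition models :: "(uterm \<times> uterm) set \<Rightarrow> 'a unary_alg set" where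
  "models E = {S. algebra_21 S \<and> (\<forall>p\<in>E. satisfies S p)}"

text \<open>
  A variety is an equational class, represented by its members whose carrier is a set of
  elements of \<open>'a\<close>. When \<open>'a\<close> is infinite, nothing is lost: an identity that fails
  in an algebra fails in a countable subalgebra, and an algebra is an epigroup algebra if all
  its countable subalgebras are; so varieties, inclusion, and the property of consisting
  of epigroups are all determined by the countable members.
\<close>

definition variety :: "'a unary_alg set \<Rightarrow> bool" where
  "variety V \<longleftrightarrow> (\<exists>E. V = models E)"

definition epigroup_variety :: "'a unary_alg set \<Rightarrow> bool" where
  "epigroup_variety V \<longleftrightarrow> variety V \<and> (\<forall>S\<in>V. epigroup_algebra S)"

definition EPI :: "'a unary_alg set gorder" where
  "EPI = \<lparr>carrier = {V. epigroup_variety V}, eq = (=), le = (\<subseteq>)\<rparr>"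

text \<open>
  The periodic semigroup varieties below are read as epigroup varieties, i.e. as consisting of
  the same semigroups endowed with pseudoinversion.
\<close>

definition TRIV :: "'a unary_alg set" where
  "TRIV = {S. epigroup_algebra S \<and> (\<forall>x\<in>carrier S. \<forall>y\<in>carrier S. x = y)}"

definition SL :: "'a unary_alg set" where
  "SL = {S. epigroup_algebra S \<and>
     (\<forall>x\<in>carrier S. \<forall>y\<in>carrier S. mul S x y = mul S y x) \<and>
     (\<forall>x\<in>carrier S. mul S x x = x)}"

definition ZM :: "'a unary_alg set" where
  "ZM = {S. epigroup_algebra S \<and>
     (\<exists>z\<in>carrier S. \<forall>x\<in>carrier S. \<forall>y\<in>carrier S. mul S x y = z)}"

definition neutral_elem :: "('a, 'm) gorder_scheme \<Rightarrow> 'a \<Rightarrow> bool" where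
  "neutral_elem L x \<longleftrightarrow> x \<in> carrier L \<and>
     (\<forall>y\<in>carrier L. \<forall>z\<in>carrier L.
        ((x \<squnion>\<^bsub>L\<^esub> y) \<sqinter>\<^bsub>L\<^esub> (y \<squnion>\<^bsub>L\<^esub> z)) \<sqinter>\<^bsub>L\<^esub> (z \<squnion>\<^bsub>L\<^esub> x)
          = ((x \<sqinter>\<^bsub>L\<^esub> y) \<squnion>\<^bsub>L\<^esub> (y \<sqinter>\<^bsub>L\<^esub> z)) \<squnion>\<^bsub>L\<^esub> (z \<sqinter>\<^bsub>L\<^esub> x))"

definition costandard_elem :: "('a, 'm) gorder_scheme \<Rightarrow> 'a \<Rightarrow> bool" where
  "costandard_elem L x \<longleftrightarrow> x \<in> carrier L \<and>
     (\<forall>y\<in>carrier L. \<forall>z\<in>carrier L.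
        (x \<sqinter>\<^bsub>L\<^esub> y) \<squnion>\<^bsub>L\<^esub> z = (x \<squnion>\<^bsub>L\<^esub> z) \<sqinter>\<^bsub>L\<^esub> (y \<squnion>\<^bsub>L\<^esub> z))"

definition upper_modular_elem :: "('a, 'm) gorder_scheme \<Rightarrow> 'a \<Rightarrow> bool" where
  "upper_modular_elem L x \<longleftrightarrow> x \<in> carrier L \<and>
     (\<forall>y\<in>carrier L. \<forall>z\<in>carrier L. y \<sqsubseteq>\<^bsub>L\<^esub> x \<longrightarrow>
        (z \<squnion>\<^bsub>L\<^esub> y) \<sqinter>\<^bsub>L\<^esub> x = (z \<sqinter>\<^bsub>L\<^esub> x) \<squnion>\<^bsub>L\<^esub> y)"

definition lower_modular_elem :: "('a, 'm) gorder_scheme \<Rightarrow> 'a \<Rightarrow> bool" where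
  "lower_modular_elem L x \<longleftrightarrow> x \<in> carrier L \<and>
     (\<forall>y\<in>carrier L. \<forall>z\<in>carrier L. x \<sqsubseteq>\<^bsub>L\<^esub> y \<longrightarrow>
        (z \<sqinter>\<^bsub>L\<^esub> y) \<squnion>\<^bsub>L\<^esub> x = (z \<squnion>\<^bsub>L\<^esub> x) \<sqinter>\<^bsub>L\<^esub> y)"

end

theory Submission
  imports Defs "HOL-Library.Sublist" "HOL-Library.Countable"
begin

text \<open>
  The proof is carried out on the side of identities. Epigroup varieties correspond, with the order
  reversed, to the fully invariant congruences of the algebra of terms that contain the axioms of
  epigroups of some bounded index (\<open>epi_th\<close>, \<open>var_of\<close>). The join of two varieties becomes an
  intersection of theories, and their meet becomes the theory of all chains of identities from
  either theory (\<open>join_EPI\<close>, \<open>meet_EPI\<close>). This rests on three facts: pseudoinversion is described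
  by equations (\<open>epigroup_algebra_iff\<close>), equational logic is complete because the free algebra of
  countable rank lives on every infinite type (\<open>Ids_models\<close>), and the index is bounded in an
  epigroup variety (\<open>epigroup_variety_models\<close>).

  The four varieties are special. The theory of semilattices consists of the identities that preserve
  the content, which is the set of variables of a term. The theory of zero multiplication consists of
  the identities between terms that are not variables, and of the trivial ones. Both are coatoms. An epigroup theory that changes the content of some term
  forces idempotents to be minimal, as in a completely simple semigroup, so that a term equals
  suitable longer terms; one that relates a variable to another term makes all elements group
  elements. Therefore chains of identities can be moved into either coatom, and a theory can be
  recovered from its intersection with the coatom. It follows that the coatoms, and their
  intersection, are distributive, dually distributive and cancellable (\<open>dist_cancel_sl\<close>,
  \<open>dist_cancel_zm\<close>, \<open>dist_cancel_inf\<close>), and these properties imply neutrality and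
  costandardness. It also follows that the theories above the intersection of the coatoms are just
  the four in question (\<open>above_sl_zm\<close>). Neutral elements are lower-modular and upper-modular
  in every lattice (\<open>median_modular\<close>).

  Conversely, let a theory \<open>a\<close> be costandard, or lower-modular and upper-modular. Test varieties show
  that it contains the intersection of the coatoms. With nilpotent algebras that identify
  \<open>y x\<^sup>n z\<close> with \<open>x\<^sup>n z z y\<close> or with \<open>x\<^sup>n z y y\<close>, one forces one of these identities upon \<open>a\<close>
  (\<open>costandard_UW\<close>, \<open>lower_modular_UW\<close>): the class of \<open>y x\<^sup>n z\<close> modulo such an algebra has just two
  words, while a chain through longer words leads out of it. Consequently the members of the
  variety are nil extensions of semilattices, with central idempotents (\<open>nilsemiI\<close>). Four algebras with
  three or four elements then show that \<open>a\<close> relates \<open>x y\<close> to some term other than \<open>x y\<close> and \<open>y x\<close>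
  (\<open>costandard_above\<close>, \<open>modular_above\<close>). From this it is elementary that all
  products are idempotent (\<open>products_absorbing\<close>), which is to say that \<open>a\<close> contains all identities
  common to semilattices and zero multiplication.
\<close>

section \<open>Pseudoinversion described by equations\<close>

locale sgrp =
  fixes S :: "'a unary_alg"
  assumes semigroup: "semigroup_21 S"
begin

abbreviation prod_S (infixl "\<cdot>" 70) where "a \<cdot> b \<equiv> mul S a b"
abbreviation "C \<equiv> carrier S"
abbreviation "pw \<equiv> pow_Suc S"

lemma mul_closed [simp, intro]: "a \<in> C \<Longrightarrow> b \<in> C \<Longrightarrow> a \<cdot> b \<in> C"
  and bar_closed [simp, intro]: "a \<in> C \<Longrightarrow> bar S a \<in> C"
  and assoc: "a \<in> C \<Longrightarrow> b \<in> C \<Longrightarrow> c \<in> C \<Longrightarrow> a \<cdot> b \<cdot> c = a \<cdot> (b \<cdot> c)"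
  and algebra: "algebra_21 S"
  using semigroup by (auto simp: semigroup_21_def algebra_21_def)

lemma pow_closed [simp, intro]: "a \<in> C \<Longrightarrow> pw a n \<in> C"
  by (induction n) auto

lemma pow_add: "a \<in> C \<Longrightarrow> pw a m \<cdot> pw a n = pw a (Suc (m + n))"
  by (induction n) (auto simp: assoc[symmetric])

lemma pow_pow: "a \<in> C \<Longrightarrow> pw (pw a m) n = pw a (m + n * Suc m)"
  by (induction n) (auto simp: pow_add algebra_simps)

lemma pow_commute:
  assumes "a \<in> C" "c \<in> C" "a \<cdot> c = c \<cdot> a" shows "pw a k \<cdot> c = c \<cdot> pw a k"
proof (induction k)
  case (Suc k)
  have "pw a (Suc k) \<cdot> c = pw a k \<cdot> c \<cdot> a" using assms by (simp add: assoc)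
  then show ?case unfolding Suc using assms by (simp add: assoc)
qed (use assms in simp)

lemma pow_idem: "e \<cdot> e = e \<Longrightarrow> pw e n = e"
  by (induction n) auto

lemma pow_inverse:
  assumes x: "x \<in> C" and b: "b \<in> C" and c: "x \<cdot> b = b \<cdot> x" and bxb: "b \<cdot> x \<cdot> b = b"
  shows "pw x k \<cdot> pw b k = x \<cdot> b \<and> pw b k \<cdot> pw x k = x \<cdot> b"
proof (induction k)
  case 0 then show ?case using c by simp
next
  case (Suc k)
  have xk: "x \<cdot> pw x k = pw x (Suc k)" "b \<cdot> pw b k = pw b (Suc k)"
    using pow_add[OF x, of 0 k] pow_add[OF b, of 0 k] by simp_all
  have e: "x \<cdot> b \<cdot> b = b" using x b c bxb by (simp add: assoc)
  have "pw x (Suc k) \<cdot> pw b (Suc k) = x \<cdot> (pw x k \<cdot> pw b k) \<cdot> b"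
    unfolding xk(1)[symmetric] using x b by (simp add: assoc)
  also have "\<dots> = x \<cdot> (x \<cdot> b \<cdot> b)" using Suc x b by (simp add: assoc)
  finally have a: "pw x (Suc k) \<cdot> pw b (Suc k) = x \<cdot> b" unfolding e .
  have "pw b (Suc k) \<cdot> pw x (Suc k) = b \<cdot> (pw b k \<cdot> pw x k) \<cdot> x"
    unfolding xk(2)[symmetric] using x b by (simp add: assoc)
  also have "\<dots> = b \<cdot> x \<cdot> b \<cdot> x" using Suc x b by (simp add: assoc)
  finally show ?case using a c bxb by simp
qed

text \<open>
  The group of units of the monoid \<open>e S e\<close>, which is the largest subgroup with unit \<open>e\<close>.
\<close>

definition unit_group :: "'a \<Rightarrow> 'a set" where
  "unit_group e = {y \<in> C. e \<cdot> y = y \<and> y \<cdot> e = y \<and>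
     (\<exists>z\<in>C. e \<cdot> z = z \<and> z \<cdot> e = z \<and> y \<cdot> z = e \<and> z \<cdot> y = e)}"

lemma unit_in_unit_group: "e \<in> C \<Longrightarrow> e \<cdot> e = e \<Longrightarrow> e \<in> unit_group e"
  by (auto simp: unit_group_def)

lemma mult_unit_group:
  assumes "x \<in> unit_group e" "y \<in> unit_group e" shows "x \<cdot> y \<in> unit_group e"
proof -
  from assms obtain x' y' where C: "x \<in> C" "y \<in> C" "x' \<in> C" "y' \<in> C"
    and x: "e \<cdot> x = x" "x \<cdot> e = x" "e \<cdot> x' = x'" "x' \<cdot> e = x'" "x \<cdot> x' = e" "x' \<cdot> x = e"
    and y: "e \<cdot> y = y" "y \<cdot> e = y" "e \<cdot> y' = y'" "y' \<cdot> e = y'" "y \<cdot> y' = e" "y' \<cdot> y = e"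
    by (auto simp: unit_group_def)
  have e: "e \<in> C" using C x by (metis mul_closed)
  have "x \<cdot> y \<cdot> (y' \<cdot> x') = x \<cdot> (y \<cdot> y') \<cdot> x'" using C by (simp add: assoc)
  then have 1: "x \<cdot> y \<cdot> (y' \<cdot> x') = e" using x y by simp
  have "y' \<cdot> x' \<cdot> (x \<cdot> y) = y' \<cdot> (x' \<cdot> x) \<cdot> y" using C by (simp add: assoc)
  then have 2: "y' \<cdot> x' \<cdot> (x \<cdot> y) = e" using x y by simp
  have 3: "e \<cdot> (x \<cdot> y) = x \<cdot> y" "x \<cdot> y \<cdot> e = x \<cdot> y" "e \<cdot> (y' \<cdot> x') = y' \<cdot> x'" "y' \<cdot> x' \<cdot> e = y' \<cdot> x'"
    using C e x y by (simp_all add: assoc) (simp_all add: assoc[symmetric])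
  have "y' \<cdot> x' \<in> C" using C by simp
  then show ?thesis unfolding unit_group_def using C e 1 2 3 by blast
qed

lemma pow_unit_group: "x \<in> unit_group e \<Longrightarrow> pw x n \<in> unit_group e"
  by (induction n) (auto simp: mult_unit_group)

lemma unit_group_subgroup:
  assumes "e \<in> C" "e \<cdot> e = e"
  shows "subgroup_with_unit S (unit_group e) e"
  unfolding subgroup_with_unit_def restrict_to_def
proof
  show "unit_group e \<subseteq> C" by (auto simp: unit_group_def)
  show "group \<lparr>carrier = unit_group e, mult = mul S, one = e\<rparr>"
  proof (rule groupI; simp)
    show "e \<in> unit_group e" using assms by (rule unit_in_unit_group)
  next
    fix x y z assume "x \<in> unit_group e" "y \<in> unit_group e" "z \<in> unit_group e"
    then show "x \<cdot> y \<cdot> z = x \<cdot> (y \<cdot> z)" by (auto simp: unit_group_def assoc)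
  next
    fix x assume "x \<in> unit_group e"
    then show "\<exists>y\<in>unit_group e. y \<cdot> x = e" by (fastforce simp: unit_group_def)
  qed (auto simp: mult_unit_group, auto simp: unit_group_def)
qed

lemma subgroup_in_unit_group:
  assumes "subgroup_with_unit S H f"
  shows "f \<in> C" "f \<cdot> f = f" "f \<in> H" "H \<subseteq> unit_group f"
proof -
  let ?G = "\<lparr>carrier = H, mult = mul S, one = f\<rparr>"
  from assms have H: "H \<subseteq> C" and g: "group ?G"
    by (auto simp: subgroup_with_unit_def restrict_to_def)
  interpret G: group ?G by (rule g)
  show f: "f \<in> H" using G.one_closed by simp
  then show "f \<in> C" using H by blast
  show "f \<cdot> f = f" using G.l_one[of f] f by simp
  show "H \<subseteq> unit_group f"
  proof
    fix y assume y: "y \<in> H"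
    then have "m_inv ?G y \<in> H" using G.inv_closed[of y] by simp
    then show "y \<in> unit_group f" unfolding unit_group_def
      using y H G.l_one[of y] G.r_one[of y] G.l_inv[of y] G.r_inv[of y]
        G.l_one[of "m_inv ?G y"] G.r_one[of "m_inv ?G y"] by auto
  qed
qed

text \<open>
  A common member \<open>y\<close>, with inverses \<open>z\<close> and \<open>z'\<close> in the two groups, gives
  \<open>e f = e (y z') = f\<close> and \<open>e f = (z y) f = e\<close>. Hence maximal subgroups are disjoint.
\<close>

lemma units_agree:
  assumes "y \<in> unit_group e" "y \<in> unit_group f" shows "e = f"
proof -
  from assms obtain z z' where C: "y \<in> C" "z \<in> C" "z' \<in> C"
    and z: "e \<cdot> y = y" "y \<cdot> e = y" "y \<cdot> z = e" "z \<cdot> y = e"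
    and z': "f \<cdot> y = y" "y \<cdot> f = y" "y \<cdot> z' = f" "z' \<cdot> y = f"
    by (auto simp: unit_group_def)
  have ef: "e \<in> C" "f \<in> C" using C z z' by auto
  have "e \<cdot> f = e \<cdot> (y \<cdot> z')" using z' by simp
  also have "\<dots> = e \<cdot> y \<cdot> z'" using C ef by (simp add: assoc)
  finally have 1: "e \<cdot> f = f" using z z' by simp
  have "e \<cdot> f = z \<cdot> y \<cdot> f" using z by simp
  also have "\<dots> = z \<cdot> (y \<cdot> f)" using C ef by (simp add: assoc)
  finally have "e \<cdot> f = e" using z z' by simp
  with 1 show ?thesis by simp
qed

text \<open>
  Two powers of \<open>x\<close> that lie in subgroups have a common power, so by disjointness all such
  powers lie in one and the same maximal subgroup.
\<close>

lemma max_subgroup_unique: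
  assumes e: "e \<in> C" "e \<cdot> e = e" and x: "x \<in> C" and n: "pw x n \<in> unit_group e"
  shows "max_subgroup_of_elem S x = unit_group e" "omega S x = e"
proof -
  have sub: "subgroup_of S (unit_group e)"
    using unit_group_subgroup[OF e] by (auto simp: subgroup_of_def)
  have mx: "maximal_subgroup S (unit_group e)"
    unfolding maximal_subgroup_def
  proof (intro conjI allI impI sub)
    fix H assume H: "subgroup_of S H \<and> unit_group e \<subseteq> H"
    then obtain f where f: "subgroup_with_unit S H f" by (auto simp: subgroup_of_def)
    have "e \<in> unit_group f"
      using H subgroup_in_unit_group(4)[OF f] unit_in_unit_group[OF e] by blast
    then have "e = f" using units_agree unit_in_unit_group[OF e] by blast
    then show "H = unit_group e" using H subgroup_in_unit_group(4)[OF f] by blast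
  qed
  have uniq: "G = unit_group e" if G: "maximal_subgroup S G" "pw x k \<in> G" for G k
  proof -
    from G obtain f where f: "subgroup_with_unit S G f"
      by (auto simp: maximal_subgroup_def subgroup_of_def)
    note f' = subgroup_in_unit_group[OF f]
    have "subgroup_of S (unit_group f)"
      using unit_group_subgroup[OF f'(1,2)] by (auto simp: subgroup_of_def)
    then have Gf: "G = unit_group f" using G f'(4) by (auto simp: maximal_subgroup_def)
    have "pw (pw x k) n = pw (pw x n) k" by (simp add: pow_pow x algebra_simps)
    moreover have "pw (pw x k) n \<in> unit_group f" using Gf G pow_unit_group by blast
    moreover have "pw (pw x n) k \<in> unit_group e" using n pow_unit_group by blast
    ultimately show ?thesis using units_agree Gf by metis
  qed
  show m: "max_subgroup_of_elem S x = unit_group e"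
    unfolding max_subgroup_of_elem_def using mx n uniq by (intro the_equality) blast+
  show "omega S x = e"
    unfolding omega_def m
  proof (rule the_equality)
    show "subgroup_with_unit S (unit_group e) e" by (rule unit_group_subgroup[OF e])
  next
    fix f assume f: "subgroup_with_unit S (unit_group e) f"
    from subgroup_in_unit_group[OF f] unit_in_unit_group[of f] units_agree
    show "f = e" by metis
  qed
qed

text \<open>
  Three equations determine the pseudoinverse. With them, pseudoinversion becomes accessible to
  equational logic: for fixed \<open>n\<close> they are identities.
\<close>

lemma pseudoinverseI:
  assumes x: "x \<in> C" and b: "b \<in> C" and c: "x \<cdot> b = b \<cdot> x" and bxb: "b \<cdot> x \<cdot> b = b"
    and n: "pw x (Suc n) \<cdot> b = pw x n"
  shows "pw x n \<in> unit_group (x \<cdot> b)" "pseudoinverse S x = b"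
proof -
  define e where "e = x \<cdot> b"
  have "e \<cdot> e = x \<cdot> (b \<cdot> x \<cdot> b)" using x b by (simp add: e_def assoc)
  then have e: "e \<in> C" "e \<cdot> e = e" using x b bxb by (auto simp: e_def)
  have "x \<cdot> e = x \<cdot> (b \<cdot> x)" "b \<cdot> e = b \<cdot> x \<cdot> b" "e \<cdot> b = b \<cdot> x \<cdot> b"
    using x b c by (simp_all add: e_def assoc)
  then have xe: "x \<cdot> e = e \<cdot> x" "b \<cdot> e = b" "e \<cdot> b = b"
    using x b bxb by (simp_all add: e_def assoc)
  have powb: "pw x k \<cdot> b = b \<cdot> pw x k" for k
    using pow_commute[OF x b c] .
  have 1: "pw x n \<cdot> e = pw x n" using n x b by (simp add: e_def assoc)
  have 2: "e \<cdot> pw x n = pw x n"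
  proof -
    have "e \<cdot> pw x n = b \<cdot> (x \<cdot> pw x n)" using x b c by (simp add: e_def assoc)
    also have "x \<cdot> pw x n = pw x (Suc n)" using pow_add[OF x, of 0 n] by simp
    finally show ?thesis using powb[of "Suc n"] n by simp
  qed
  have pp: "pw x k \<cdot> pw b k = e \<and> pw b k \<cdot> pw x k = e" for k
    using pow_inverse[OF x b c bxb] e_def by simp
  have ebn: "pw b n \<cdot> e = pw b n" "e \<cdot> pw b n = pw b n"
    by (induction n) (use b e xe in \<open>simp_all add: assoc\<close>, simp_all add: assoc[symmetric])
  show in_e: "pw x n \<in> unit_group (x \<cdot> b)"
    unfolding e_def[symmetric] unit_group_def
    using 1 2 x b pp[of n] ebn by (auto intro!: bexI[of _ "pw b n"])
  note m = max_subgroup_unique[OF e x in_e[folded e_def]]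
  have "e \<cdot> x \<cdot> e = e \<cdot> (x \<cdot> e)" "e \<cdot> (e \<cdot> x) = e \<cdot> e \<cdot> x" "e \<cdot> x \<cdot> b = e \<cdot> (x \<cdot> b)" "b \<cdot> (x \<cdot> e) = b \<cdot> x \<cdot> e"
    using x b e(1) by (simp_all add: assoc)
  then have xe': "x \<cdot> e \<in> C" "x \<cdot> e \<cdot> e = x \<cdot> e" "e \<cdot> (x \<cdot> e) = x \<cdot> e" "x \<cdot> e \<cdot> b = e" "b \<cdot> (x \<cdot> e) = e"
    using e xe x b e_def c by simp_all
  have bG: "b \<in> unit_group e" and xG: "x \<cdot> e \<in> unit_group e"
    unfolding unit_group_def using b xe xe' by blast+
  let ?G = "restrict_to S (unit_group e) e"
  have g: "group ?G" using unit_group_subgroup[OF e] by (simp add: subgroup_with_unit_def)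
  have "m_inv ?G (x \<cdot> e) = b"
    by (rule group.inv_equality[OF g]) (use bG xG xe' in \<open>auto simp: restrict_to_def\<close>)
  then show "pseudoinverse S x = b" unfolding pseudoinverse_def m .
qed

text \<open>
  If \<open>z\<close> is the inverse of \<open>x\<^sup>n\<close> in its maximal subgroup with unit \<open>e\<close>, then \<open>x\<close> commutes with
  \<open>e\<close> and \<open>z\<close>, and the inverse of \<open>x e\<close> is a power of \<open>x\<close> times \<open>z z\<close>.
\<close>

lemma pseudoinverseD:
  assumes x: "x \<in> C" and G: "subgroup_of S G" "pw x n \<in> G" and b: "b = pseudoinverse S x"
  shows "x \<cdot> b = b \<cdot> x" "b \<cdot> x \<cdot> b = b" "pw x (Suc n) \<cdot> b = pw x n"
proof -
  from G obtain e where e0: "subgroup_with_unit S G e" by (auto simp: subgroup_of_def)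
  note e = subgroup_in_unit_group[OF e0]
  define y where "y = pw x n"
  have y: "y \<in> unit_group e" using G e y_def by blast
  note m = max_subgroup_unique[OF e(1,2) x y[unfolded y_def]]
  from y obtain z where C: "y \<in> C" "z \<in> C" and z: "e \<cdot> y = y" "y \<cdot> e = y"
      "e \<cdot> z = z" "z \<cdot> e = z" "y \<cdot> z = e" "z \<cdot> y = e" by (auto simp: unit_group_def)
  have xy: "x \<cdot> y = y \<cdot> x" using pow_add[OF x, of 0 n] pow_add[OF x, of n 0] by (simp add: y_def)
  have "e \<cdot> x = z \<cdot> y \<cdot> x" using z by simp
  also have "\<dots> = z \<cdot> x \<cdot> y" using C x xy by (simp add: assoc)
  also have "\<dots> = z \<cdot> x \<cdot> y \<cdot> e" using C x z e by (simp add: assoc)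
  also have "\<dots> = z \<cdot> (x \<cdot> y) \<cdot> e" using C x e by (simp add: assoc)
  also have "\<dots> = z \<cdot> y \<cdot> x \<cdot> e" using C x e xy by (simp add: assoc)
  finally have 1: "e \<cdot> x = e \<cdot> x \<cdot> e" using z by simp
  have "x \<cdot> e = x \<cdot> (y \<cdot> z)" using z by simp
  also have "\<dots> = y \<cdot> x \<cdot> z" using C x xy by (simp add: assoc[symmetric])
  also have "\<dots> = e \<cdot> (y \<cdot> x \<cdot> z)" using C x z e by (simp add: assoc[symmetric])
  also have "y \<cdot> x \<cdot> z = x \<cdot> (y \<cdot> z)" using C x xy by (simp add: assoc[symmetric])
  finally have 2: "x \<cdot> e = e \<cdot> x" using 1 z x e by (simp add: assoc)
  have "z \<cdot> x = z \<cdot> (x \<cdot> e)" using C x e z 2 by (metis assoc)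
  also have "\<dots> = z \<cdot> (x \<cdot> y) \<cdot> z" using C x e z by (simp add: assoc)
  also have "\<dots> = z \<cdot> y \<cdot> (x \<cdot> z)" using C x e xy by (simp add: assoc)
  also have "\<dots> = x \<cdot> e \<cdot> z" unfolding z 2 using C x e by (simp add: assoc)
  finally have zx: "z \<cdot> x = x \<cdot> z" using C x e z by (simp add: assoc)
  have xG: "x \<cdot> e \<in> unit_group e"
  proof -
    have p: "x \<cdot> pw x (n + n) = y \<cdot> y"
      using pow_add[OF x, of 0 "n+n"] pow_add[OF x, of n n] by (simp add: y_def)
    \<comment> \<open>Multiplied by \<open>x\<close>, the power in \<open>w\<close> becomes \<open>y y\<close>.\<close>
    define w where "w = pw x (n + n) \<cdot> z \<cdot> z"
    have pz: "pw x k \<cdot> z = z \<cdot> pw x k" for k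
      using pow_commute[OF x C(2) zx[symmetric]] .
    have px: "pw x (n + n) \<cdot> x = x \<cdot> pw x (n + n)"
      using pow_add[OF x, of 0 "n+n"] by simp
    have "w \<cdot> e = pw x (n + n) \<cdot> z \<cdot> (z \<cdot> e)"
      using x C e(1) by (simp add: w_def assoc)
    moreover have "w = z \<cdot> pw x (n + n) \<cdot> z" by (simp only: w_def pz)
    then have "e \<cdot> w = e \<cdot> z \<cdot> pw x (n + n) \<cdot> z"
      using x C e(1) by (simp add: assoc)
    ultimately have w: "w \<in> C" "w \<cdot> e = w" "e \<cdot> w = w"
      using x C z pz[of "n+n"] by (simp_all add: w_def)
    have "x \<cdot> w = y \<cdot> y \<cdot> z \<cdot> z" unfolding p[symmetric] w_def using x C by (simp add: assoc)
    also have "\<dots> = y \<cdot> (y \<cdot> z) \<cdot> z" using C by (simp add: assoc)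
    finally have xw: "x \<cdot> w = e" using z by simp
    have "w \<cdot> x = pw x (n + n) \<cdot> z \<cdot> (z \<cdot> x)" unfolding w_def using x C by (simp add: assoc)
    also have "\<dots> = pw x (n + n) \<cdot> z \<cdot> (x \<cdot> z)" unfolding zx ..
    also have "\<dots> = pw x (n + n) \<cdot> (z \<cdot> x) \<cdot> z" using x C by (simp add: assoc)
    also have "\<dots> = pw x (n + n) \<cdot> x \<cdot> z \<cdot> z" unfolding zx using x C by (simp add: assoc)
    also have "\<dots> = x \<cdot> w" unfolding w_def px using x C by (simp add: assoc)
    finally have wx: "w \<cdot> x = e" using xw by simp
    show ?thesis unfolding unit_group_def
      using x e w 2 xw wx by (auto intro!: bexI[of _ w] simp: assoc[symmetric]) (auto simp: assoc)
  qed
  let ?G = "restrict_to S (unit_group e) e"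
  interpret G: group ?G using unit_group_subgroup[OF e(1,2)] by (simp add: subgroup_with_unit_def)
  have b': "b = m_inv ?G (x \<cdot> e)" using b by (simp add: pseudoinverse_def m)
  have "b \<in> unit_group e" using G.inv_closed[of "x \<cdot> e"] xG by (simp add: b' restrict_to_def)
  then have bC: "b \<in> C" "e \<cdot> b = b" "b \<cdot> e = b" by (auto simp: unit_group_def)
  have "b \<cdot> (x \<cdot> e) = e" "x \<cdot> e \<cdot> b = e"
    using G.l_inv[of "x \<cdot> e"] G.r_inv[of "x \<cdot> e"] xG by (auto simp: b' restrict_to_def)
  moreover have "x \<cdot> e \<cdot> b = x \<cdot> (e \<cdot> b)" using bC x e(1) by (simp add: assoc)
  moreover have "b \<cdot> (x \<cdot> e) = b \<cdot> e \<cdot> x" using bC(1) x e(1) 2 by (simp add: assoc)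
  ultimately have bx: "b \<cdot> x = e" "x \<cdot> b = e" using bC by simp_all
  then show "x \<cdot> b = b \<cdot> x" "b \<cdot> x \<cdot> b = b" using bC by simp_all
  show "pw x (Suc n) \<cdot> b = pw x n"
    using bx x bC z by (simp add: assoc y_def)
qed

end

lemma epigroup_algebra_iff:
  "epigroup_algebra S \<longleftrightarrow> semigroup_21 S \<and> (\<forall>x\<in>carrier S.
     mul S x (bar S x) = mul S (bar S x) x \<and> mul S (mul S (bar S x) x) (bar S x) = bar S x \<and>
     (\<exists>n. mul S (pow_Suc S x (Suc n)) (bar S x) = pow_Suc S x n))" (is "?l \<longleftrightarrow> ?r")
proof
  assume l: ?l
  then interpret sgrp S by unfold_locales (simp add: epigroup_algebra_def is_epigroup_def)
  show ?r
  proof (intro conjI ballI semigroup)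
    fix x assume x: "x \<in> C"
    then obtain n G where G: "subgroup_of S G" "pw x n \<in> G"
      using l by (auto simp: epigroup_algebra_def is_epigroup_def)
    have b: "bar S x = pseudoinverse S x" using l x by (simp add: epigroup_algebra_def)
    from pseudoinverseD[OF x G b] show "x \<cdot> bar S x = bar S x \<cdot> x" "bar S x \<cdot> x \<cdot> bar S x = bar S x"
      "\<exists>n. pw x (Suc n) \<cdot> bar S x = pw x n" by blast+
  qed
next
  assume r: ?r
  then interpret sgrp S by unfold_locales simp
  show ?l unfolding epigroup_algebra_def is_epigroup_def
  proof (intro conjI ballI semigroup)
    fix x assume x: "x \<in> C"
    then obtain n where n: "x \<cdot> bar S x = bar S x \<cdot> x" "bar S x \<cdot> x \<cdot> bar S x = bar S x"
      "pw x (Suc n) \<cdot> bar S x = pw x n" using r by blast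
    note p = pseudoinverseI[OF x _ n]
    show "bar S x = pseudoinverse S x" using p(2) x by simp
    have "x \<cdot> bar S x \<cdot> (x \<cdot> bar S x) = x \<cdot> (bar S x \<cdot> x \<cdot> bar S x)"
      using x by (simp add: assoc)
    then have "x \<cdot> bar S x \<cdot> (x \<cdot> bar S x) = x \<cdot> bar S x" using n(2) by simp
    then have "subgroup_of S (unit_group (x \<cdot> bar S x))"
      using unit_group_subgroup[of "x \<cdot> bar S x"] x by (auto simp: subgroup_of_def)
    then show "\<exists>n G. subgroup_of S G \<and> pw x n \<in> G" using p(1) x by blast
  qed
qed

section \<open>Equational theories and the free algebra\<close>

primrec subst :: "(nat \<Rightarrow> uterm) \<Rightarrow> uterm \<Rightarrow> uterm" where
  "subst \<sigma> (Var i) = \<sigma> i"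
| "subst \<sigma> (Mul s t) = Mul (subst \<sigma> s) (subst \<sigma> t)"
| "subst \<sigma> (Bar t) = Bar (subst \<sigma> t)"

primrec vars :: "uterm \<Rightarrow> nat set" where
  "vars (Var i) = {i}"
| "vars (Mul s t) = vars s \<union> vars t"
| "vars (Bar t) = vars t"

primrec tpow :: "uterm \<Rightarrow> nat \<Rightarrow> uterm" where
  "tpow t 0 = t"
| "tpow t (Suc n) = Mul (tpow t n) t"

lemma eval_subst: "eval_term S v (subst \<sigma> t) = eval_term S (\<lambda>i. eval_term S v (\<sigma> i)) t"
  by (induction t) auto

lemma subst_Var [simp]: "subst Var t = t"
  by (induction t) auto

lemma vars_subst: "vars (subst \<sigma> t) = (\<Union>i\<in>vars t. vars (\<sigma> i))"
  by (induction t) auto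

lemma subst_cong: "(\<And>i. i \<in> vars t \<Longrightarrow> \<sigma> i = \<tau> i) \<Longrightarrow> subst \<sigma> t = subst \<tau> t"
  by (induction t) auto

lemma vars_nonempty [simp]: "vars t \<noteq> {}"
  by (induction t) auto

lemma eval_tpow [simp]: "eval_term S v (tpow t n) = pow_Suc S (eval_term S v t) n"
  by (induction n) auto

lemma eval_closed:
  "algebra_21 S \<Longrightarrow> (\<And>i. v i \<in> carrier S) \<Longrightarrow> eval_term S v t \<in> carrier S"
  by (induction t) (auto simp: algebra_21_def)

lemma eval_cong: "(\<And>i. i \<in> vars t \<Longrightarrow> v i = w i) \<Longrightarrow> eval_term S v t = eval_term S w t"
  by (induction t) auto

text \<open>
  The fully invariant congruences of the algebra of terms.
\<close>

definition eq_theory :: "(uterm \<times> uterm) set \<Rightarrow> bool" where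
  "eq_theory \<theta> \<longleftrightarrow> equiv UNIV \<theta> \<and>
     (\<forall>s s' t t'. (s, s') \<in> \<theta> \<longrightarrow> (t, t') \<in> \<theta> \<longrightarrow> (Mul s t, Mul s' t') \<in> \<theta>) \<and>
     (\<forall>s t. (s, t) \<in> \<theta> \<longrightarrow> (Bar s, Bar t) \<in> \<theta>) \<and>
     (\<forall>\<sigma> s t. (s, t) \<in> \<theta> \<longrightarrow> (subst \<sigma> s, subst \<sigma> t) \<in> \<theta>)"

lemma eq_theoryI:
  assumes "\<And>t. (t, t) \<in> \<theta>" "\<And>s t. (s, t) \<in> \<theta> \<Longrightarrow> (t, s) \<in> \<theta>"
    "\<And>s t u. (s, t) \<in> \<theta> \<Longrightarrow> (t, u) \<in> \<theta> \<Longrightarrow> (s, u) \<in> \<theta>"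
    "\<And>s s' t t'. (s, s') \<in> \<theta> \<Longrightarrow> (t, t') \<in> \<theta> \<Longrightarrow> (Mul s t, Mul s' t') \<in> \<theta>"
    "\<And>s t. (s, t) \<in> \<theta> \<Longrightarrow> (Bar s, Bar t) \<in> \<theta>"
    "\<And>\<sigma> s t. (s, t) \<in> \<theta> \<Longrightarrow> (subst \<sigma> s, subst \<sigma> t) \<in> \<theta>"
  shows "eq_theory \<theta>"
proof -
  have "refl \<theta>" "sym \<theta>" "trans \<theta>"
    using assms(1) by (simp add: refl_on_def) (use assms(2,3) in \<open>blast intro: symI transI\<close>)+
  then show ?thesis unfolding eq_theory_def using assms(4-6) by (auto intro: equivI)
qed

lemma eq_theoryD:
  assumes "eq_theory \<theta>"
  shows "(t, t) \<in> \<theta>" "(s, t) \<in> \<theta> \<Longrightarrow> (t, s) \<in> \<theta>"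
    "(s, t) \<in> \<theta> \<Longrightarrow> (t, u) \<in> \<theta> \<Longrightarrow> (s, u) \<in> \<theta>"
    "(s, s') \<in> \<theta> \<Longrightarrow> (t, t') \<in> \<theta> \<Longrightarrow> (Mul s t, Mul s' t') \<in> \<theta>"
    "(s, t) \<in> \<theta> \<Longrightarrow> (Bar s, Bar t) \<in> \<theta>"
    "(s, t) \<in> \<theta> \<Longrightarrow> (subst \<sigma> s, subst \<sigma> t) \<in> \<theta>"
  using assms unfolding eq_theory_def equiv_def refl_on_def by (auto dest: symD transD)

definition Ids :: "'a unary_alg set \<Rightarrow> (uterm \<times> uterm) set" where
  "Ids V = {p. \<forall>S\<in>V. satisfies S p}"

lemma in_Ids: "(s, t) \<in> Ids V \<longleftrightarrow>
   (\<forall>S\<in>V. \<forall>v. (\<forall>i. v i \<in> carrier S) \<longrightarrow> eval_term S v s = eval_term S v t)"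
  by (auto simp: Ids_def satisfies_def)

lemma eq_theory_Ids:
  assumes "\<And>S. S \<in> V \<Longrightarrow> algebra_21 S" shows "eq_theory (Ids V)"
proof (rule eq_theoryI)
  fix \<sigma> s t assume "(s, t) \<in> Ids V"
  then show "(subst \<sigma> s, subst \<sigma> t) \<in> Ids V"
    by (simp add: in_Ids eval_subst eval_closed[OF assms])
next
  fix s t u assume "(s, t) \<in> Ids V" "(t, u) \<in> Ids V"
  then show "(s, u) \<in> Ids V" unfolding in_Ids by simp
qed (simp_all add: in_Ids)

instance uterm :: countable by countable_datatype

text \<open>
  The quotient of the set of terms by \<open>\<theta>\<close> is countable, so an infinite type has room for a copy
  of it.
\<close>

lemma free_algebra:
  assumes \<theta>: "eq_theory \<theta>"
  obtains S :: "'a::infinite unary_alg" and q where "S \<in> models \<theta>" "\<And>t. q t \<in> carrier S"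
    "\<And>s t. q s = q t \<longleftrightarrow> (s, t) \<in> \<theta>" "\<And>t. eval_term S (\<lambda>i. q (Var i)) t = q t"
proof -
  note D = eq_theoryD[OF \<theta>]
  obtain f :: "nat \<Rightarrow> 'a" where f: "inj f"
    using infinite_countable_subset[OF infinite_UNIV] by blast
  define r where "r t = (SOME t'. (t, t') \<in> \<theta>)" for t
  define q where "q t = f (to_nat (r t))" for t
  have r: "(t, r t) \<in> \<theta>" for t unfolding r_def by (rule someI) (rule D(1))
  have "r s = r t" if "(s, t) \<in> \<theta>" for s t
  proof -
    have "(\<lambda>t'. (s, t') \<in> \<theta>) = (\<lambda>t'. (t, t') \<in> \<theta>)" using that D(2,3) by blast
    then show ?thesis by (simp add: r_def)
  qed
  moreover have "(s, t) \<in> \<theta>" if "r s = r t" for s t using r[of s] r[of t] that D(2,3) by metis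
  ultimately have "r s = r t \<longleftrightarrow> (s, t) \<in> \<theta>" for s t by blast
  then have q: "q s = q t \<longleftrightarrow> (s, t) \<in> \<theta>" for s t
    by (simp add: q_def inj_eq[OF f])
  define g where "g = inv_into UNIV q"
  define S where "S = \<lparr>carrier = range q, mul = (\<lambda>a b. q (Mul (g a) (g b))),
    bar = (\<lambda>a. q (Bar (g a)))\<rparr>"
  have qg: "q (g a) = a" if "a \<in> range q" for a using that by (simp add: g_def f_inv_into_f)
  have iq: "(g (q t), t) \<in> \<theta>" for t
    using q[of "g (q t)" t] qg[of "q t"] by simp
  have mulq: "mul S (q s) (q t) = q (Mul s t)" for s t
    unfolding S_def using iq D(4) by (simp add: q)
  have barq: "bar S (q s) = q (Bar s)" for s
    unfolding S_def using iq D(5) by (simp add: q)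
  have ev: "eval_term S (\<lambda>i. q (\<sigma> i)) t = q (subst \<sigma> t)" for \<sigma> t
    by (induction t) (auto simp: mulq barq)
  have alg: "algebra_21 S" by (auto simp: algebra_21_def S_def)
  have sat: "satisfies S (s, t)" if st: "(s, t) \<in> \<theta>" for s t
    unfolding satisfies_def
  proof (intro allI impI)
    fix v :: "nat \<Rightarrow> 'a" assume "\<forall>i. v i \<in> carrier S"
    then have "v = (\<lambda>i. q (g (v i)))" by (auto simp: S_def qg)
    then show "eval_term S v (fst (s, t)) = eval_term S v (snd (s, t))"
      using ev D(6)[OF st] q by (metis fst_conv snd_conv)
  qed
  show ?thesis
  proof (rule that[of S q])
    show "S \<in> models \<theta>" using alg sat by (auto simp: models_def)
  qed (use q ev[of Var] in \<open>auto simp: S_def\<close>)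
qed

text \<open>
  Completeness of equational logic: in the free algebra, the valuation that sends each variable
  to its own class refutes every identity outside \<open>\<theta>\<close>.
\<close>

lemma Ids_models:
  assumes \<theta>: "eq_theory \<theta>"
  shows "Ids (models \<theta> :: 'a::infinite unary_alg set) = \<theta>"
proof
  show "\<theta> \<subseteq> Ids (models \<theta> :: 'a unary_alg set)" by (auto simp: Ids_def models_def)
  obtain S :: "'a unary_alg" and q where S: "S \<in> models \<theta>" "\<And>t. q t \<in> carrier S"
    "\<And>s t. q s = q t \<longleftrightarrow> (s, t) \<in> \<theta>" "\<And>t. eval_term S (\<lambda>i. q (Var i)) t = q t"
    using free_algebra[OF \<theta>] by blast
  show "Ids (models \<theta> :: 'a unary_alg set) \<subseteq> \<theta>"
  proof (rule subrelI)
    fix s t assume "(s, t) \<in> Ids (models \<theta> :: 'a unary_alg set)"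
    then have "eval_term S (\<lambda>i. q (Var i)) s = eval_term S (\<lambda>i. q (Var i)) t"
      using S(1,2) by (auto simp: in_Ids)
    then show "(s, t) \<in> \<theta>" by (simp add: S)
  qed
qed

lemma models_Ids: "variety V \<Longrightarrow> models (Ids V) = V"
  unfolding variety_def models_def Ids_def by auto

lemma models_algebra: "S \<in> models E \<Longrightarrow> algebra_21 S"
  by (simp add: models_def)

section \<open>Theories of epigroups\<close>

text \<open>
  Exponents are shifted as in \<^const>\<open>pow_Suc\<close>: the last axiom says that the \<open>(n + 1)\<close>-st power
  of \<open>x\<close> is fixed by the idempotent \<open>x \<cdot> bar x\<close>, and so lies in a subgroup.
\<close>

definition epi_axioms :: "nat \<Rightarrow> (uterm \<times> uterm) set" where
  "epi_axioms n = (let x = Var 0 in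
    {(Mul (Mul x (Var 1)) (Var 2), Mul x (Mul (Var 1) (Var 2))),
     (Mul x (Bar x), Mul (Bar x) x),
     (Mul (Mul (Bar x) x) (Bar x), Bar x),
     (Mul (tpow x (Suc n)) (Bar x), tpow x n)})"

definition epi_theory :: "(uterm \<times> uterm) set \<Rightarrow> bool" where
  "epi_theory \<theta> \<longleftrightarrow> eq_theory \<theta> \<and> (\<exists>n. epi_axioms n \<subseteq> \<theta>)"

definition bounded_epigroup :: "nat \<Rightarrow> 'a unary_alg \<Rightarrow> bool" where
  "bounded_epigroup n S \<longleftrightarrow> semigroup_21 S \<and> (\<forall>x\<in>carrier S.
     mul S x (bar S x) = mul S (bar S x) x \<and> mul S (mul S (bar S x) x) (bar S x) = bar S x \<and>
     mul S (pow_Suc S x (Suc n)) (bar S x) = pow_Suc S x n)"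

lemma bounded_epigroup_iff:
  assumes "algebra_21 S"
  shows "bounded_epigroup n S \<longleftrightarrow> (\<forall>p\<in>epi_axioms n. satisfies S p)"
proof
  assume "bounded_epigroup n S"
  then show "\<forall>p\<in>epi_axioms n. satisfies S p"
    by (auto simp: bounded_epigroup_def semigroup_21_def epi_axioms_def Let_def satisfies_def)
next
  assume sat: "\<forall>p\<in>epi_axioms n. satisfies S p"
  have ev: "eval_term S v s = eval_term S v t"
    if "(s, t) \<in> epi_axioms n" "\<And>i. v i \<in> carrier S" for s t v
    using sat that by (auto simp: satisfies_def)
  have 1: "mul S (mul S x y) z = mul S x (mul S y z)"
    if "x \<in> carrier S" "y \<in> carrier S" "z \<in> carrier S" for x y z
    using ev[of "Mul (Mul (Var 0) (Var 1)) (Var 2)" "Mul (Var 0) (Mul (Var 1) (Var 2))"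
      "\<lambda>i. if i = 0 then x else if i = 1 then y else z"] that
    by (simp add: epi_axioms_def Let_def)
  have 2: "mul S x (bar S x) = mul S (bar S x) x \<and>
     mul S (mul S (bar S x) x) (bar S x) = bar S x \<and>
     mul S (pow_Suc S x (Suc n)) (bar S x) = pow_Suc S x n" if "x \<in> carrier S" for x
    using ev[of "Mul (Var 0) (Bar (Var 0))" "Mul (Bar (Var 0)) (Var 0)" "\<lambda>i. x"]
      ev[of "Mul (Mul (Bar (Var 0)) (Var 0)) (Bar (Var 0))" "Bar (Var 0)" "\<lambda>i. x"]
      ev[of "Mul (tpow (Var 0) (Suc n)) (Bar (Var 0))" "tpow (Var 0) n" "\<lambda>i. x"] that
    by (simp add: epi_axioms_def Let_def)
  show "bounded_epigroup n S"
    unfolding bounded_epigroup_def semigroup_21_def using assms 1 2 by blast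
qed

lemma bounded_epigroup_mono:
  assumes "bounded_epigroup n S" "n \<le> m" shows "bounded_epigroup m S"
proof -
  interpret sgrp S using assms(1) by unfold_locales (simp add: bounded_epigroup_def)
  have "pw x (Suc m) \<cdot> bar S x = pw x m" if x: "x \<in> C" for x
    using assms(2)
  proof (induction m rule: dec_induct)
    case base then show ?case using assms(1) x by (simp add: bounded_epigroup_def)
  next
    case (step k)
    have "pw x (Suc (Suc k)) \<cdot> bar S x = x \<cdot> pw x (Suc k) \<cdot> bar S x"
      using pow_add[OF x, of 0 "Suc k"] by simp
    also have "\<dots> = x \<cdot> (pw x (Suc k) \<cdot> bar S x)" using x by (intro assoc) auto
    also have "\<dots> = pw x (Suc k)" using step pow_add[OF x, of 0 k] by simp
    finally show ?case .
  qed
  then show ?thesis using assms(1) by (auto simp: bounded_epigroup_def)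
qed

lemma bounded_epigroup_epigroup: "bounded_epigroup n S \<Longrightarrow> epigroup_algebra S"
  unfolding bounded_epigroup_def epigroup_algebra_iff by blast

lemma theory_bounded_epigroup:
  assumes "epi_axioms n \<subseteq> \<theta>" "S \<in> models \<theta>" shows "bounded_epigroup n S"
  using bounded_epigroup_iff[of S n] assms by (auto simp: models_def)

text \<open>
  By completeness, membership in a theory can be tested on algebras of natural numbers.
\<close>

lemma theory_member:
  assumes "eq_theory \<theta>" "\<And>S :: nat unary_alg. S \<in> models \<theta> \<Longrightarrow> satisfies S p"
  shows "p \<in> \<theta>"
  using Ids_models[OF assms(1), where 'a = nat] assms(2) by (auto simp: Ids_def)

lemma epi_axioms_mono:
  assumes "eq_theory \<theta>" "epi_axioms n \<subseteq> \<theta>" "n \<le> m" shows "epi_axioms m \<subseteq> \<theta>"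
proof
  fix p assume "p \<in> epi_axioms m"
  then show "p \<in> \<theta>"
    using bounded_epigroup_mono[OF theory_bounded_epigroup[OF assms(2)] assms(3)]
      bounded_epigroup_iff[OF models_algebra] assms(1) theory_member by metis
qed

text \<open>
  The generator of the free algebra has some finite index, and that it does is an identity of
  the variety; so the index is bounded throughout an epigroup variety.
\<close>

lemma epigroup_variety_models:
  assumes \<theta>: "eq_theory \<theta>"
  shows "epigroup_variety (models \<theta> :: 'a::infinite unary_alg set) \<longleftrightarrow> epi_theory \<theta>"
proof
  assume "epi_theory \<theta>"
  then obtain n where "epi_axioms n \<subseteq> \<theta>" by (auto simp: epi_theory_def)
  then show "epigroup_variety (models \<theta> :: 'a unary_alg set)"
    unfolding epigroup_variety_def variety_def
    using theory_bounded_epigroup bounded_epigroup_epigroup by blast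
next
  assume l: "epigroup_variety (models \<theta> :: 'a unary_alg set)"
  obtain F :: "'a unary_alg" and q where F: "F \<in> models \<theta>" "\<And>t. q t \<in> carrier F"
    "\<And>s t. q s = q t \<longleftrightarrow> (s, t) \<in> \<theta>" "\<And>t. eval_term F (\<lambda>i. q (Var i)) t = q t"
    using free_algebra[OF \<theta>] by blast
  have epi: "epigroup_algebra S" if "S \<in> models \<theta>" for S :: "'a unary_alg"
    using l that by (auto simp: epigroup_variety_def)
  have "epigroup_algebra F" using F(1) by (rule epi)
  then obtain n where n: "mul F (pow_Suc F (q (Var 0)) (Suc n)) (bar F (q (Var 0))) = pow_Suc F (q (Var 0)) n"
    using F(2)[of "Var 0"] by (auto simp: epigroup_algebra_iff)
  have "eval_term F (\<lambda>i. q (Var i)) (Mul (tpow (Var 0) (Suc n)) (Bar (Var 0))) =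
      eval_term F (\<lambda>i. q (Var i)) (tpow (Var 0) n)" using n by simp
  then have n': "(Mul (tpow (Var 0) (Suc n)) (Bar (Var 0)), tpow (Var 0) n) \<in> \<theta>"
    by (simp only: F)
  have "p \<in> Ids (models \<theta> :: 'a unary_alg set)" if p: "p \<in> epi_axioms n" for p
    unfolding Ids_def
  proof (intro CollectI ballI)
    fix S :: "'a unary_alg" assume S: "S \<in> models \<theta>"
    have "satisfies S (Mul (tpow (Var 0) (Suc n)) (Bar (Var 0)), tpow (Var 0) n)"
      using S n' by (auto simp: models_def)
    then have "mul S (pow_Suc S x (Suc n)) (bar S x) = pow_Suc S x n" if "x \<in> carrier S" for x
      using that unfolding satisfies_def by (auto dest: spec[of _ "\<lambda>_. x"])
    then have "bounded_epigroup n S"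
      using epi[OF S] by (simp add: bounded_epigroup_def epigroup_algebra_iff)
    then show "satisfies S p" using bounded_epigroup_iff[OF models_algebra[OF S]] p by blast
  qed
  then show "epi_theory \<theta>"
    unfolding epi_theory_def Ids_models[OF \<theta>] using \<theta> by blast
qed

lemma eq_theory_UNIV: "eq_theory UNIV" by (rule eq_theoryI) auto

lemma eq_theory_Int: "eq_theory \<alpha> \<Longrightarrow> eq_theory \<beta> \<Longrightarrow> eq_theory (\<alpha> \<inter> \<beta>)"
  by (rule eq_theoryI) (auto dest: eq_theoryD)

lemma epi_theory_Int:
  assumes "epi_theory \<alpha>" "epi_theory \<beta>" shows "epi_theory (\<alpha> \<inter> \<beta>)"
proof -
  from assms obtain m n where m: "epi_axioms m \<subseteq> \<alpha>" and n: "epi_axioms n \<subseteq> \<beta>"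
    and e: "eq_theory \<alpha>" "eq_theory \<beta>" by (auto simp: epi_theory_def)
  have "epi_axioms (max m n) \<subseteq> \<alpha> \<inter> \<beta>"
    using epi_axioms_mono[OF e(1) m, of "max m n"] epi_axioms_mono[OF e(2) n, of "max m n"] by auto
  then show ?thesis using e eq_theory_Int by (auto simp: epi_theory_def)
qed

lemma eq_theory_rtrancl:
  assumes a: "eq_theory \<alpha>" and b: "eq_theory \<beta>" shows "eq_theory ((\<alpha> \<union> \<beta>)\<^sup>*)"
proof -
  note A = eq_theoryD[OF a] and B = eq_theoryD[OF b]
  let ?R = "(\<alpha> \<union> \<beta>)\<^sup>*"
  have map: "(f s, f t) \<in> ?R" if "(s, t) \<in> ?R"
    "\<And>s t. (s, t) \<in> \<alpha> \<Longrightarrow> (f s, f t) \<in> \<alpha>" "\<And>s t. (s, t) \<in> \<beta> \<Longrightarrow> (f s, f t) \<in> \<beta>" for f s t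
    using that(1) by induction (use that(2,3) in \<open>auto intro: rtrancl_into_rtrancl\<close>)
  show ?thesis
  proof (rule eq_theoryI)
    have "sym (\<alpha> \<union> \<beta>)" by (rule symI) (use A(2) B(2) in blast)
    then show "(t, s) \<in> ?R" if "(s, t) \<in> ?R" for s t
      using that by (blast intro: symD sym_rtrancl)
  next
    fix s s' t t' assume "(s, s') \<in> ?R" "(t, t') \<in> ?R"
    then have "(Mul s t, Mul s' t) \<in> ?R" "(Mul s' t, Mul s' t') \<in> ?R"
      using map[of s s' "\<lambda>s. Mul s t"] map[of t t' "Mul s'"] A(1,4) B(1,4) by auto
    then show "(Mul s t, Mul s' t') \<in> ?R" by (rule rtrancl_trans)
  qed (use map[of _ _ Bar] map[of _ _ "subst _"] A(5,6) B(5,6) in auto)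
qed

lemma epi_theory_rtrancl:
  assumes "epi_theory \<alpha>" "epi_theory \<beta>" shows "epi_theory ((\<alpha> \<union> \<beta>)\<^sup>*)"
  using assms eq_theory_rtrancl unfolding epi_theory_def by blast

text \<open>
  Ordered by inclusion, the theories of epigroups form a lattice. The meet is the intersection,
  and two terms are related by the join if a chain of steps from either theory leads from one to
  the other.
\<close>

typedef epi_th = "{\<theta>. epi_theory \<theta>}" morphisms idents Abs_epi_th
  by (rule exI[of _ UNIV]) (simp add: epi_theory_def eq_theory_UNIV)

lemma epi_idents: "epi_theory (idents a)" using idents by blast

lemma eq_idents: "eq_theory (idents a)" using epi_idents by (simp add: epi_theory_def)

instantiation epi_th :: lattice
begin

definition "inf_epi_th a b = Abs_epi_th (idents a \<inter> idents b)"
definition "sup_epi_th a b = Abs_epi_th ((idents a \<union> idents b)\<^sup>*)"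
definition "less_eq_epi_th a b \<longleftrightarrow> idents a \<subseteq> idents b"
definition "less_epi_th a b \<longleftrightarrow> idents a \<subset> idents b"

lemma idents_inf: "idents (inf a b) = idents a \<inter> idents b"
  unfolding inf_epi_th_def by (simp add: Abs_epi_th_inverse epi_idents epi_theory_Int)

lemma idents_sup: "idents (sup a b) = (idents a \<union> idents b)\<^sup>*"
  unfolding sup_epi_th_def by (simp add: Abs_epi_th_inverse epi_idents epi_theory_rtrancl)

instance
proof
  fix a b c :: epi_th
  show "a \<le> b \<Longrightarrow> b \<le> a \<Longrightarrow> a = b"
    unfolding less_eq_epi_th_def by (simp add: idents_inject)
  show "a \<le> sup a b" "b \<le> sup a b" unfolding less_eq_epi_th_def idents_sup by auto
  assume "b \<le> a" "c \<le> a"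
  then have le: "idents b \<union> idents c \<subseteq> idents a" by (simp add: less_eq_epi_th_def)
  show "sup b c \<le> a" unfolding less_eq_epi_th_def idents_sup
  proof (rule subrelI)
    fix s t assume "(s, t) \<in> (idents b \<union> idents c)\<^sup>*"
    then show "(s, t) \<in> idents a"
      by induction (use le eq_theoryD(1,3)[OF eq_idents[of a]] in blast)+
  qed
qed (auto simp: less_eq_epi_th_def less_epi_th_def idents_inf)

end

section \<open>The lattice of epigroup varieties, dually\<close>

definition var_of :: "epi_th \<Rightarrow> 'a unary_alg set" where
  "var_of a = models (idents a)"

lemma Ids_var_of: "Ids (var_of a :: 'a::infinite unary_alg set) = idents a"
  unfolding var_of_def by (rule Ids_models) (rule eq_idents)

lemma var_of_le: "(var_of a :: 'a::infinite unary_alg set) \<subseteq> var_of b \<longleftrightarrow> b \<le> a"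
proof
  assume "(var_of a :: 'a unary_alg set) \<subseteq> var_of b"
  then have "Ids (var_of b :: 'a unary_alg set) \<subseteq> Ids (var_of a :: 'a unary_alg set)"
    by (auto simp: Ids_def)
  then show "b \<le> a" by (simp add: Ids_var_of less_eq_epi_th_def)
qed (auto simp: var_of_def models_def less_eq_epi_th_def)

lemma var_of_inject: "(var_of a :: 'a::infinite unary_alg set) = var_of b \<longleftrightarrow> a = b"
  using var_of_le[where 'a = 'a, of a b] var_of_le[where 'a = 'a, of b a] by (auto intro: antisym)

lemma carrier_EPI: "V \<in> carrier EPI \<longleftrightarrow> (\<exists>a. V = (var_of a :: 'a::infinite unary_alg set))"
proof
  assume "V \<in> carrier EPI"
  then have V: "epigroup_variety V" by (simp add: EPI_def)
  then have var: "variety V" by (simp add: epigroup_variety_def)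
  then have eq: "eq_theory (Ids V)"
    by (intro eq_theory_Ids) (auto simp: variety_def models_def)
  then have "epi_theory (Ids V)"
    using V epigroup_variety_models[OF eq, where 'a = 'a] by (simp add: models_Ids[OF var])
  then have "V = var_of (Abs_epi_th (Ids V))"
    by (simp add: var_of_def Abs_epi_th_inverse models_Ids[OF var])
  then show "\<exists>a. V = (var_of a :: 'a unary_alg set)" by blast
qed (use epigroup_variety_models[OF eq_idents, where 'a = 'a] epi_idents in \<open>auto simp: EPI_def var_of_def\<close>)

lemma least_EPI_unique: "least EPI x A \<Longrightarrow> least EPI y A \<Longrightarrow> x = y"
  by (auto simp: least_def EPI_def)

lemma greatest_EPI_unique: "greatest EPI x A \<Longrightarrow> greatest EPI y A \<Longrightarrow> x = y"
  by (auto simp: greatest_def EPI_def)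

lemma le_EPI:
  "le EPI (var_of a) (var_of b :: 'a::infinite unary_alg set) \<longleftrightarrow> b \<le> a"
  by (simp add: EPI_def var_of_le)

lemma var_of_EPI [simp]: "(var_of a :: 'a::infinite unary_alg set) \<in> carrier EPI"
  using carrier_EPI by blast

lemma join_EPI:
  "join EPI (var_of a) (var_of b) = (var_of (inf a b) :: 'a::infinite unary_alg set)"
proof -
  have l: "least EPI (var_of (inf a b)) (Upper EPI {var_of a, var_of b :: 'a unary_alg set})"
  proof (rule least_UpperI)
    fix y :: "'a unary_alg set" assume y: "y \<in> Upper EPI {var_of a, var_of b}"
    then obtain c where c: "y = var_of c" using carrier_EPI[of y] by (auto simp: Upper_def)
    have "le EPI (var_of a) y" "le EPI (var_of b) y" using y by (auto simp: Upper_def)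
    then show "le EPI (var_of (inf a b)) y" by (simp add: c le_EPI)
  qed (auto simp: le_EPI)
  show ?thesis unfolding join_def Lattice.sup_def
    by (rule some_equality[where P = "\<lambda>x. least EPI x _", OF l least_EPI_unique[OF _ l]])
qed

lemma meet_EPI:
  "meet EPI (var_of a) (var_of b) = (var_of (sup a b) :: 'a::infinite unary_alg set)"
proof -
  have g: "greatest EPI (var_of (sup a b)) (Lower EPI {var_of a, var_of b :: 'a unary_alg set})"
  proof (rule greatest_LowerI)
    fix y :: "'a unary_alg set" assume y: "y \<in> Lower EPI {var_of a, var_of b}"
    then obtain c where c: "y = var_of c" using carrier_EPI[of y] by (auto simp: Lower_def)
    have "le EPI y (var_of a)" "le EPI y (var_of b)" using y by (auto simp: Lower_def)
    then show "le EPI y (var_of (sup a b))" by (simp add: c le_EPI)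
  qed (auto simp: le_EPI)
  show ?thesis unfolding meet_def Lattice.inf_def
    by (rule some_equality[where P = "\<lambda>x. greatest EPI x _", OF g greatest_EPI_unique[OF _ g]])
qed

lemma all_EPI:
  "(\<forall>y\<in>carrier EPI. P y) \<longleftrightarrow> (\<forall>b. P (var_of b :: 'a::infinite unary_alg set))"
  using carrier_EPI[where 'a = 'a] by metis

lemmas EPI_dual = all_EPI join_EPI meet_EPI var_of_inject le_EPI

text \<open>
  Passing from varieties to theories reverses the order, so each condition below is the order
  dual of the one it translates.
\<close>

lemma neutral_EPI: "neutral_elem EPI (var_of a :: 'a::infinite unary_alg set) \<longleftrightarrow>
   (\<forall>b c. sup (sup (inf a b) (inf b c)) (inf c a) = inf (inf (sup a b) (sup b c)) (sup c a))"
  unfolding neutral_elem_def EPI_dual by simp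

lemma costandard_EPI: "costandard_elem EPI (var_of a :: 'a::infinite unary_alg set) \<longleftrightarrow>
   (\<forall>b c. inf (sup a b) c = sup (inf a c) (inf b c))"
  unfolding costandard_elem_def EPI_dual by simp

lemma upper_modular_EPI: "upper_modular_elem EPI (var_of a :: 'a::infinite unary_alg set) \<longleftrightarrow>
   (\<forall>b c. a \<le> b \<longrightarrow> sup (inf c b) a = inf (sup c a) b)"
  unfolding upper_modular_elem_def EPI_dual by simp

lemma lower_modular_EPI: "lower_modular_elem EPI (var_of a :: 'a::infinite unary_alg set) \<longleftrightarrow>
   (\<forall>b c. b \<le> a \<longrightarrow> inf (sup c b) a = sup (inf c a) b)"
  unfolding lower_modular_elem_def EPI_dual by simp

section \<open>Distributive and cancellable elements of a lattice\<close>

text \<open>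
  An element with these properties is neutral: any two lattice expressions that agree after
  taking the meet with it, and after taking the join with it, are equal. Each of the three
  properties has a meaning of its own for coatoms, see \<open>dist_cancel_coatomI\<close>.
\<close>

definition dist_cancel :: "'l::lattice \<Rightarrow> bool" where
  "dist_cancel a \<longleftrightarrow>
     (\<forall>b c. inf a (sup b c) = sup (inf a b) (inf a c)) \<and>
     (\<forall>b c. sup a (inf b c) = inf (sup a b) (sup a c)) \<and>
     (\<forall>b c. inf a b = inf a c \<longrightarrow> sup a b = sup a c \<longrightarrow> b = c)"

lemma dist_cancelD:
  assumes "dist_cancel a"
  shows "inf a (sup b c) = sup (inf a b) (inf a c)" "sup a (inf b c) = inf (sup a b) (sup a c)"
    "inf a b = inf a c \<Longrightarrow> sup a b = sup a c \<Longrightarrow> b = c"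
  using assms unfolding dist_cancel_def by blast+

text \<open>
  By distributivity, the meets of both sides with \<open>a\<close> agree, and so do the joins.
\<close>

lemma dist_cancel_median:
  assumes a: "dist_cancel a"
  shows "sup (sup (inf a b) (inf b c)) (inf c a) = inf (inf (sup a b) (sup b c)) (sup c a)"
    (is "?l = ?r")
proof (rule dist_cancelD(3)[OF a])
  note D = dist_cancelD(1,2)[OF a]
  have "sup (inf a b) (inf a (inf b c)) = inf a b"
    by (rule sup_absorb1) (auto intro: le_infI1 le_infI2)
  then have "inf a ?l = sup (inf a b) (inf a c)" by (simp add: D(1) inf_commute[of c a])
  also have "\<dots> = inf a ?r"
    unfolding D(1)[symmetric] by (rule antisym) (auto intro: le_supI1 le_supI2 le_infI1 le_infI2)
  finally show "inf a ?l = inf a ?r" .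
  have "inf (sup a b) (sup a (sup b c)) = sup a b"
    by (rule inf_absorb1) (auto intro: le_supI1 le_supI2)
  then have "sup a ?r = inf (sup a b) (sup a c)" by (simp add: D(2) sup_commute[of c a])
  also have "\<dots> = sup a ?l"
    unfolding D(2)[symmetric] by (rule antisym) (auto intro: le_supI1 le_supI2 le_infI1 le_infI2)
  finally show "sup a ?l = sup a ?r" by simp
qed

lemma dist_cancel_costandard:
  assumes a: "dist_cancel a"
  shows "inf (sup a b) c = sup (inf a c) (inf b c)" (is "?l = ?r")
proof (rule dist_cancelD(3)[OF a])
  note D = dist_cancelD(1,2)[OF a]
  have "inf a ?l = inf a c" by (rule antisym) (auto intro: le_supI1 le_supI2 le_infI1 le_infI2)
  also have "\<dots> = inf a ?r"
    unfolding D by (rule antisym) (auto intro: le_supI1 le_supI2 le_infI1 le_infI2)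
  finally show "inf a ?l = inf a ?r" .
  have "sup a ?l = inf (sup a b) (sup a c)"
    unfolding D by (rule antisym) (auto intro: le_supI1 le_supI2 le_infI1 le_infI2)
  also have "\<dots> = sup a ?r"
    unfolding D(2)[symmetric] by (rule antisym) (auto intro: le_supI1 le_supI2 le_infI1 le_infI2)
  finally show "sup a ?l = sup a ?r" .
qed

text \<open>
  If \<open>b\<close> is comparable with \<open>a\<close>, the absorption laws reduce the median equation to a modular law.
\<close>

lemma median_modular:
  assumes med: "\<And>b c :: 'l::lattice.
    sup (sup (inf a b) (inf b c)) (inf c a) = inf (inf (sup a b) (sup b c)) (sup c a)"
  shows "a \<le> b \<Longrightarrow> sup (inf c b) a = inf (sup c a) b" "b \<le> a \<Longrightarrow> inf (sup c b) a = sup (inf c a) b"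
proof -
  show "sup (inf c b) a = inf (sup c a) b" if "a \<le> b"
  proof -
    have "sup (inf c b) a = sup (sup (inf a b) (inf b c)) (inf c a)"
      using that by (simp add: inf_absorb1 sup_absorb1 sup_commute inf_commute sup_assoc sup_inf_absorb
        le_supI1 le_infI2 antisym)
    also have "\<dots> = inf (inf (sup a b) (sup b c)) (sup c a)" by (rule med)
    also have "\<dots> = inf (sup c a) b"
      using that by (simp add: sup_absorb2 inf_sup_absorb inf_commute)
    finally show ?thesis .
  qed
  show "inf (sup c b) a = sup (inf c a) b" if "b \<le> a"
  proof -
    have "sup (inf c a) b = sup (sup (inf a b) (inf b c)) (inf c a)"
      using that by (simp add: inf_absorb2 sup_inf_absorb sup_commute)
    also have "\<dots> = inf (inf (sup a b) (sup b c)) (sup c a)" by (rule med)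
    also have "\<dots> = inf (sup c b) a"
      using that by (intro antisym) (auto simp: sup_absorb1 sup_commute[of c b] intro: le_infI1 le_infI2 le_supI1 le_supI2)
    finally show ?thesis by simp
  qed
qed

text \<open>
  The distributive law for the meet is immediate. The other two follow by cancelling \<open>p\<close> first and
  then \<open>q\<close>; cancelling \<open>p\<close> reduces the dual distributive law to elements below \<open>p\<close>.
\<close>

lemma dist_cancel_inf:
  fixes p q :: "'l::lattice"
  assumes p: "dist_cancel p" and q: "dist_cancel q"
  shows "dist_cancel (inf p q)"
proof -
  note P = dist_cancelD[OF p] and Q = dist_cancelD[OF q]
  have 1: "inf (inf p q) (sup b c) = sup (inf (inf p q) b) (inf (inf p q) c)" for b c
    by (simp add: inf_assoc P(1) Q(1))
  have sup_p: "sup p (sup (inf p q) x) = sup p x" and sup_q: "sup q (sup (inf p q) x) = sup q x" for x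
    by (rule antisym; auto intro: le_supI1 le_supI2 le_infI1 le_infI2)+
  have 2: "sup (inf p q) (inf b c) = inf (sup (inf p q) b) (sup (inf p q) c)" (is "?l = ?r") for b c
  proof (rule P(3))
    show "sup p ?l = sup p ?r" by (simp add: P(2) sup_p)
    let ?b = "inf p b" and ?c = "inf p c"
    have ip: "inf p (sup (inf p q) x) = sup (inf p q) (inf p x)" for x
      by (simp add: P(1))
    have "sup (inf p q) (inf ?b ?c) = inf (sup (inf p q) ?b) (sup (inf p q) ?c)" (is "?l' = ?r'")
    proof (rule Q(3))
      show "sup q ?l' = sup q ?r'" by (simp add: Q(2) sup_q)
      have "inf q (sup (inf p q) (inf p x)) = inf p q" for x
        by (rule antisym; auto simp: Q(1) intro: le_supI1 le_infI1 le_infI2)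
      from this[of b] this[of c] this[of "inf b ?c"]
      have a: "inf q (sup (inf p q) ?b) = inf p q" "inf q (sup (inf p q) ?c) = inf p q"
        "inf q ?l' = inf p q" by (simp_all only: inf_assoc)
      have "inf q ?r' = inf (inf q (sup (inf p q) ?b)) (inf q (sup (inf p q) ?c))"
        by (simp add: inf_assoc inf_left_commute)
      then show "inf q ?l' = inf q ?r'" by (simp only: a inf_idem)
    qed
    moreover have "inf p ?l = ?l'" by (simp add: ip inf_assoc inf_left_commute)
    moreover have "inf p ?r = inf (inf p (sup (inf p q) b)) (inf p (sup (inf p q) c))"
      by (simp add: inf_assoc inf_left_commute)
    ultimately show "inf p ?l = inf p ?r" by (simp only: ip)
  qed
  have 3: "b = c" if i: "inf (inf p q) b = inf (inf p q) c"
    and s: "sup (inf p q) b = sup (inf p q) c" for b c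
  proof (rule P(3))
    show "sup p b = sup p c" using s sup_p by metis
    have "sup q b = sup q c" using s sup_q by metis
    then have "sup q (inf p b) = sup q (inf p c)" by (simp add: Q(2))
    moreover have "inf q (inf p b) = inf q (inf p c)"
      using i by (simp add: inf_assoc inf_left_commute)
    ultimately show "inf p b = inf p c" by (rule Q(3)[rotated])
  qed
  show ?thesis unfolding dist_cancel_def using 1 2 3 by blast
qed

section \<open>Epigroups of bounded index\<close>

lemma (in sgrp) bar_idem:
  assumes e: "e \<in> C" "e \<cdot> e = e" and b: "e \<cdot> bar S e = bar S e \<cdot> e"
    "bar S e \<cdot> e \<cdot> bar S e = bar S e" "pw e (Suc n) \<cdot> bar S e = pw e n"
  shows "bar S e = e"
proof -
  have "e \<cdot> bar S e = e" using b(3) pow_idem[OF e(2)] e(2) by simp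
  then show ?thesis using b(1,2) by simp
qed

text \<open>
  In a semilattice, a term evaluates to the greatest lower bound of the values of its variables.
\<close>

lemma (in sgrp) semilattice_eval:
  assumes E: "E \<subseteq> C" "\<And>a b. a \<in> E \<Longrightarrow> b \<in> E \<Longrightarrow> a \<cdot> b \<in> E"
    "\<And>a b. a \<in> E \<Longrightarrow> b \<in> E \<Longrightarrow> a \<cdot> b = b \<cdot> a" "\<And>a. a \<in> E \<Longrightarrow> a \<cdot> a = a"
    "\<And>a. a \<in> E \<Longrightarrow> bar S a = a"
    and v: "\<And>i. v i \<in> E" and st: "vars s = vars t"
  shows "eval_term S v s = eval_term S v t"
proof -
  have inE: "eval_term S v t \<in> E" for t by (induction t) (simp_all add: E v)
  have lower: "eval_term S v t \<cdot> v z = eval_term S v t" if "z \<in> vars t" for t z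
    using that
  proof (induction t)
    case (Mul p q)
    have C: "eval_term S v p \<in> C" "eval_term S v q \<in> C" "v z \<in> C"
      using inE[of p] inE[of q] v[of z] E(1) by auto
    show ?case
    proof (cases "z \<in> vars q")
      case True then show ?thesis using Mul C by (simp add: assoc)
    next
      case False
      then have p: "eval_term S v p \<cdot> v z = eval_term S v p" using Mul by simp
      have "eval_term S v p \<cdot> eval_term S v q \<cdot> v z = eval_term S v p \<cdot> v z \<cdot> eval_term S v q"
        using C E(3)[OF inE[of q] v[of z]] by (simp add: assoc)
      then show ?thesis using p by simp
    qed
  qed (use E v inE in simp_all)
  have greatest: "a \<cdot> eval_term S v t = a" if "a \<in> E" "\<And>z. z \<in> vars t \<Longrightarrow> a \<cdot> v z = a" for t a
    using that(2)
  proof (induction t)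
    case (Mul p q)
    have "eval_term S v p \<in> C" "eval_term S v q \<in> C" "a \<in> C"
      using inE[of p] inE[of q] that(1) E(1) by auto
    then have "a \<cdot> (eval_term S v p \<cdot> eval_term S v q) = a \<cdot> eval_term S v p \<cdot> eval_term S v q"
      by (simp add: assoc)
    then show ?case using Mul by simp
  qed (use E inE in simp_all)
  have "eval_term S v s \<cdot> eval_term S v t = eval_term S v s"
    "eval_term S v t \<cdot> eval_term S v s = eval_term S v t"
    using greatest[OF inE] lower st by blast+
  then show ?thesis using E(3)[OF inE inE] by metis
qed

locale epigrp = sgrp S for S :: "'a unary_alg" +
  fixes n :: nat
  assumes bounded: "bounded_epigroup n S"
begin

abbreviation "om x \<equiv> x \<cdot> bar S x"

lemma bar_commute: "x \<in> C \<Longrightarrow> bar S x \<cdot> x = om x"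
  and bar_inner: "x \<in> C \<Longrightarrow> om x \<cdot> bar S x = bar S x"
  and pow_index: "x \<in> C \<Longrightarrow> pw x (Suc n) \<cdot> bar S x = pw x n"
  using bounded by (auto simp: bounded_epigroup_def)

lemma om_idem: "x \<in> C \<Longrightarrow> om x \<cdot> om x = om x"
  by (metis assoc bar_closed bar_commute bar_inner mul_closed)

lemma bar_fix: "e \<in> C \<Longrightarrow> e \<cdot> e = e \<Longrightarrow> bar S e = e"
  using bar_idem[of e n] bar_commute[of e] bar_inner[of e] pow_index[of e] by simp

lemma pow_om: assumes x: "x \<in> C" and k: "n \<le> k" shows "pw x k \<cdot> om x = pw x k" "om x \<cdot> pw x k = pw x k"
proof -
  have "bounded_epigroup k S" using bounded_epigroup_mono[OF bounded k] .
  then have "pw x (Suc k) \<cdot> bar S x = pw x k" using x by (auto simp: bounded_epigroup_def)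
  then show 1: "pw x k \<cdot> om x = pw x k" using x by (simp add: assoc)
  have "x \<cdot> om x = om x \<cdot> x" using x by (simp add: assoc bar_commute)
  then show "om x \<cdot> pw x k = pw x k" using pow_commute[of x "om x" k] x 1 by simp
qed

lemma om_pow: "x \<in> C \<Longrightarrow> pw x k \<cdot> pw (bar S x) k = om x" "x \<in> C \<Longrightarrow> pw (bar S x) k \<cdot> pw x k = om x"
  using pow_inverse[of x "bar S x" k] bar_commute[of x] bar_inner[of x] by simp_all

text \<open>
  With \<open>s = p q\<close> and \<open>t = q p\<close> we have \<open>s\<^sup>k p = p t\<^sup>k\<close>. Since \<open>om s\<close> and \<open>om t\<close> fix large
  powers of \<open>s\<close> and \<open>t\<close>, both sides equal \<open>om s \<cdot> p \<cdot> om t\<close>.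
\<close>

lemma om_switch:
  assumes p: "p \<in> C" and q: "q \<in> C"
  shows "om (p \<cdot> q) \<cdot> p = p \<cdot> om (q \<cdot> p)"
proof -
  let ?s = "p \<cdot> q" and ?t = "q \<cdot> p"
  have sw: "pw ?s k \<cdot> p = p \<cdot> pw ?t k" for k
  proof (induction k)
    case (Suc k)
    have "pw ?s (Suc k) \<cdot> p = pw ?s k \<cdot> p \<cdot> ?t" using p q by (simp add: assoc)
    then show ?case unfolding Suc using p q by (simp add: assoc)
  qed (use p q in \<open>simp add: assoc\<close>)
  have "om ?s \<cdot> p = pw (bar S ?s) n \<cdot> (pw ?s n \<cdot> p)" using p q om_pow(2)[of ?s n] by (simp add: assoc[symmetric])
  also have "\<dots> = pw (bar S ?s) n \<cdot> (p \<cdot> (pw ?t n \<cdot> om ?t))" using sw p q pow_om(1)[of ?t n] by simp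
  also have "\<dots> = pw (bar S ?s) n \<cdot> (pw ?s n \<cdot> p) \<cdot> om ?t" unfolding sw using p q by (simp add: assoc)
  also have "\<dots> = om ?s \<cdot> p \<cdot> om ?t" unfolding om_pow(2)[of ?s n, OF mul_closed[OF p q], symmetric] using p q by (simp add: assoc)
  finally have 1: "om ?s \<cdot> p = om ?s \<cdot> p \<cdot> om ?t" .
  have "p \<cdot> om ?t = p \<cdot> pw ?t n \<cdot> pw (bar S ?t) n" using p q om_pow(1)[of ?t n] by (simp add: assoc)
  also have "\<dots> = om ?s \<cdot> pw ?s n \<cdot> p \<cdot> pw (bar S ?t) n" using sw p q pow_om(2)[of ?s n] by simp
  also have "\<dots> = om ?s \<cdot> (pw ?s n \<cdot> p) \<cdot> pw (bar S ?t) n" using p q by (simp add: assoc)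
  also have "\<dots> = om ?s \<cdot> p \<cdot> (pw ?t n \<cdot> pw (bar S ?t) n)" unfolding sw using p q by (simp add: assoc)
  finally have "p \<cdot> om ?t = om ?s \<cdot> p \<cdot> om ?t" using p q om_pow(1)[of ?t n] by simp
  with 1 show ?thesis by simp
qed

text \<open>
  A power of \<open>c\<close> and hence \<open>om c\<close> commutes with \<open>a\<close>; then
  \<open>a \<cdot> bar c = om c \<cdot> a \<cdot> bar c = bar c \<cdot> (c a) \<cdot> bar c = bar c \<cdot> a \<cdot> om c\<close>.
\<close>

lemma bar_centralizes:
  assumes a: "a \<in> C" and c: "c \<in> C" and ac: "a \<cdot> c = c \<cdot> a"
  shows "a \<cdot> bar S c = bar S c \<cdot> a"
proof -
  let ?b = "bar S c"
  have pc: "pw c n \<cdot> a = a \<cdot> pw c n" using pow_commute[OF c a] ac by simp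
  have 1: "om c \<cdot> a = om c \<cdot> a \<cdot> om c"
  proof -
    have "om c \<cdot> a = pw ?b n \<cdot> (pw c n \<cdot> a)" using a c om_pow(2)[OF c, of n] by (simp add: assoc[symmetric])
    also have "\<dots> = pw ?b n \<cdot> (a \<cdot> (pw c n \<cdot> om c))" using pc pow_om(1)[OF c, of n] by simp
    also have "\<dots> = pw ?b n \<cdot> (pw c n \<cdot> a) \<cdot> om c" unfolding pc using a c by (simp add: assoc)
    also have "\<dots> = om c \<cdot> a \<cdot> om c" unfolding om_pow(2)[OF c, of n, symmetric] using a c by (simp add: assoc)
    finally show ?thesis .
  qed
  have 2: "a \<cdot> om c = om c \<cdot> a \<cdot> om c"
  proof -
    have "a \<cdot> om c = (a \<cdot> pw c n) \<cdot> pw ?b n" using a c om_pow(1)[OF c, of n] by (simp add: assoc)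
    also have "\<dots> = om c \<cdot> pw c n \<cdot> a \<cdot> pw ?b n" using pc pow_om(2)[OF c, of n] by simp
    also have "\<dots> = om c \<cdot> (pw c n \<cdot> a) \<cdot> pw ?b n" using a c by (simp add: assoc)
    also have "\<dots> = om c \<cdot> a \<cdot> (pw c n \<cdot> pw ?b n)" unfolding pc using a c by (simp add: assoc)
    finally show ?thesis using om_pow(1)[OF c, of n] by simp
  qed
  have "a \<cdot> ?b = a \<cdot> om c \<cdot> ?b" using a c bar_inner[OF c] by (simp add: assoc)
  also have "\<dots> = ?b \<cdot> (c \<cdot> a) \<cdot> ?b" unfolding 2 1[symmetric] using a c by (simp add: bar_commute[symmetric] assoc)
  also have "\<dots> = ?b \<cdot> (a \<cdot> om c)" unfolding ac[symmetric] using a c by (simp add: assoc)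
  also have "\<dots> = ?b \<cdot> om c \<cdot> a" unfolding 2 1[symmetric] using a c by (simp add: assoc)
  also have "?b \<cdot> om c = ?b" using bar_inner[OF c] bar_commute[OF c] c by (metis assoc bar_closed)
  finally show ?thesis .
qed

text \<open>
  In a completely simple semigroup, \<open>om (w F)\<close> is an idempotent in the same right ideal as
  \<open>w\<close> and therefore fixes \<open>w\<close>. This property singles out such elements in an arbitrary epigroup;
  they form an ideal that is closed under pseudoinversion.
\<close>

definition spanned :: "'a \<Rightarrow> bool" where
  "spanned w \<longleftrightarrow> w \<in> C \<and> (\<forall>F\<in>C. om (w \<cdot> F) \<cdot> w = w)"

lemma spanned_mult_left: "spanned w \<Longrightarrow> p \<in> C \<Longrightarrow> spanned (p \<cdot> w)"
  unfolding spanned_def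
proof (intro conjI ballI)
  fix F assume w: "w \<in> C \<and> (\<forall>F\<in>C. om (w \<cdot> F) \<cdot> w = w)" and p: "p \<in> C" and F: "F \<in> C"
  have "om (p \<cdot> w \<cdot> F) \<cdot> (p \<cdot> w) = om (p \<cdot> (w \<cdot> F)) \<cdot> p \<cdot> w" using w p F by (simp add: assoc)
  also have "\<dots> = p \<cdot> om (w \<cdot> F \<cdot> p) \<cdot> w" using w p F by (simp add: om_switch)
  also have "\<dots> = p \<cdot> (om (w \<cdot> (F \<cdot> p)) \<cdot> w)" using w p F by (simp add: assoc)
  also have "om (w \<cdot> (F \<cdot> p)) \<cdot> w = w" using w p F by blast
  finally show "om (p \<cdot> w \<cdot> F) \<cdot> (p \<cdot> w) = p \<cdot> w" .
qed auto

lemma spanned_mult_right: "spanned w \<Longrightarrow> p \<in> C \<Longrightarrow> spanned (w \<cdot> p)"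
  unfolding spanned_def
proof (intro conjI ballI)
  fix F assume w: "w \<in> C \<and> (\<forall>F\<in>C. om (w \<cdot> F) \<cdot> w = w)" and p: "p \<in> C" and F: "F \<in> C"
  have "om (w \<cdot> p \<cdot> F) \<cdot> (w \<cdot> p) = om (w \<cdot> (p \<cdot> F)) \<cdot> w \<cdot> p" using w p F by (simp add: assoc)
  also have "om (w \<cdot> (p \<cdot> F)) \<cdot> w = w" using w p F by blast
  finally show "om (w \<cdot> p \<cdot> F) \<cdot> (w \<cdot> p) = w \<cdot> p" .
qed auto

lemma spanned_bar: assumes w: "spanned w" shows "spanned (bar S w)"
proof -
  have C: "w \<in> C" using w by (simp add: spanned_def)
  have "bar S w = w \<cdot> (bar S w \<cdot> bar S w)" using C bar_inner[OF C] by (simp add: assoc)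
  then show ?thesis using spanned_mult_right[OF w, of "bar S w \<cdot> bar S w"] C by simp
qed

lemma spanned_eval:
  assumes "\<And>i. v i \<in> C" "z \<in> vars h" "spanned (v z)" shows "spanned (eval_term S v h)"
  using assms(2)
proof (induction h)
  case (Mul p q)
  have C: "eval_term S v p \<in> C" "eval_term S v q \<in> C" using eval_closed[OF algebra] assms(1) by auto
  show ?case
  proof (cases "z \<in> vars p")
    case True then show ?thesis using Mul C spanned_mult_right by simp
  next
    case False then show ?thesis using Mul C spanned_mult_left by simp
  qed
qed (use assms spanned_bar in auto)

definition idempotents_minimal :: bool where
  "idempotents_minimal \<longleftrightarrow> (\<forall>e\<in>C. \<forall>k\<in>C. e \<cdot> e = e \<longrightarrow> k \<cdot> k = k \<longrightarrow> e \<cdot> k = k \<longrightarrow> k \<cdot> e = k \<longrightarrow> k = e)"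

text \<open>
  Since \<open>e\<close> is a left unit for \<open>om (e F)\<close>, the element \<open>om (e F) \<cdot> e\<close> is an idempotent below \<open>e\<close>.
\<close>

lemma spanned_idem:
  assumes m: idempotents_minimal and e: "e \<in> C" "e \<cdot> e = e" shows "spanned e"
  unfolding spanned_def
proof (intro conjI ballI e)
  fix F assume F: "F \<in> C"
  let ?o = "om (e \<cdot> F)"
  have o: "e \<cdot> ?o = ?o" "?o \<cdot> ?o = ?o" "?o \<in> C" using e F om_idem[of "e \<cdot> F"] by (simp_all add: assoc[symmetric])
  have "?o \<cdot> e \<cdot> (?o \<cdot> e) = ?o \<cdot> (e \<cdot> ?o) \<cdot> e" using e(1) o(3) by (simp only: assoc mul_closed)
  then have "?o \<cdot> e \<cdot> (?o \<cdot> e) = ?o \<cdot> e" using o by simp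
  moreover have "e \<cdot> (?o \<cdot> e) = e \<cdot> ?o \<cdot> e" "?o \<cdot> e \<cdot> e = ?o \<cdot> (e \<cdot> e)" using e(1) o(3) by (simp_all only: assoc mul_closed)
  ultimately show "?o \<cdot> e = e"
    using m e o unfolding idempotents_minimal_def by (metis mul_closed)
qed

text \<open>
  For idempotents \<open>k\<close> below \<open>e\<close>, give the value \<open>k\<close> to \<open>z\<close> and \<open>e\<close> to all other variables. The
  term with \<open>z\<close> then takes the value \<open>k\<close>, and the other one \<open>e\<close>. Moreover the value of \<open>t\<close>, and
  with it that of \<open>s\<close>, does not depend on \<open>z\<close>, so that \<open>z\<close> may be given an idempotent value; the
  value of \<open>s\<close> then lies in the ideal of spanned elements.
\<close>

lemma content_changing_identity:
  assumes id: "\<And>v. (\<And>i. v i \<in> C) \<Longrightarrow> eval_term S v s = eval_term S v t"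
    and z: "z \<in> vars s" "z \<notin> vars t"
  shows idempotents_minimal "(\<And>i. v i \<in> C) \<Longrightarrow> spanned (eval_term S v s)"
proof -
  show m: idempotents_minimal
    unfolding idempotents_minimal_def
  proof (intro ballI impI)
    fix e k assume e: "e \<in> C" "k \<in> C" "e \<cdot> e = e" "k \<cdot> k = k" "e \<cdot> k = k" "k \<cdot> e = k"
    define v where "v i = (if i = z then k else e)" for i
    have "eval_term S v h = (if z \<in> vars h then k else e)" for h
      by (induction h) (use e bar_fix in \<open>auto simp: v_def\<close>)
    then show "k = e" using id[of v] z e by (simp add: v_def)
  qed
  assume v: "\<And>i. v i \<in> C"
  let ?v = "v(z := om (v z))"
  have v': "?v i \<in> C" for i using v by simp
  have "eval_term S v s = eval_term S v t" using id[of v] v by simp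
  also have "\<dots> = eval_term S ?v t" using z(2) by (intro eval_cong) auto
  also have "\<dots> = eval_term S ?v s" using id[of ?v] v' by simp
  finally have eq: "eval_term S v s = eval_term S ?v s" .
  have "spanned (?v z)" using spanned_idem[OF m] om_idem[OF v] v by simp
  then have "spanned (eval_term S ?v s)" using spanned_eval[of ?v z s] v' z(1) by blast
  then show "spanned (eval_term S v s)" by (simp only: eq)
qed

text \<open>
  Repeated substitution makes \<open>a\<close> a multiple of arbitrarily high powers of itself, which are fixed
  by \<open>om a\<close>.
\<close>

lemma power_divisor_regular:
  assumes a: "a \<in> C" and c: "c \<in> C" and ac: "a = a \<cdot> a \<cdot> c"
  shows "om a \<cdot> a = a"
proof -
  have "\<exists>d\<in>C. a = pw a (Suc k) \<cdot> d" for k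
  proof (induction k)
    case 0 then show ?case using ac c by auto
  next
    case (Suc k)
    then obtain d where d: "d \<in> C" "a = pw a k \<cdot> a \<cdot> d" by auto
    then have "a = pw a k \<cdot> (a \<cdot> a \<cdot> c) \<cdot> d" using ac by simp
    also have "\<dots> = pw a (Suc (Suc k)) \<cdot> (c \<cdot> d)" using a c d(1) by (simp add: assoc)
    finally show ?case using c d(1) by blast
  qed
  then obtain d where d: "d \<in> C" "a = pw a (Suc n) \<cdot> d" by blast
  have "om a \<cdot> a = om a \<cdot> (pw a (Suc n) \<cdot> d)" using d(2) by simp
  also have "\<dots> = om a \<cdot> pw a (Suc n) \<cdot> d" using a d(1) by (simp only: assoc mul_closed bar_closed pow_closed)
  also have "\<dots> = a" using pow_om(2)[OF a, of "Suc n"] d(2) by simp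
  finally show ?thesis .
qed

text \<open>
  A term other than a variable takes, when all variables get the value \<open>a\<close>, the value \<open>a a\<close>
  or \<open>a a d\<close> with \<open>d\<close> commuting with \<open>a\<close>.
\<close>

lemma one_variable_identity_regular:
  assumes a: "a \<in> C" and t: "t \<notin> range Var" and id: "a = eval_term S (\<lambda>_. a) t"
  shows "om a \<cdot> a = a"
proof -
  let ?e = "eval_term S (\<lambda>_. a)"
  define Z where "Z = {c \<in> C. a \<cdot> c = c \<cdot> a}"
  have Z: "Z \<subseteq> C" "a \<in> Z" "\<And>c d. c \<in> Z \<Longrightarrow> d \<in> Z \<Longrightarrow> c \<cdot> d \<in> Z" "\<And>c. c \<in> Z \<Longrightarrow> bar S c \<in> Z"
    using a bar_centralizes[OF a]
    by (auto simp: Z_def) (metis assoc)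
  have eZ: "?e p \<in> Z" for p by (induction p) (use Z in auto)
  have square: "\<exists>d\<in>Z. x \<cdot> y = a \<cdot> a \<cdot> d \<or> x \<cdot> y = a \<cdot> a"
    if "x = a \<or> (\<exists>c\<in>Z. x = a \<cdot> c)" "y = a \<or> (\<exists>c\<in>Z. y = a \<cdot> c)" for x y
  proof -
    have 1: "a \<cdot> c \<cdot> a = a \<cdot> a \<cdot> c" if "c \<in> Z" for c
    proof -
      from that have "c \<in> C" "c \<cdot> a = a \<cdot> c" by (auto simp: Z_def)
      then show ?thesis using a by (simp add: assoc)
    qed
    have 2: "a \<cdot> c \<cdot> (a \<cdot> d) = a \<cdot> a \<cdot> (c \<cdot> d)" if "c \<in> Z" "d \<in> Z" for c d
    proof -
      have C: "c \<in> C" "d \<in> C" using that Z(1) by auto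
      have "a \<cdot> c \<cdot> (a \<cdot> d) = a \<cdot> c \<cdot> a \<cdot> d" using C a by (simp add: assoc)
      then show ?thesis using C a 1[OF that(1)] by (simp add: assoc)
    qed
    have 3: "a \<cdot> (a \<cdot> d) = a \<cdot> a \<cdot> d" if "d \<in> Z" for d using that a by (simp add: Z_def assoc)
    from that 1 2 3 Z show ?thesis by metis
  qed
  have div: "?e p = a \<or> (\<exists>c\<in>Z. ?e p = a \<cdot> c)" for p
  proof (induction p)
    case (Mul p q)
    show ?case using square[OF Mul] Z a by (auto simp: assoc) (metis Z_def assoc mem_Collect_eq)
  next
    case (Bar p)
    have C: "?e p \<in> C" "?e p \<in> Z" using eZ Z by auto
    have b: "bar S (?e p) = ?e p \<cdot> (bar S (?e p) \<cdot> bar S (?e p))" using bar_inner[OF C(1)] C(1) by (simp add: assoc)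
    define w where "w = bar S (?e p) \<cdot> bar S (?e p)"
    have w: "w \<in> Z" "w \<in> C" using C Z by (auto simp: w_def)
    have "a \<cdot> c \<cdot> w = a \<cdot> (c \<cdot> w)" if "c \<in> Z" for c using that a w Z by (intro assoc) auto
    then show ?case using Bar b w Z(3) unfolding w_def[symmetric] by (metis eval_term.simps(3))
  qed simp
  have "\<exists>d\<in>Z. ?e t = a \<cdot> a \<cdot> d \<or> ?e t = a \<cdot> a"
  proof (cases t)
    case (Mul p q) then show ?thesis using square[OF div div, of p q] by simp
  next
    case (Bar p)
    have C: "?e p \<in> C" "?e p \<in> Z" using eZ Z by auto
    have "bar S (?e p) = ?e p \<cdot> (bar S (?e p) \<cdot> bar S (?e p))" using bar_inner[OF C(1)] C(1) by (simp add: assoc)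
    also have "\<dots> = ?e p \<cdot> (?e p \<cdot> (bar S (?e p) \<cdot> bar S (?e p)) \<cdot> bar S (?e p))"
      using bar_inner[OF C(1)] C(1) by (simp add: assoc)
    finally have "bar S (?e p) = ?e p \<cdot> ?e p \<cdot> (bar S (?e p) \<cdot> bar S (?e p) \<cdot> bar S (?e p))"
      using C(1) by (simp add: assoc)
    moreover define w where "w = bar S (?e p) \<cdot> bar S (?e p) \<cdot> bar S (?e p)"
    ultimately have b: "?e t = ?e p \<cdot> ?e p \<cdot> w" using Bar by simp
    have w: "w \<in> Z" "w \<in> C" using C Z by (auto simp: w_def)
    from square[OF div div, of p p] obtain d where "d \<in> Z" "?e p \<cdot> ?e p = a \<cdot> a \<cdot> d \<or> ?e p \<cdot> ?e p = a \<cdot> a" by blast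
    moreover have "a \<cdot> a \<cdot> d \<cdot> w = a \<cdot> a \<cdot> (d \<cdot> w)" if "d \<in> Z" for d using that a w Z by (intro assoc) auto
    ultimately show ?thesis using b w Z(3) by metis
  qed (use t in simp)
  then show ?thesis
  proof (elim bexE disjE)
    fix d assume "d \<in> Z" "?e t = a \<cdot> a \<cdot> d"
    then show ?thesis using power_divisor_regular[OF a, of d] id Z by auto
  next
    assume "?e t = a \<cdot> a"
    then have "a \<cdot> a = a" using id by simp
    then show ?thesis using power_divisor_regular[OF a a] by simp
  qed
qed

end

section \<open>Semilattices and zero multiplication\<close>

lemma models_epi:
  obtains n where "\<And>S :: 'a unary_alg. S \<in> models (idents a) \<Longrightarrow> epigrp S n"
proof -
  obtain n where n: "epi_axioms n \<subseteq> idents a" using epi_idents[of a] by (auto simp: epi_theory_def)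
  show ?thesis
  proof (rule that[of n])
    fix S :: "'a unary_alg" assume "S \<in> models (idents a)"
    then have b: "bounded_epigroup n S" using theory_bounded_epigroup[OF n] by blast
    then show "epigrp S n" by unfold_locales (simp_all add: bounded_epigroup_def)
  qed
qed

lemma models_eval:
  "S \<in> models \<theta> \<Longrightarrow> (s, t) \<in> \<theta> \<Longrightarrow> (\<And>i. v i \<in> carrier S) \<Longrightarrow> eval_term S v s = eval_term S v t"
  by (auto simp: models_def satisfies_def)

lemma identity_by_models:
  assumes "\<And>(S :: nat unary_alg) v. S \<in> models (idents a) \<Longrightarrow> (\<And>i. v i \<in> carrier S) \<Longrightarrow>
    eval_term S v s = eval_term S v t"
  shows "(s, t) \<in> idents a"
  by (rule theory_member[OF eq_idents]) (use assms in \<open>auto simp: satisfies_def\<close>)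

text \<open>
  The term for the idempotent usually written with the exponent \<open>\<omega>\<close>.
\<close>

definition omt :: "uterm \<Rightarrow> uterm" where "omt t = Mul t (Bar t)"

text \<open>
  Equal to \<open>u\<close> at valuations where \<open>u\<close> is spanned, and mentioning all variables of \<open>F\<close>.
\<close>

definition detour :: "uterm \<Rightarrow> uterm \<Rightarrow> uterm" where
  "detour F u = Mul (omt (Mul u F)) u"

lemma vars_omt [simp]: "vars (omt t) = vars t" by (simp add: omt_def)

lemma vars_detour [simp]: "vars (detour F t) = vars t \<union> vars F" by (auto simp: detour_def)

definition sl_th :: epi_th where "sl_th = Abs_epi_th {(s, t). vars s = vars t}"

definition zm_th :: epi_th where
  "zm_th = Abs_epi_th {(s, t). s = t \<or> s \<notin> range Var \<and> t \<notin> range Var}"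

definition top_th :: epi_th where "top_th = Abs_epi_th UNIV"

lemma in_sl_th: "(s, t) \<in> idents sl_th \<longleftrightarrow> vars s = vars t"
proof -
  have "eq_theory {(s, t). vars s = vars t}" by (rule eq_theoryI) (auto simp: vars_subst)
  moreover have "epi_axioms 0 \<subseteq> {(s, t). vars s = vars t}" by (auto simp: epi_axioms_def Let_def)
  ultimately have "epi_theory {(s, t). vars s = vars t}" by (auto simp: epi_theory_def)
  then show ?thesis by (simp add: sl_th_def Abs_epi_th_inverse)
qed

lemma nonvar_simps [simp]: "Mul s t \<notin> range Var" "Bar t \<notin> range Var"
  by auto

lemma subst_nonvar: "t \<notin> range Var \<Longrightarrow> subst \<sigma> t \<notin> range Var"
  by (cases t) auto

lemma in_zm_th: "(s, t) \<in> idents zm_th \<longleftrightarrow> s = t \<or> s \<notin> range Var \<and> t \<notin> range Var"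
proof -
  let ?\<theta> = "{(s, t). s = t \<or> s \<notin> range Var \<and> t \<notin> range Var}"
  have "eq_theory ?\<theta>" by (rule eq_theoryI) (auto simp del: image_iff dest: subst_nonvar)
  moreover have "epi_axioms 1 \<subseteq> ?\<theta>" by (auto simp: epi_axioms_def Let_def)
  ultimately have "epi_theory ?\<theta>" by (auto simp: epi_theory_def)
  then show ?thesis by (simp add: zm_th_def Abs_epi_th_inverse)
qed

lemma in_top_th: "idents top_th = UNIV"
  by (simp add: top_th_def Abs_epi_th_inverse epi_theory_def eq_theory_UNIV)

lemma le_top_th: "a \<le> top_th" by (simp add: less_eq_epi_th_def in_top_th)

lemma dist_cancel_top_th: "dist_cancel top_th"
  unfolding dist_cancel_def using le_top_th
  by (simp add: inf_absorb2 sup_absorb1 le_supI)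

lemma not_leD: "\<not> b \<le> a \<Longrightarrow> \<exists>s t. (s, t) \<in> idents b \<and> (s, t) \<notin> idents a"
  by (auto simp: less_eq_epi_th_def)

text \<open>
  If every \<open>b\<close> not below \<open>a\<close> has the join \<open>top_th\<close> with \<open>a\<close>, then the dual distributive law says that
  \<open>a\<close> is prime, and cancellation says that \<open>b\<close> is recovered from its meet with \<open>a\<close>. The
  distributive law is obtained from maps \<open>g\<close> that move a chain of identities into \<open>a\<close> while fixing
  its two ends.
\<close>

lemma dist_cancel_coatomI:
  assumes top: "\<And>b. \<not> b \<le> a \<Longrightarrow> sup a b = top_th"
    and prime: "\<And>b c. \<not> b \<le> a \<Longrightarrow> \<not> c \<le> a \<Longrightarrow> \<not> inf b c \<le> a"
    and rec: "\<And>b c. \<not> b \<le> a \<Longrightarrow> \<not> c \<le> a \<Longrightarrow> inf a b = inf a c \<Longrightarrow> b \<le> c"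
    and shift: "\<And>b c u v. (u, v) \<in> idents a \<Longrightarrow> u \<noteq> v \<Longrightarrow> \<exists>g. g u = u \<and> g v = v \<and>
      (\<forall>d s t. (s, t) \<in> idents d \<longrightarrow> (g s, g t) \<in> idents d \<inter> idents a)"
  shows "dist_cancel a"
  unfolding dist_cancel_def
proof (intro conjI allI impI)
  fix b c
  show "inf a (sup b c) = sup (inf a b) (inf a c)"
  proof (rule antisym)
    show "inf a (sup b c) \<le> sup (inf a b) (inf a c)"
      unfolding less_eq_epi_th_def
    proof (rule subrelI)
      fix u v assume "(u, v) \<in> idents (inf a (sup b c))"
      then have uv: "(u, v) \<in> idents a" "(u, v) \<in> (idents b \<union> idents c)\<^sup>*"
        by (simp_all add: idents_inf idents_sup)
      show "(u, v) \<in> idents (sup (inf a b) (inf a c))"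
      proof (cases "u = v")
        case False
        then obtain g where g: "g u = u" "g v = v"
          and gg: "\<And>d s t. (s, t) \<in> idents d \<Longrightarrow> (g s, g t) \<in> idents d \<inter> idents a"
          using shift[OF uv(1)] by blast
        have "(g u, g v) \<in> ((idents a \<inter> idents b) \<union> (idents a \<inter> idents c))\<^sup>*"
          using uv(2) by induction (use gg in \<open>auto intro: rtrancl_into_rtrancl\<close>)
        then show ?thesis by (simp add: g idents_inf idents_sup)
      qed (simp add: idents_sup)
    qed
  qed (auto intro: le_infI2)
  show "sup a (inf b c) = inf (sup a b) (sup a c)"
  proof (cases "b \<le> a \<or> c \<le> a")
    case True
    then show ?thesis by (auto simp: sup_absorb1 inf_absorb1 inf_absorb2 le_infI1 le_infI2)
  next
    case False
    then show ?thesis using top[of b] top[of c] top[OF prime[of b c]] by simp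
  qed
  assume eq: "inf a b = inf a c" "sup a b = sup a c"
  have le: "b \<le> a \<longleftrightarrow> c \<le> a" using eq(2) by (metis sup.absorb_iff1)
  show "b = c"
  proof (cases "b \<le> a")
    case True
    then show ?thesis using le eq(1) by (simp add: inf_absorb2)
  next
    case False
    then show ?thesis using le rec[of b c] rec[of c b] eq(1) by (auto intro: antisym)
  qed
qed

text \<open>
  Whether \<open>a\<close> lies below \<open>p\<close> and whether it lies below \<open>q\<close> determines \<open>a\<close>: its meets
  with \<open>p\<close> and \<open>q\<close> are forced, and \<open>a\<close> is recovered from one of them.
\<close>

lemma above_inf_coatoms:
  assumes "\<not> p \<le> q" "\<not> q \<le> p"
    and prime: "\<And>b c. \<not> b \<le> q \<Longrightarrow> \<not> c \<le> q \<Longrightarrow> \<not> inf b c \<le> q"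
    and rec_p: "\<And>b c. \<not> b \<le> p \<Longrightarrow> \<not> c \<le> p \<Longrightarrow> inf p b = inf p c \<Longrightarrow> b \<le> c"
    and rec_q: "\<And>b c. \<not> b \<le> q \<Longrightarrow> \<not> c \<le> q \<Longrightarrow> inf q b = inf q c \<Longrightarrow> b \<le> c"
    and ge: "inf p q \<le> a"
  shows "a = top_th \<or> a = p \<or> a = q \<or> a = inf p q"
proof -
  have one: "a = x" if "\<not> x \<le> y" "\<not> y \<le> x" "a \<le> x" "\<not> a \<le> y" "inf x y \<le> a"
    "\<And>b c. \<not> b \<le> y \<Longrightarrow> \<not> c \<le> y \<Longrightarrow> inf y b = inf y c \<Longrightarrow> b \<le> c" for a x y :: epi_th
  proof -
    have "inf y a \<le> inf y x" using that(3) by (auto intro: le_infI2)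
    moreover have "inf y x \<le> inf y a" using that(5) by (simp add: inf_commute)
    ultimately have "inf y a = inf y x" by (rule antisym)
    then show ?thesis using that(1,4) that(6)[of a x] that(6)[of x a] by (auto intro: antisym)
  qed
  consider "a \<le> p" "a \<le> q" | "a \<le> p" "\<not> a \<le> q" | "\<not> a \<le> p" "a \<le> q" | "\<not> a \<le> p" "\<not> a \<le> q" by blast
  then show ?thesis
  proof cases
    case 1 then have "a = inf p q" using ge by (intro antisym) auto
    then show ?thesis by simp
  next
    case 2 then show ?thesis using one[of p q a] assms(1,2) ge rec_q by blast
  next
    case 3
    have "inf q p \<le> a" using ge by (simp add: inf_commute)
    then show ?thesis using one[of q p a] 3 assms(1,2) rec_p by blast
  next
    case 4
    have "\<not> inf p a \<le> q" using prime 4 assms(1) by blast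
    moreover have "inf p q \<le> inf p a" using ge by simp
    ultimately have "inf p a = p" using one[of p q "inf p a"] assms(1,2) rec_q by simp
    then have "inf p a = inf p top_th" using le_top_th by (simp add: inf_absorb1)
    moreover have "\<not> top_th \<le> p" using 4 le_top_th order_trans by metis
    ultimately have "top_th \<le> a" using rec_p[of top_th a] 4 by simp
    then show ?thesis using le_top_th by (auto intro: antisym)
  qed
qed

lemma sl_not_le_zm: "\<not> sl_th \<le> zm_th"
proof
  assume "sl_th \<le> zm_th"
  then have "(Var 0, Mul (Var 0) (Var 0)) \<in> idents zm_th"
    unfolding less_eq_epi_th_def using in_sl_th by auto
  then show False by (simp add: in_zm_th)
qed

lemma zm_not_le_sl: "\<not> zm_th \<le> sl_th"
proof
  assume "zm_th \<le> sl_th"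
  then have "(Bar (Var 1), Bar (Var 0)) \<in> idents sl_th"
    unfolding less_eq_epi_th_def using in_zm_th by blast
  then show False by (simp add: in_sl_th)
qed

lemma identity_changes_content:
  assumes st: "(s, t) \<in> idents b" "vars s \<noteq> vars t" and S: "S \<in> models (idents b)" and epi: "epigrp S n"
  shows "epigrp.idempotents_minimal S"
    "(\<And>i. v i \<in> carrier S) \<Longrightarrow> epigrp.spanned S (eval_term S v s)"
proof -
  interpret epigrp S n by (rule epi)
  note ev = models_eval[OF S st(1)]
  have both: "idempotents_minimal \<and> ((\<forall>i. v i \<in> carrier S) \<longrightarrow> spanned (eval_term S v s))"
  proof (cases "vars s \<subseteq> vars t")
    case True
    then obtain z where z: "z \<in> vars t" "z \<notin> vars s" using st(2) by blast
    from content_changing_identity[of t s, OF _ z] ev show ?thesis by metis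
  next
    case False
    then obtain z where z: "z \<in> vars s" "z \<notin> vars t" by blast
    from content_changing_identity[of s t, OF _ z] ev show ?thesis by metis
  qed
  then show idempotents_minimal "(\<And>i. v i \<in> carrier S) \<Longrightarrow> spanned (eval_term S v s)" by blast+
qed

lemma detour_identity:
  assumes "(s, t) \<in> idents b" "vars s \<noteq> vars t"
  shows "(s, detour F s) \<in> idents b"
proof -
  obtain n where n: "\<And>S :: nat unary_alg. S \<in> models (idents b) \<Longrightarrow> epigrp S n"
    using models_epi by blast
  show ?thesis
  proof (rule identity_by_models)
    fix S :: "nat unary_alg" and v :: "nat \<Rightarrow> nat" assume S: "S \<in> models (idents b)" and v: "\<And>i. v i \<in> carrier S"
    interpret epigrp S n by (rule n[OF S])
    have "spanned (eval_term S v s)" using identity_changes_content(2)[OF assms S n[OF S]] v by blast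
    moreover have "eval_term S v F \<in> C" using eval_closed[OF algebra] v by blast
    ultimately show "eval_term S v s = eval_term S v (detour F s)"
      by (simp add: spanned_def detour_def omt_def)
  qed
qed

text \<open>
  If \<open>b\<close> changes the content of some term, all idempotents of its models are spanned, and so are
  their multiples.
\<close>

lemma detour_omt_identity:
  assumes "\<not> b \<le> sl_th"
  shows "(omt s, detour F (omt s)) \<in> idents b"
    "(Mul (omt s) t, detour F (Mul (omt s) t)) \<in> idents b"
proof -
  obtain p q where pq: "(p, q) \<in> idents b" "vars p \<noteq> vars q"
    using not_leD[OF assms] by (auto simp: in_sl_th)
  obtain n where n: "\<And>S :: nat unary_alg. S \<in> models (idents b) \<Longrightarrow> epigrp S n"
    using models_epi by blast
  have "eval_term S v u = eval_term S v (detour F u)" if S: "S \<in> models (idents b)"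
    and v: "\<And>i. v i \<in> carrier S" and u: "u = omt s \<or> u = Mul (omt s) t" for S :: "nat unary_alg" and v :: "nat \<Rightarrow> nat" and u
  proof -
    interpret epigrp S n by (rule n[OF S])
    have ev: "eval_term S v p \<in> C" for p using eval_closed[OF algebra] v by blast
    have "spanned (eval_term S v (omt s))"
      using spanned_idem[OF identity_changes_content(1)[OF pq S n[OF S]]] om_idem ev
      by (simp add: omt_def)
    then have "spanned (eval_term S v u)" using u spanned_mult_right ev by auto
    then show ?thesis using ev by (simp add: spanned_def detour_def[of F u] omt_def[of "Mul u F"])
  qed
  then have "(u, detour F u) \<in> idents b" if "u = omt s \<or> u = Mul (omt s) t" for u
    using that by (intro identity_by_models) blast
  then show "(omt s, detour F (omt s)) \<in> idents b"
    "(Mul (omt s) t, detour F (Mul (omt s) t)) \<in> idents b" by simp_all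
qed

lemma detour_cong: "(s, t) \<in> idents b \<Longrightarrow> (detour F s, detour F t) \<in> idents b"
proof -
  assume st: "(s, t) \<in> idents b"
  note B = eq_theoryD[OF eq_idents[of b]]
  have "(Mul s F, Mul t F) \<in> idents b" using st B(1,4) by blast
  then show ?thesis unfolding detour_def omt_def using st B(4,5) by blast
qed

lemma sl_prime:
  assumes "\<not> b \<le> sl_th" "\<not> c \<le> sl_th" shows "\<not> inf b c \<le> sl_th"
proof
  assume "inf b c \<le> sl_th"
  moreover have "(omt (Var 0), detour (Var 1) (omt (Var 0))) \<in> idents (inf b c)"
    using detour_omt_identity(1) assms by (simp add: idents_inf)
  ultimately have "(omt (Var 0), detour (Var 1) (omt (Var 0))) \<in> idents sl_th"
    unfolding less_eq_epi_th_def by blast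
  then show False by (simp add: in_sl_th)
qed

text \<open>
  An identity \<open>u = v\<close> of \<open>b\<close> that changes the content is split into \<open>u = d u = d v = v\<close>, where
  \<open>d\<close> is the detour through \<open>u v\<close>. The middle step preserves the content. So does
  \<open>u = om (u u) \<cdot> u\<close>, which therefore holds in \<open>c\<close> and makes \<open>u\<close> a multiple of an idempotent; as
  \<open>c\<close> also changes some content, \<open>u\<close> equals its detours in \<open>c\<close>.
\<close>

lemma sl_rec:
  assumes b: "\<not> b \<le> sl_th" and c: "\<not> c \<le> sl_th" and eq: "inf sl_th b = inf sl_th c"
  shows "b \<le> c"
  unfolding less_eq_epi_th_def
proof (rule subrelI)
  fix u v assume uv: "(u, v) \<in> idents b"
  note C = eq_theoryD[OF eq_idents[of c]] and B = eq_theoryD[OF eq_idents[of b]]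
  have move: "p \<in> idents c" if "p \<in> idents b" "p \<in> idents sl_th" for p
    using that eq by (metis IntD2 IntI idents_inf)
  show "(u, v) \<in> idents c"
  proof (cases "vars u = vars v")
    case True
    then show ?thesis using move uv by (simp add: in_sl_th)
  next
    case False
    let ?F = "Mul u v"
    have d: "(w, detour ?F w) \<in> idents c" if "(w, w') \<in> idents b" "vars w \<noteq> vars w'" for w w'
    proof -
      have 1: "(w, detour w w) \<in> idents c"
        using move[OF detour_identity[OF that]] by (simp add: in_sl_th)
      have "(detour w w, detour ?F (detour w w)) \<in> idents c"
        unfolding detour_def[of w w] by (rule detour_omt_identity(2)[OF c])
      moreover have "(detour ?F (detour w w), detour ?F w) \<in> idents c"
        using 1 C(2) by (blast intro: detour_cong)
      ultimately show ?thesis using 1 C(3) by blast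
    qed
    have "(detour ?F u, detour ?F v) \<in> idents c"
      by (rule move) (auto simp: in_sl_th detour_cong uv)
    moreover have "(u, detour ?F u) \<in> idents c" "(v, detour ?F v) \<in> idents c"
      using d[OF uv] d[OF B(2)[OF uv]] False by auto
    ultimately show ?thesis using C(2,3) by blast
  qed
qed

text \<open>
  Let the variable \<open>z\<close> occur on one side only of an identity of \<open>b\<close>. Substituting \<open>p q\<close> for \<open>z\<close> and \<open>p\<close> for the other variables gives
  \<open>p q = p\<close> up to content. By symmetry \<open>q p = q\<close>, and \<open>p q\<close> and \<open>q p\<close> have the same content.
\<close>

lemma sl_top:
  assumes "\<not> b \<le> sl_th" shows "sup sl_th b = top_th"
proof -
  let ?J = "idents (sup sl_th b)"
  note J = eq_theoryD[OF eq_idents[of "sup sl_th b"]]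
  have sl: "(s, t) \<in> ?J" if "vars s = vars t" for s t using that by (auto simp: idents_sup in_sl_th)
  obtain s0 t0 where "(s0, t0) \<in> idents b" "vars s0 \<noteq> vars t0"
    using not_leD[OF assms] by (auto simp: in_sl_th)
  then obtain s t z where st: "(s, t) \<in> idents b" and z: "z \<in> vars s" "z \<notin> vars t"
    using eq_theoryD(2)[OF eq_idents] by blast
  have absorb: "(Mul p q, p) \<in> ?J" for p q
  proof -
    define \<sigma> where "\<sigma> i = (if i = z then Mul p q else p)" for i
    have "(subst \<sigma> s, subst \<sigma> t) \<in> ?J"
      using st J(6) by (auto simp: idents_sup)
    moreover have "vars (subst \<sigma> s) = vars (Mul p q)"
      using z by (auto simp: vars_subst \<sigma>_def split: if_splits)
    moreover have "vars (subst \<sigma> t) = vars p"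
    proof -
      have "\<sigma> i = p" if "i \<in> vars t" for i using that z by (auto simp: \<sigma>_def)
      then show ?thesis using vars_nonempty[of t] by (auto simp: vars_subst simp del: vars_nonempty)
    qed
    ultimately show ?thesis using sl J(2,3) by metis
  qed
  have "(p, q) \<in> ?J" for p q
    by (rule J(3)[OF J(2)[OF absorb[of p q]] J(3)[OF sl absorb[of q p]]]) auto
  then have "?J = UNIV" by auto
  then show ?thesis by (metis idents_inject in_top_th)
qed

text \<open>
  A chain from \<open>u\<close> to \<open>v\<close> is shifted as follows: variables foreign to \<open>u\<close> are replaced by \<open>u\<close>,
  and then terms that lack a variable of \<open>u\<close> are replaced by their detours through \<open>u\<close>. A step
  between terms of different contents is respected because both terms equal their detours.
\<close>

lemma dist_cancel_sl: "dist_cancel sl_th"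
proof (rule dist_cancel_coatomI)
  fix u v assume uv: "(u, v) \<in> idents sl_th"
  define \<sigma> where "\<sigma> i = (if i \<in> vars u then Var i else u)" for i
  define f where "f w = (if vars w = vars u then w else detour u w)" for w
  let ?g = "\<lambda>w. f (subst \<sigma> w)"
  have fix_\<sigma>: "subst \<sigma> w = w" if "vars w = vars u" for w
  proof -
    have "subst \<sigma> w = subst Var w" by (rule subst_cong) (use that in \<open>auto simp: \<sigma>_def\<close>)
    then show ?thesis by simp
  qed
  have sub: "vars (subst \<sigma> w) \<subseteq> vars u" for w by (auto simp: vars_subst \<sigma>_def split: if_splits)
  have vf: "vars (?g w) = vars u" for w using sub[of w] by (auto simp: f_def)
  have "(?g s, ?g t) \<in> idents d \<inter> idents sl_th" if st: "(s, t) \<in> idents d" for d s t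
  proof -
    note D = eq_theoryD[OF eq_idents[of d]]
    let ?s = "subst \<sigma> s" and ?t = "subst \<sigma> t"
    have st': "(?s, ?t) \<in> idents d" using st D(6) by blast
    then have d: "(detour u ?s, detour u ?t) \<in> idents d" by (rule detour_cong)
    have "(?g s, ?g t) \<in> idents d"
    proof (cases "vars ?s = vars ?t")
      case True then show ?thesis using st' d by (simp add: f_def)
    next
      case False
      then have "(?s, detour u ?s) \<in> idents d" "(?t, detour u ?t) \<in> idents d"
        using detour_identity[OF st'] detour_identity[OF D(2)[OF st']] by auto
      then have "(?s, f ?s) \<in> idents d" "(?t, f ?t) \<in> idents d" using D(1) by (simp_all add: f_def)
      then show ?thesis using st' D(2)[of ?s "f ?s"] D(3)[of "f ?s" ?s ?t] D(3)[of "f ?s" ?t "f ?t"] by blast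
    qed
    then show ?thesis using vf by (simp add: in_sl_th)
  qed
  moreover have "?g u = u" "?g v = v" using uv fix_\<sigma> by (simp_all add: f_def in_sl_th)
  ultimately show "\<exists>g. g u = u \<and> g v = v \<and>
      (\<forall>d s t. (s, t) \<in> idents d \<longrightarrow> (g s, g t) \<in> idents d \<inter> idents sl_th)" by (intro exI[of _ ?g]) blast
qed (use sl_top sl_prime sl_rec in blast)+

definition regular :: "uterm \<Rightarrow> uterm" where "regular u = Mul (omt u) u"

text \<open>
  An identity of \<open>b\<close> between a variable and another term makes every element a multiple of its
  own square, hence a group element.
\<close>

lemma zm_regular:
  assumes "\<not> b \<le> zm_th" shows "(u, regular u) \<in> idents b"
proof -
  note B = eq_theoryD[OF eq_idents[of b]]
  obtain s0 t0 where "(s0, t0) \<in> idents b" "(s0, t0) \<notin> idents zm_th"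
    using not_leD[OF assms] by blast
  then obtain i t where it: "(Var i, t) \<in> idents b" "t \<noteq> Var i"
    using B(2) by (auto simp: in_zm_th)
  obtain n where n: "\<And>S :: nat unary_alg. S \<in> models (idents b) \<Longrightarrow> epigrp S n"
    using models_epi by blast
  have "(Var 0, regular (Var 0)) \<in> idents b"
  proof (rule identity_by_models)
    fix S :: "nat unary_alg" and v :: "nat \<Rightarrow> nat" assume S: "S \<in> models (idents b)" and v: "\<And>i. v i \<in> carrier S"
    interpret epigrp S n by (rule n[OF S])
    let ?a = "v 0"
    have a: "?a \<in> C" using v .
    have "mul S (om ?a) ?a = ?a"
    proof (cases t)
      case (Var j)
      then have "j \<noteq> i" using it(2) by auto
      moreover have v: "(if k = i then ?a else mul S (om ?a) ?a) \<in> C" for k using a by simp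
      ultimately show ?thesis
        using models_eval[OF S it(1), where v = "\<lambda>k. if k = i then ?a else mul S (om ?a) ?a", OF v] Var
        by simp
    qed (use one_variable_identity_regular[OF a, of t] models_eval[OF S it(1), of "\<lambda>_. ?a"] a in auto)
    then show "eval_term S v (Var 0) = eval_term S v (regular (Var 0))"
      by (simp add: regular_def omt_def)
  qed
  from B(6)[OF this, of "\<lambda>_. u"] show ?thesis by (simp add: regular_def omt_def)
qed

lemma zm_prime:
  assumes "\<not> b \<le> zm_th" "\<not> c \<le> zm_th" shows "\<not> inf b c \<le> zm_th"
proof
  assume "inf b c \<le> zm_th"
  moreover have "(Var 0, regular (Var 0)) \<in> idents (inf b c)"
    using zm_regular assms by (simp add: idents_inf)
  ultimately have "(Var 0, regular (Var 0)) \<in> idents zm_th"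
    unfolding less_eq_epi_th_def by blast
  then show False by (simp add: in_zm_th regular_def)
qed

text \<open>
  Replacing \<open>u\<close> and \<open>v\<close> by \<open>om u \<cdot> u\<close> and \<open>om v \<cdot> v\<close> turns an identity of \<open>b\<close> into one between terms
  that are not variables.
\<close>

lemma zm_rec:
  assumes b: "\<not> b \<le> zm_th" and c: "\<not> c \<le> zm_th" and eq: "inf zm_th b = inf zm_th c"
  shows "b \<le> c"
  unfolding less_eq_epi_th_def
proof (rule subrelI)
  fix u v assume uv: "(u, v) \<in> idents b"
  note B = eq_theoryD[OF eq_idents[of b]] and C = eq_theoryD[OF eq_idents[of c]]
  have "(regular u, regular v) \<in> idents b" using uv B(4,5) by (simp add: regular_def omt_def)
  then have "(regular u, regular v) \<in> idents (inf zm_th b)"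
    by (simp add: idents_inf in_zm_th regular_def image_iff)
  then have "(regular u, regular v) \<in> idents c" using eq by (simp add: idents_inf)
  then show "(u, v) \<in> idents c" using zm_regular[OF c] C(2,3) by blast
qed

lemma zm_top:
  assumes "\<not> b \<le> zm_th" shows "sup zm_th b = top_th"
proof -
  let ?J = "idents (sup zm_th b)"
  note J = eq_theoryD[OF eq_idents[of "sup zm_th b"]]
  have 1: "(u, regular u) \<in> ?J" for u using zm_regular[OF assms] by (auto simp: idents_sup)
  have 2: "(regular u, regular v) \<in> ?J" for u v
    by (auto simp: idents_sup in_zm_th regular_def)
  have "(u, v) \<in> ?J" for u v by (rule J(3)[OF J(3)[OF 1 2] J(2)[OF 1]])
  then have "?J = UNIV" by auto
  then show ?thesis by (metis idents_inject in_top_th)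
qed

text \<open>
  A chain is shifted by replacing each variable \<open>w\<close> by \<open>om w \<cdot> w\<close>.
\<close>

lemma dist_cancel_zm: "dist_cancel zm_th"
proof (rule dist_cancel_coatomI)
  fix u v assume uv: "(u, v) \<in> idents zm_th" "u \<noteq> v"
  define g where "g w = (if w \<in> range Var then regular w else w)" for w
  have reg: "regular w \<notin> range Var" for w by (auto simp: regular_def)
  have gv: "g w \<notin> range Var" for w using reg by (simp add: g_def)
  have "(g s, g t) \<in> idents d \<inter> idents zm_th" if st: "(s, t) \<in> idents d" for d s t
  proof -
    note D = eq_theoryD[OF eq_idents[of d]]
    have "(g s, g t) \<in> idents d"
    proof (cases "d \<le> zm_th")
      case True
      then have "s = t \<or> g s = s \<and> g t = t"
        using st by (auto simp: less_eq_epi_th_def in_zm_th g_def dest!: subsetD[of _ _ "(s, t)"])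
      then show ?thesis using st D(1) by auto
    next
      case False
      then have "(w, g w) \<in> idents d" for w using zm_regular D(1) by (simp add: g_def)
      then show ?thesis using st D(2,3) by blast
    qed
    then show ?thesis using gv by (simp add: in_zm_th)
  qed
  moreover have "g u = u" "g v = v" using uv by (auto simp: in_zm_th g_def)
  ultimately show "\<exists>g. g u = u \<and> g v = v \<and>
      (\<forall>d s t. (s, t) \<in> idents d \<longrightarrow> (g s, g t) \<in> idents d \<inter> idents zm_th)" by (intro exI[of _ g]) blast
qed (use zm_top zm_prime zm_rec in blast)+

lemma in_var_ofI:
  assumes "algebra_21 S"
    "\<And>v s t. (\<And>i. v i \<in> carrier S) \<Longrightarrow> (s, t) \<in> idents a \<Longrightarrow> eval_term S v s = eval_term S v t"
  shows "S \<in> var_of a"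
  unfolding var_of_def models_def satisfies_def using assms by auto

lemma epigroup_algebraE:
  assumes "epigroup_algebra S" "a \<in> carrier S"
  obtains n where "mul S a (bar S a) = mul S (bar S a) a"
    "mul S (mul S (bar S a) a) (bar S a) = bar S a" "mul S (pow_Suc S a (Suc n)) (bar S a) = pow_Suc S a n"
  using assms by (auto simp only: epigroup_algebra_iff)

lemma epigroup_sgrp: "epigroup_algebra S \<Longrightarrow> sgrp S"
  by unfold_locales (simp add: epigroup_algebra_iff)

lemma var_of_epigroup: "S \<in> var_of a \<Longrightarrow> epigroup_algebra (S :: 'a::infinite unary_alg)"
  using carrier_EPI[of "var_of a"] by (auto simp: EPI_def epigroup_variety_def)

lemma var_of_top: "var_of top_th = (TRIV :: 'a::infinite unary_alg set)"
proof (intro equalityI subsetI)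
  fix S :: "'a unary_alg" assume S: "S \<in> var_of top_th"
  have "x = y" if "x \<in> carrier S" "y \<in> carrier S" for x y
    using models_eval[of S UNIV "Var 0" "Var 1" "\<lambda>i. if i = 0 then x else y"] S that
    by (auto simp: var_of_def in_top_th)
  then show "S \<in> TRIV" using var_of_epigroup[OF S] by (simp add: TRIV_def)
next
  fix S :: "'a unary_alg" assume S: "S \<in> TRIV"
  then interpret sgrp S by (auto simp: TRIV_def intro: epigroup_sgrp)
  have "eval_term S v s = eval_term S v t" if "\<And>i. v i \<in> C" for v s t
    using S eval_closed[OF algebra, of v] that by (simp add: TRIV_def)
  note E = this
  show "S \<in> var_of top_th" by (rule in_var_ofI[OF algebra E])
qed

text \<open>
  A semilattice satisfies all identities that preserve the content since pseudoinversion is the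
  identity map on it.
\<close>

lemma var_of_sl: "var_of sl_th = (SL :: 'a::infinite unary_alg set)"
proof (intro equalityI subsetI)
  fix S :: "'a unary_alg" assume S: "S \<in> var_of sl_th"
  have "mul S x y = mul S y x" "mul S x x = x" if "x \<in> carrier S" "y \<in> carrier S" for x y
  proof -
    have v: "(if i = 0 then x else y) \<in> carrier S" for i :: nat using that by simp
    have "(Mul (Var 0) (Var 1), Mul (Var 1) (Var 0)) \<in> idents sl_th"
      "(Mul (Var 0) (Var 0), Var 0) \<in> idents sl_th" by (auto simp: in_sl_th)
    from this[THEN models_eval[OF S[unfolded var_of_def], where v = "\<lambda>i. if i = 0 then x else y"], OF v]
    show "mul S x y = mul S y x" "mul S x x = x" by simp_all
  qed
  then show "S \<in> SL" using var_of_epigroup[OF S] by (auto simp: SL_def)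
next
  fix S :: "'a unary_alg" assume S: "S \<in> SL"
  then have e: "epigroup_algebra S" by (simp add: SL_def)
  interpret sgrp S using epigroup_sgrp[OF e] .
  have bar: "bar S a = a" if "a \<in> C" for a
  proof -
    have "mul S a a = a" using S that unfolding SL_def by blast
    note idem = bar_idem[OF that this]
    show ?thesis by (rule epigroup_algebraE[OF e that]) (erule idem)
  qed
  have "eval_term S v s = eval_term S v t" if "\<And>i. v i \<in> C" "vars s = vars t" for v s t
  proof (rule semilattice_eval[of C, OF subset_refl mul_closed _ _ bar that])
    show "mul S a b = mul S b a" if "a \<in> C" "b \<in> C" for a b using S that unfolding SL_def by blast
    show "mul S a a = a" if "a \<in> C" for a using S that unfolding SL_def by blast
  qed
  note E = this
  show "S \<in> var_of sl_th"
  proof (rule in_var_ofI[OF algebra])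
    fix v :: "nat \<Rightarrow> 'a" and s t assume "\<And>i. v i \<in> C" "(s, t) \<in> idents sl_th"
    then show "eval_term S v s = eval_term S v t" by (intro E) (simp_all only: in_sl_th)
  qed
qed

lemma var_of_zm: "var_of zm_th = (ZM :: 'a::infinite unary_alg set)"
proof (intro equalityI subsetI)
  fix S :: "'a unary_alg" assume S: "S \<in> var_of zm_th"
  have alg: "algebra_21 S" using S models_algebra by (auto simp: var_of_def)
  then obtain c where c: "c \<in> carrier S" by (auto simp: algebra_21_def)
  have "mul S x y = mul S c c" if "x \<in> carrier S" "y \<in> carrier S" for x y
  proof -
    have v: "(if i = 0 then x else if i = 1 then y else c) \<in> carrier S" for i :: nat
      using that c by simp
    have "(Mul (Var 0) (Var 1), Mul (Var 2) (Var 2)) \<in> idents zm_th" by (simp add: in_zm_th)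
    from models_eval[OF S[unfolded var_of_def] this,
        where v = "\<lambda>i. if i = 0 then x else if i = 1 then y else c", OF v] show ?thesis by simp
  qed
  moreover have "mul S c c \<in> carrier S" using alg c by (simp add: algebra_21_def)
  ultimately show "S \<in> ZM" using var_of_epigroup[OF S] unfolding ZM_def by blast
next
  fix S :: "'a unary_alg" assume S: "S \<in> ZM"
  then have e: "epigroup_algebra S" by (simp add: ZM_def)
  interpret sgrp S using epigroup_sgrp[OF e] .
  from S obtain z where z: "z \<in> C" "\<And>x y. x \<in> C \<Longrightarrow> y \<in> C \<Longrightarrow> mul S x y = z" by (auto simp: ZM_def)
  have bar: "bar S a = z" if "a \<in> C" for a
  proof -
    have "mul S (mul S (bar S a) a) (bar S a) = bar S a"
      by (rule epigroup_algebraE[OF e that])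
    moreover have "mul S (mul S (bar S a) a) (bar S a) = z" using that by (intro z(2)) auto
    ultimately show ?thesis by simp
  qed
  have "eval_term S v t = z" if "\<And>i. v i \<in> C" "t \<notin> range Var" for v t
    using that(2) eval_closed[OF algebra, of v] that(1) z(2) bar by (cases t) auto
  then have "eval_term S v s = eval_term S v t"
    if "\<And>i. v i \<in> C" "s = t \<or> s \<notin> range Var \<and> t \<notin> range Var" for v s t
    using that by metis
  note E = this
  show "S \<in> var_of zm_th"
  proof (rule in_var_ofI[OF algebra])
    fix v :: "nat \<Rightarrow> 'a" and s t assume "\<And>i. v i \<in> C" "(s, t) \<in> idents zm_th"
    then show "eval_term S v s = eval_term S v t" by (intro E) (simp_all only: in_zm_th)
  qed
qed

lemma var_of_inf: "var_of (inf sl_th zm_th) = join EPI (SL :: 'a::infinite unary_alg set) ZM"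
  by (simp only: join_EPI[symmetric] var_of_sl var_of_zm)

lemma special_dist_cancel:
  assumes "a = top_th \<or> a = sl_th \<or> a = zm_th \<or> a = inf sl_th zm_th" shows "dist_cancel a"
  using assms dist_cancel_top_th dist_cancel_sl dist_cancel_zm dist_cancel_inf by blast

lemma above_sl_zm:
  assumes "inf sl_th zm_th \<le> a"
  shows "a = top_th \<or> a = sl_th \<or> a = zm_th \<or> a = inf sl_th zm_th"
  by (rule above_inf_coatoms[OF sl_not_le_zm zm_not_le_sl zm_prime sl_rec zm_rec assms])

section \<open>Words\<close>

primrec has_bar :: "uterm \<Rightarrow> bool" where
  "has_bar (Var i) \<longleftrightarrow> False"
| "has_bar (Mul s t) \<longleftrightarrow> has_bar s \<or> has_bar t"
| "has_bar (Bar t) \<longleftrightarrow> True"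

primrec letters :: "uterm \<Rightarrow> nat list" where
  "letters (Var i) = [i]"
| "letters (Mul s t) = letters s @ letters t"
| "letters (Bar t) = letters t"

lemma letters_nonempty [simp]: "letters t \<noteq> []"
  by (induction t) auto

lemma set_letters: "set (letters t) = vars t"
  by (induction t) auto

lemma letters_tpow [simp]: "letters (tpow (Var i) m) = replicate (Suc m) i"
  by (induction m) (auto simp: replicate_append_same)

lemma has_bar_tpow [simp]: "has_bar (tpow t m) = has_bar t"
  by (induction m) auto

fun word_prod :: "'a unary_alg \<Rightarrow> 'a list \<Rightarrow> 'a" where
  "word_prod S [] = undefined"
| "word_prod S [a] = a"
| "word_prod S (a # b # as) = mul S a (word_prod S (b # as))"

lemma (in sgrp) word_prod_closed [simp]: "as \<noteq> [] \<Longrightarrow> set as \<subseteq> C \<Longrightarrow> word_prod S as \<in> C"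
proof (induction as)
  case (Cons a as) then show ?case by (cases as) auto
qed simp

lemma (in sgrp) word_prod_append:
  "as \<noteq> [] \<Longrightarrow> bs \<noteq> [] \<Longrightarrow> set as \<subseteq> C \<Longrightarrow> set bs \<subseteq> C \<Longrightarrow>
   word_prod S (as @ bs) = word_prod S as \<cdot> word_prod S bs"
proof (induction as)
  case (Cons a as)
  show ?case
  proof (cases as)
    case Nil then show ?thesis using Cons by (cases bs) auto
  next
    case (Cons b as')
    then have "word_prod S (as @ bs) = word_prod S as \<cdot> word_prod S bs" using Cons.IH Cons.prems by auto
    then show ?thesis using Cons Cons.prems by (simp add: assoc)
  qed
qed simp

lemma (in sgrp) eval_word:
  assumes "\<And>i. v i \<in> C" "\<not> has_bar t"
  shows "eval_term S v t = word_prod S (map v (letters t))"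
  using assms(2)
proof (induction t)
  case (Mul s t)
  then show ?case using assms(1) by (subst letters.simps, subst map_append, subst word_prod_append) auto
qed auto

text \<open>
  Such terms differ in bracketing only.
\<close>

lemma same_word_identity:
  assumes "\<not> has_bar s" "\<not> has_bar t" "letters s = letters t" shows "(s, t) \<in> idents a"
proof (rule identity_by_models)
  fix S :: "nat unary_alg" and v :: "nat \<Rightarrow> nat"
  assume S: "S \<in> models (idents a)" and v: "\<And>i. v i \<in> carrier S"
  obtain n where "epigrp S n" using models_epi S by metis
  then interpret epigrp S n .
  show "eval_term S v s = eval_term S v t" using eval_word[of v] v assms by simp
qed

definition th_of :: "'a unary_alg \<Rightarrow> epi_th" where "th_of S = Abs_epi_th (Ids {S})"

lemma idents_th_of:
  assumes "bounded_epigroup n S" shows "idents (th_of S) = Ids {S}"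
proof -
  have alg: "algebra_21 S" using assms by (simp add: bounded_epigroup_def semigroup_21_def)
  then have "eq_theory (Ids {S})" by (intro eq_theory_Ids) simp
  moreover have "epi_axioms n \<subseteq> Ids {S}" using bounded_epigroup_iff[OF alg] assms by (auto simp: Ids_def)
  ultimately have "epi_theory (Ids {S})" by (auto simp: epi_theory_def)
  then show ?thesis by (simp add: th_of_def Abs_epi_th_inverse)
qed

lemma in_th_of:
  assumes "bounded_epigroup n S"
  shows "(s, t) \<in> idents (th_of S) \<longleftrightarrow>
    (\<forall>v. (\<forall>i. v i \<in> carrier S) \<longrightarrow> eval_term S v s = eval_term S v t)"
  by (simp add: idents_th_of[OF assms] in_Ids)

text \<open>
  This is how identities are shown not to belong to a join: a set of terms that neither theory
  leaves cannot be left by chains.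
\<close>

lemma sup_closed_set:
  assumes "(s, t) \<in> idents (sup b c)" "s \<in> X"
    "\<And>p q. p \<in> X \<Longrightarrow> (p, q) \<in> idents b \<Longrightarrow> q \<in> X" "\<And>p q. p \<in> X \<Longrightarrow> (p, q) \<in> idents c \<Longrightarrow> q \<in> X"
  shows "t \<in> X"
  using assms(1) unfolding idents_sup by induction (use assms in blast)+

lemma in_sup:
  "(s, t) \<in> idents b \<Longrightarrow> (s, t) \<in> idents (sup b c)" "(s, t) \<in> idents c \<Longrightarrow> (s, t) \<in> idents (sup b c)"
  by (auto simp: idents_sup)

lemma sup_trans3:
  assumes "(p, q) \<in> idents (sup b c)" "(q, r) \<in> idents (sup b c)" "(r, s) \<in> idents (sup b c)"
  shows "(p, s) \<in> idents (sup b c)"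
  using assms eq_theoryD(3)[OF eq_idents] by blast

section \<open>Nilpotent algebras in which two words are identified\<close>

locale two_words =
  fixes U W :: "nat list"
  assumes U_nonempty: "U \<noteq> []" and shorter: "length U < length W" and not_factor: "\<not> sublist U W"
begin

text \<open>
  Words that are factors of neither \<open>U\<close> nor \<open>W\<close> are zero, represented by \<^const>\<open>None\<close>, and \<open>W\<close>
  is represented by \<open>U\<close>. This is compatible with concatenation because all proper extensions
  of \<open>U\<close> and \<open>W\<close> are zero.
\<close>

definition nf :: "nat list \<Rightarrow> nat list option" where
  "nf w = (if w = W then Some U else if sublist w U \<or> sublist w W then Some w else None)"

text \<open>
  In a nilpotent semigroup the pseudoinverse of every element is zero.
\<close>

definition nil_alg :: "nat list option unary_alg" where
  "nil_alg = \<lparr>carrier = insert None (Some ` {w. w \<noteq> [] \<and> nf w = Some w}),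
     mul = (\<lambda>x y. case x of None \<Rightarrow> None | Some p \<Rightarrow> (case y of None \<Rightarrow> None | Some q \<Rightarrow> nf (p @ q))),
     bar = (\<lambda>x. None)\<rparr>"

lemma U_neq_W: "U \<noteq> W" using shorter by auto

lemma nf_U: "nf U = Some U" using U_neq_W by (simp add: nf_def)

lemma nf_W: "nf W = Some U" by (simp add: nf_def)

lemma nf_Some: "nf w = Some r \<longleftrightarrow> w = W \<and> r = U \<or> w \<noteq> W \<and> r = w \<and> (sublist w U \<or> sublist w W)"
  by (auto simp: nf_def)

lemma nf_None: "nf w = None \<longleftrightarrow> \<not> sublist w U \<and> \<not> sublist w W"
  by (auto simp: nf_def)

lemma nf_factor: "nf w = None \<Longrightarrow> nf (p @ w @ q) = None"
  unfolding nf_None by (meson sublist_appendI sublist_order.order.trans)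

lemma nf_extend: "s \<noteq> [] \<Longrightarrow> nf (U @ s) = None" "s \<noteq> [] \<Longrightarrow> nf (s @ U) = None"
  "s \<noteq> [] \<Longrightarrow> nf (W @ s) = None" "s \<noteq> [] \<Longrightarrow> nf (s @ W) = None"
proof -
  assume s: "s \<noteq> []"
  have "\<not> sublist (U @ s) W" "\<not> sublist (s @ U) W"
    using not_factor by (meson sublist_append_leftI sublist_append_rightI sublist_order.order.trans)+
  moreover have "\<not> sublist w w'" if "length w' < length w" for w w' :: "nat list"
    using that sublist_length_le[of w w'] by linarith
  ultimately show "nf (U @ s) = None" "nf (s @ U) = None" "nf (W @ s) = None" "nf (s @ W) = None"
    unfolding nf_None using s shorter by auto
qed

lemma nf_append:
  assumes "nf w = Some r" "s \<noteq> []" shows "nf (r @ s) = nf (w @ s)" "nf (s @ r) = nf (s @ w)"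
  using assms(1) nf_extend[OF assms(2)] by (auto simp: nf_Some)

lemma nf_idem: "nf w = Some r \<Longrightarrow> nf r = Some r" by (auto simp: nf_Some nf_U U_neq_W)

lemma nf_nonempty: "nf w = Some r \<Longrightarrow> w \<noteq> [] \<Longrightarrow> r \<noteq> []" using U_nonempty by (auto simp: nf_Some)

lemma nil_alg_simps [simp]:
  "mul nil_alg None y = None" "mul nil_alg x None = None" "mul nil_alg (Some p) (Some q) = nf (p @ q)"
  "bar nil_alg x = None" "None \<in> carrier nil_alg" "Some w \<in> carrier nil_alg \<longleftrightarrow> w \<noteq> [] \<and> nf w = Some w"
  by (auto simp: nil_alg_def split: option.splits)

lemma nil_alg_mul_closed: "x \<in> carrier nil_alg \<Longrightarrow> y \<in> carrier nil_alg \<Longrightarrow> mul nil_alg x y \<in> carrier nil_alg"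
proof (cases x; cases y; simp)
  fix p q assume "p \<noteq> [] \<and> nf p = Some p" "q \<noteq> [] \<and> nf q = Some q"
  then show "nf (p @ q) \<in> carrier nil_alg"
    using nf_idem[of "p @ q"] nf_nonempty[of "p @ q"] by (cases "nf (p @ q)") auto
qed

lemma nil_alg_assoc:
  assumes "x \<in> carrier nil_alg" "y \<in> carrier nil_alg" "z \<in> carrier nil_alg"
  shows "mul nil_alg (mul nil_alg x y) z = mul nil_alg x (mul nil_alg y z)"
proof (cases x; cases y; cases z; simp)
  fix p q s assume s: "x = Some p" "y = Some q" "z = Some s"
  then have n: "p \<noteq> []" "s \<noteq> []" using assms by auto
  have "mul nil_alg (nf (p @ q)) (Some s) = nf (p @ q @ s)"
    using nf_append(1)[of "p @ q" _ s] nf_factor[of "p @ q" "[]" s] n by (cases "nf (p @ q)") auto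
  moreover have "mul nil_alg (Some p) (nf (q @ s)) = nf (p @ q @ s)"
    using nf_append(2)[of "q @ s" _ p] nf_factor[of "q @ s" p "[]"] n by (cases "nf (q @ s)") auto
  ultimately show "mul nil_alg (nf (p @ q)) (Some s) = mul nil_alg (Some p) (nf (q @ s))" by simp
qed

text \<open>
  Each multiplication lengthens the word; only the passage from \<open>W\<close> to \<open>U\<close> shortens it, and
  thereafter every product vanishes.
\<close>

lemma nil_alg_pow:
  assumes "x \<in> carrier nil_alg" "pow_Suc nil_alg x k = Some r"
  shows "Suc k \<le> length W \<and> (r = U \<or> Suc k \<le> length r)"
  using assms(2)
proof (induction k arbitrary: r)
  case 0
  then have "r \<noteq> []" using assms(1) by auto
  then show ?case using shorter by (cases r) auto
next
  case (Suc k)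
  then obtain p q where p: "x = Some p" "pow_Suc nil_alg x k = Some q" "nf (q @ p) = Some r"
    by (cases x; cases "pow_Suc nil_alg x k") auto
  then have "p \<noteq> []" using assms(1) by simp
  moreover from this have "q \<noteq> U" using p nf_extend(1)[of p] by auto
  ultimately have l: "Suc (Suc k) \<le> length (q @ p)" using Suc.IH[OF p(2)] by (cases p) auto
  have "sublist (q @ p) U \<or> sublist (q @ p) W" using p(3) by (auto simp: nf_Some)
  then have "length (q @ p) \<le> length W" using sublist_length_le shorter by fastforce
  then show ?case using l p(3) by (auto simp: nf_Some)
qed

lemma bounded_nil_alg: "bounded_epigroup (length W) nil_alg"
proof -
  have "pow_Suc nil_alg x (length W) = None" if "x \<in> carrier nil_alg" for x
    using nil_alg_pow[OF that, of "length W"] by (cases "pow_Suc nil_alg x (length W)") auto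
  then show ?thesis
    unfolding bounded_epigroup_def semigroup_21_def algebra_21_def
    using nil_alg_mul_closed nil_alg_assoc by (auto intro: nil_alg_simps(5))
qed

lemma nil_alg_eval:
  assumes v: "\<And>i. v i \<in> carrier nil_alg"
  shows "eval_term nil_alg v t = (if has_bar t \<or> (\<exists>i\<in>vars t. v i = None) then None
    else nf (concat (map (\<lambda>i. the (v i)) (letters t))))"
proof (induction t)
  case (Var i)
  then show ?case using v[of i] by (cases "v i") auto
next
  case (Mul s t)
  show ?case
  proof (cases "has_bar (Mul s t) \<or> (\<exists>i\<in>vars (Mul s t). v i = None)")
    case True
    then have "eval_term nil_alg v s = None \<or> eval_term nil_alg v t = None"
      unfolding Mul.IH by auto
    then show ?thesis using True by auto
  next
    case False
    let ?c = "\<lambda>t. concat (map (\<lambda>i. the (v i)) (letters t))"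
    have ne: "?c p \<noteq> []" if "\<forall>i\<in>vars p. v i \<noteq> None" for p
    proof -
      obtain i where i: "i \<in> set (letters p)" using letters_nonempty[of p] last_in_set by blast
      then have "v i \<noteq> None" using that set_letters by blast
      then obtain w where w: "v i = Some w" by blast
      then have "w \<noteq> []" using v[of i] by simp
      then show ?thesis using i w by force
    qed
    have e: "eval_term nil_alg v s = nf (?c s)" "eval_term nil_alg v t = nf (?c t)"
      using Mul.IH False by (auto simp del: not_None_eq)
    have n: "?c s \<noteq> []" "?c t \<noteq> []" using ne False by auto
    have "mul nil_alg (nf (?c s)) (nf (?c t)) = nf (?c s @ ?c t)"
    proof (cases "nf (?c s)")
      case None then show ?thesis using nf_factor[of "?c s" "[]" "?c t"] by simp
    next
      case s: (Some p)
      show ?thesis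
      proof (cases "nf (?c t)")
        case None then show ?thesis using nf_factor[of "?c t" "?c s" "[]"] by simp
      next
        case t: (Some q)
        have "nf (p @ q) = nf (?c s @ q)" using nf_append(1)[OF s] nf_nonempty[OF t n(2)] .
        also have "\<dots> = nf (?c s @ ?c t)" using nf_append(2)[OF t n(1)] .
        finally show ?thesis using s t by simp
      qed
    qed
    then show ?thesis using False e by (auto simp del: not_None_eq)
  qed
qed simp

text \<open>
  Give each letter of \<open>U\<close> itself as its value. The only words that then evaluate to \<open>U\<close> are \<open>U\<close> and \<open>W\<close>.
\<close>

lemma nil_alg_class:
  assumes s: "\<not> has_bar s" "letters s = U" and st: "(s, t) \<in> idents (th_of nil_alg)"
  shows "\<not> has_bar t \<and> (letters t = U \<or> letters t = W)"
proof -
  define v where "v i = (if i \<in> set U then Some [i] else None)" for i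
  have v: "v i \<in> carrier nil_alg" for i
  proof (cases "i \<in> set U")
    case True
    then obtain p q where "U = p @ [i] @ q" by (metis append_Cons append_Nil in_set_conv_decomp)
    then have sub: "sublist [i] U" unfolding sublist_def by blast
    moreover have "[i] \<noteq> W" using shorter U_nonempty by (cases U) auto
    ultimately show ?thesis using True by (simp add: v_def nf_def)
  qed (simp add: v_def)
  have c: "concat (map (\<lambda>i. the (v i)) w) = w" if "set w \<subseteq> set U" for w
    using that by (induction w) (auto simp: v_def)
  have vn: "v i = None \<longleftrightarrow> i \<notin> set U" for i by (simp add: v_def)
  have "eval_term nil_alg v s = Some U"
    using s c[of U] set_letters[of s] nf_U by (auto simp: nil_alg_eval[OF v] vn)
  moreover have "eval_term nil_alg v s = eval_term nil_alg v t"
    using st v by (simp add: in_th_of[OF bounded_nil_alg])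
  ultimately have "eval_term nil_alg v t = Some U" by simp
  then have t: "\<not> has_bar t" "vars t \<subseteq> set U" "nf (concat (map (\<lambda>i. the (v i)) (letters t))) = Some U"
    by (auto simp: nil_alg_eval[OF v] vn split: if_splits)
  then have "nf (letters t) = Some U" using c[of "letters t"] by (simp add: set_letters)
  then show ?thesis using t(1) by (auto simp: nf_Some)
qed

lemma nil_alg_zero:
  assumes "\<And>t v. t \<in> {p, q} \<Longrightarrow> \<not> has_bar t \<Longrightarrow> (\<And>i. v i \<noteq> []) \<Longrightarrow> nf (concat (map v (letters t))) = None"
  shows "(p, q) \<in> idents (th_of nil_alg)"
  unfolding in_th_of[OF bounded_nil_alg]
proof (intro allI impI)
  fix v :: "nat \<Rightarrow> nat list option" assume "\<forall>i. v i \<in> carrier nil_alg"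
  then have v: "v i \<in> carrier nil_alg" for i by blast
  have "eval_term nil_alg v t = None" if t: "t \<in> {p, q}" for t
  proof (cases "has_bar t \<or> (\<exists>i\<in>vars t. v i = None)")
    case False
    define w where "w i = (if v i = None then [0] else the (v i))" for i
    have w: "w i \<noteq> []" for i using v[of i] by (cases "v i") (auto simp: w_def)
    have "concat (map (\<lambda>i. the (v i)) (letters t)) = concat (map w (letters t))"
      by (rule arg_cong[where f = concat], rule map_cong) (use False in \<open>auto simp: w_def set_letters\<close>)
    then show ?thesis using False assms[where v = w, OF t _ w] by (simp add: nil_alg_eval[OF v])
  qed (auto simp: nil_alg_eval[OF v])
  then show "eval_term nil_alg v p = eval_term nil_alg v q" by simp
qed

text \<open>
  Two terms that spell \<open>U\<close> and \<open>W\<close> agree at the valuation that gives each letter itself as its value.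
  At all others both vanish.
\<close>

lemma nil_alg_identified:
  assumes p: "\<not> has_bar p" "letters p = U" and q: "\<not> has_bar q" "letters q = W" and UW: "set U = set W"
    and canonical: "\<And>v w i. w \<in> {U, W} \<Longrightarrow> (\<And>i. v i \<noteq> []) \<Longrightarrow> nf (concat (map v w)) \<noteq> None \<Longrightarrow> i \<in> set U \<Longrightarrow> v i = [i]"
  shows "(p, q) \<in> idents (th_of nil_alg)"
  unfolding in_th_of[OF bounded_nil_alg]
proof (intro allI impI)
  fix v :: "nat \<Rightarrow> nat list option" assume "\<forall>i. v i \<in> carrier nil_alg"
  then have v: "v i \<in> carrier nil_alg" for i by blast
  have vars: "vars p = set U" "vars q = set U" using p q UW set_letters by auto
  show "eval_term nil_alg v p = eval_term nil_alg v q"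
  proof (cases "\<exists>i\<in>set U. v i = None")
    case False
    define w where "w i = (if v i = None then [0] else the (v i))" for i
    have w: "w i \<noteq> []" for i using v[of i] by (cases "v i") (auto simp: w_def)
    have mw: "concat (map (\<lambda>i. the (v i)) u) = concat (map w u)" if "set u = set U" for u
      by (rule arg_cong[where f = concat], rule map_cong) (use False that in \<open>auto simp: w_def\<close>)
    have ev: "eval_term nil_alg v p = nf (concat (map w U))" "eval_term nil_alg v q = nf (concat (map w W))"
      using False p q vars mw[OF refl] mw[OF UW[symmetric]] by (auto simp: nil_alg_eval[OF v])
    show ?thesis
    proof (cases "nf (concat (map w U)) = None \<and> nf (concat (map w W)) = None")
      case True then show ?thesis by (simp add: ev)
    next
      case False
      then have "w i = [i]" if "i \<in> set U" for i using canonical[of U w i] canonical[of W w i] w that by auto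
      then have "concat (map w u) = u" if "set u \<subseteq> set U" for u using that by (induction u) auto
      then show ?thesis using UW by (simp add: ev nf_U nf_W)
    qed
  qed (use p q vars in \<open>auto simp: nil_alg_eval[OF v]\<close>)
qed

end

section \<open>Words with a long power of one letter\<close>

text \<open>
  The length forces \<open>p\<close> to be a single letter. Both powers have at least five letters, and at most
  four letters precede either; so they overlap in position 4, counted from 0, and the letter is 0. All occurrences
  of 0 are then used up.
\<close>

lemma power_factor:
  assumes eq: "h @ replicate n (0::nat) @ e = x @ concat (replicate n p) @ y" and p: "p \<noteq> []"
    and h: "0 \<notin> set h" "length h \<le> 1" and e: "0 \<notin> set e" "length e \<le> 3" and n: "5 \<le> n"
  shows "x = h \<and> p = [0] \<and> y = e"
proof -
  have l: "length h + n + length e = length x + n * length p + length y"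
    using arg_cong[OF eq, of length] by (simp add: length_concat sum_list_replicate)
  have "length p = 1"
  proof (rule ccontr)
    assume "length p \<noteq> 1"
    moreover have "length p \<noteq> 0" using p by simp
    ultimately have "2 \<le> length p" by linarith
    then have "n * 2 \<le> n * length p" by (rule mult_le_mono2)
    then show False using l h e n by linarith
  qed
  then obtain d where pd: "p = [d]" by (cases p) auto
  have c: "concat (replicate n p) = replicate n d" unfolding pd by (induction n) auto
  have lx: "length x \<le> 4" using l h e pd by simp
  have "(x @ replicate n d @ y) ! 4 = d" using lx n by (auto simp: nth_append)
  moreover have "(h @ replicate n 0 @ e) ! 4 = 0" using h n by (auto simp: nth_append)
  ultimately have d: "d = 0" using eq c by simp
  have count: "count_list x 0 + count_list y 0 = 0"
    using arg_cong[OF eq, of "\<lambda>w. count_list w 0"] h e unfolding c d by (simp add: count_notin)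
  then have x0: "0 \<notin> set x" by (simp add: count_list_0_iff)
  have "takeWhile (\<lambda>i. i \<noteq> 0) (u @ replicate n 0 @ w) = u" if u: "0 \<notin> set u" for u w :: "nat list"
  proof -
    have "i \<noteq> 0" if "i \<in> set u" for i using u that by metis
    then show ?thesis using n by (subst takeWhile_append2) (auto simp: gr0_conv_Suc dest!: Suc_le_D)
  qed
  from this[OF x0, of y] this[OF h(1), of e]
  have "x = h" using eq c d by simp
  then show ?thesis using eq c d pd by simp
qed

text \<open>
  With \<open>x\<close>, \<open>y\<close>, \<open>z\<close> for the letters 0, 1, 2, these are the words \<open>y x\<^sup>n z\<close> and, according to \<open>k\<close>,
  \<open>x\<^sup>n z z y\<close> or \<open>x\<^sup>n z y y\<close>. The middle power keeps other substitution instances away. Of two such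
  algebras, each identifies \<open>y x\<^sup>n z\<close> with one of the longer words and annihilates the other.
\<close>

definition Uw :: "nat \<Rightarrow> nat list" where "Uw n = [1] @ replicate n 0 @ [2]"
definition Ww :: "bool \<Rightarrow> nat \<Rightarrow> nat list" where "Ww k n = replicate n 0 @ (if k then [2, 1, 1] else [2, 2, 1])"

lemma two_words_UW: assumes n: "5 \<le> n" shows "two_words (Uw n) (Ww k n)"
proof
  show "\<not> sublist (Uw n) (Ww k n)"
  proof
    assume "sublist (Uw n) (Ww k n)"
    then obtain x y where "Ww k n = x @ Uw n @ y" unfolding sublist_def by blast
    then have "[] @ replicate n 0 @ (if k then [2, 1, 1] else [2, 2, 1]) = (x @ [1]) @ concat (replicate n [0]) @ ([2] @ y)"
      by (simp add: Ww_def Uw_def concat_replicate_single)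
    from power_factor[OF this] n show False by (cases k) auto
  qed
qed (auto simp: Uw_def Ww_def)

context
  fixes n :: nat and k :: bool
  assumes n: "5 \<le> n"
begin

interpretation two_words "Uw n" "Ww k n" using two_words_UW[OF n] .

lemma factor_cases:
  assumes "nf w \<noteq> None" "w = a @ concat (replicate n p) @ b" "p \<noteq> []"
  shows "p = [0] \<and> ((\<exists>x y. x @ a = [1] \<and> b @ y = [2]) \<or>
    a = [] \<and> (\<exists>y. b @ y = (if k then [2, 1, 1] else [2, 2, 1])))"
proof -
  from assms(1) consider "sublist w (Uw n)" | "sublist w (Ww k n)" by (auto simp: nf_None)
  then show ?thesis
  proof cases
    case 1
    then obtain x y where "Uw n = x @ w @ y" unfolding sublist_def by blast
    then have "[1] @ replicate n 0 @ [2] = (x @ a) @ concat (replicate n p) @ (b @ y)"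
      using assms(2) by (simp add: Uw_def)
    from power_factor[OF this assms(3)] n show ?thesis by auto
  next
    case 2
    then obtain x y where "Ww k n = x @ w @ y" unfolding sublist_def by blast
    then have "[] @ replicate n 0 @ (if k then [2, 1, 1] else [2, 2, 1]) = (x @ a) @ concat (replicate n p) @ (b @ y)"
      using assms(2) by (simp add: Ww_def)
    from power_factor[OF this assms(3)] n show ?thesis by (auto split: if_splits)
  qed
qed

lemma map_word: "concat (map v (Uw n)) = v 1 @ concat (replicate n (v 0)) @ v 2"
  "concat (map v (Ww j n)) = [] @ concat (replicate n (v 0)) @ (if j then v 2 @ v 1 @ v 1 else v 2 @ v 2 @ v 1)"
  by (simp_all add: Uw_def Ww_def map_replicate_const)

lemma canonical:
  assumes w: "w \<in> {Uw n, Ww k n}" and v: "\<And>i. v i \<noteq> []" and nz: "nf (concat (map v w)) \<noteq> None"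
    and i: "i \<in> set (Uw n)"
  shows "v i = [i]"
proof -
  have "v 0 = [0] \<and> v 1 = [1] \<and> v 2 = [2]"
    using w
  proof (elim insertE emptyE)
    assume w: "w = Uw n"
    from factor_cases[OF nz[unfolded w] map_word(1) v] v[of 1] v[of 2]
    show ?thesis by (auto simp: append_eq_Cons_conv)
  next
    assume w: "w = Ww k n"
    from factor_cases[OF nz[unfolded w] map_word(2) v] v[of 1] v[of 2]
    show ?thesis by (auto simp: append_eq_Cons_conv split: if_splits)
  qed
  then show ?thesis using i n by (auto simp: Uw_def split: if_splits)
qed

lemma other_word_zero:
  assumes v: "\<And>i. v i \<noteq> []" shows "nf (concat (map v (Ww (\<not> k) n))) = None"
proof (rule ccontr)
  assume nz: "nf (concat (map v (Ww (\<not> k) n))) \<noteq> None"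
  from factor_cases[OF this map_word(2) v] v[of 1] v[of 2] show False
    by (auto simp: append_eq_Cons_conv split: if_splits)
qed

lemma UW_identified:
  assumes "\<not> has_bar p" "letters p = Uw n" "\<not> has_bar q" "letters q = Ww k n"
  shows "(p, q) \<in> idents (th_of nil_alg)"
proof (rule nil_alg_identified[OF assms])
  show "set (Uw n) = set (Ww k n)" using n by (auto simp: Uw_def Ww_def)
qed (rule canonical)

lemma UW_zero:
  assumes "has_bar p \<or> letters p = Ww (\<not> k) n" "has_bar q \<or> letters q = Ww (\<not> k) n"
  shows "(p, q) \<in> idents (th_of nil_alg)"
  by (rule nil_alg_zero) (use assms other_word_zero in auto)

lemmas UW_class = nil_alg_class

end

section \<open>An identity forced by costandardness or lower modularity\<close>

text \<open>
  The argument stands for \<open>x\<^sup>n\<close>, or for a term that equals \<open>x\<^sup>n\<close> in a given variety but contains a bar,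
  so that it vanishes in nilpotent algebras.
\<close>

definition U_term :: "uterm \<Rightarrow> uterm" where "U_term p = Mul (Mul (Var 1) p) (Var 2)"

definition W_term :: "bool \<Rightarrow> uterm \<Rightarrow> uterm" where
  "W_term k p = Mul (Mul (Mul p (Var 2)) (Var (if k then 1 else 2))) (Var 1)"

definition nil_th :: "bool \<Rightarrow> nat \<Rightarrow> epi_th" where
  "nil_th k m = th_of (two_words.nil_alg (Uw (Suc m)) (Ww k (Suc m)))"

lemma letters_U_term: "letters (U_term (tpow (Var 0) m)) = Uw (Suc m)"
  by (simp add: U_term_def Uw_def)

lemma letters_W_term: "letters (W_term k (tpow (Var 0) m)) = Ww k (Suc m)"
  by (simp add: W_term_def Ww_def)

lemma has_bar_UW_term [simp]: "has_bar (U_term p) = has_bar p" "has_bar (W_term k p) = has_bar p"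
  by (simp_all add: U_term_def W_term_def)

lemma UW_term_cong:
  "(p, q) \<in> idents a \<Longrightarrow> (U_term p, U_term q) \<in> idents a"
  "(p, q) \<in> idents a \<Longrightarrow> (W_term k p, W_term k q) \<in> idents a"
  using eq_theoryD(1,4)[OF eq_idents[of a]] by (simp_all add: U_term_def W_term_def)

lemma nil_th_class:
  assumes "4 \<le> m" "\<not> has_bar s" "letters s = Uw (Suc m)" "(s, t) \<in> idents (nil_th k m)"
  shows "\<not> has_bar t \<and> (letters t = Uw (Suc m) \<or> letters t = Ww k (Suc m))"
  using UW_class[where n = "Suc m" and k = k and s = s and t = t] assms by (simp add: nil_th_def)

lemma Ww_differ: "Ww k n \<noteq> Ww (\<not> k) n" by (simp add: Ww_def)

lemma Uw_Ww_differ: "Uw n \<noteq> Ww k n" by (auto simp: Uw_def Ww_def dest: arg_cong[of _ _ length])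

lemma omega_identity:
  assumes "epi_axioms m \<subseteq> idents a"
  shows "(tpow (Var 0) m, Mul (tpow (Var 0) (Suc m)) (Bar (Var 0))) \<in> idents a"
proof -
  have "(Mul (tpow (Var 0) (Suc m)) (Bar (Var 0)), tpow (Var 0) m) \<in> idents a"
    using assms by (simp add: epi_axioms_def Let_def)
  then show ?thesis by (rule eq_theoryD(2)[OF eq_idents])
qed

text \<open>
  Write \<open>p = x\<^sup>n\<close> and let \<open>q\<close> be a term with a bar that equals \<open>p\<close> in \<open>a\<close>. Let \<open>b\<close> and \<open>c\<close> be the two
  nilpotent theories, in which \<open>y p z\<close> equals \<open>p z y y\<close> and \<open>p z z y\<close> respectively. The chain
  \<open>y p z = p z y y = q z y y = p z z y\<close> consists of steps in \<open>b\<close>, \<open>a\<close>, \<open>b\<close>, and its ends are related by \<open>c\<close>.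
  Hence a chain of steps in \<open>inf a c\<close> and \<open>inf b c\<close> connects the ends. Since \<open>inf b c\<close> leaves the word
  \<open>y p z\<close> alone, \<open>a\<close> relates \<open>y p z\<close> to the only other word in its class modulo \<open>c\<close>.
\<close>

lemma costandard_UW:
  assumes co: "\<And>b c. inf (sup a b) c = sup (inf a c) (inf b c)"
    and m: "4 \<le> m" "epi_axioms m \<subseteq> idents a"
  shows "(U_term (tpow (Var 0) m), W_term False (tpow (Var 0) m)) \<in> idents a"
proof (rule ccontr)
  let ?p = "tpow (Var 0) m" and ?q = "Mul (tpow (Var 0) (Suc m)) (Bar (Var 0))"
  let ?b = "nil_th True m" and ?c = "nil_th False m"
  assume no: "(U_term ?p, W_term False ?p) \<notin> idents a"
  have n: "5 \<le> Suc m" using m by simp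
  have h1: "(U_term ?p, W_term True ?p) \<in> idents ?b" unfolding nil_th_def
    by (rule UW_identified[OF n]) (simp_all add: letters_U_term letters_W_term)
  have h2: "(W_term True ?p, W_term True ?q) \<in> idents a"
    by (rule UW_term_cong(2)[OF omega_identity[OF m(2)]])
  have h3: "(W_term True ?q, W_term False ?p) \<in> idents ?b" unfolding nil_th_def
    by (rule UW_zero[OF n]) (simp_all add: letters_W_term)
  have "(U_term ?p, W_term False ?p) \<in> idents (sup a ?b)"
    by (rule sup_trans3[OF in_sup(2)[OF h1] in_sup(1)[OF h2] in_sup(2)[OF h3]])
  moreover have UWc: "(U_term ?p, W_term False ?p) \<in> idents ?c" unfolding nil_th_def
    by (rule UW_identified[OF n]) (simp_all add: letters_U_term letters_W_term)
  ultimately have "(U_term ?p, W_term False ?p) \<in> idents (inf (sup a ?b) ?c)"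
    by (simp add: idents_inf)
  then have in_join: "(U_term ?p, W_term False ?p) \<in> idents (sup (inf a ?c) (inf ?b ?c))"
    by (simp only: co)
  let ?X = "{t. \<not> has_bar t \<and> letters t = Uw (Suc m)}"
  have "W_term False ?p \<in> ?X"
  proof (rule sup_closed_set[OF in_join])
    show "U_term ?p \<in> ?X" by (simp add: letters_U_term)
  next
    fix s t assume s: "s \<in> ?X" and st: "(s, t) \<in> idents (inf a ?c)"
    then have t: "\<not> has_bar t \<and> (letters t = Uw (Suc m) \<or> letters t = Ww False (Suc m))"
      using nil_th_class[OF m(1)] by (auto simp: idents_inf)
    have "letters t \<noteq> Ww False (Suc m)"
    proof
      assume "letters t = Ww False (Suc m)"
      then have "(t, W_term False ?p) \<in> idents a"
        using t by (intro same_word_identity) (simp_all add: letters_W_term)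
      moreover have "(U_term ?p, s) \<in> idents a"
        using s by (intro same_word_identity) (simp_all add: letters_U_term)
      moreover have "(s, t) \<in> idents a" using st by (simp add: idents_inf)
      ultimately show False
        using no eq_theoryD(3)[OF eq_idents, OF eq_theoryD(3)[OF eq_idents]] by blast
    qed
    then show "t \<in> ?X" using t by simp
  next
    fix s t assume s: "s \<in> ?X" and st: "(s, t) \<in> idents (inf ?b ?c)"
    then show "t \<in> ?X"
      using nil_th_class[OF m(1), of s t True] nil_th_class[OF m(1), of s t False] Ww_differ[of True "Suc m"]
      by (auto simp: idents_inf)
  qed
  then show False using Uw_Ww_differ[of "Suc m" False] by (simp add: letters_W_term)
qed

text \<open>
  With \<open>p\<close> and \<open>q\<close> as before, \<open>a\<close> satisfies \<open>y p z = y q z\<close>, and the chain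
  \<open>y p z = p z z y = q z z y = y q z\<close> consists of steps in \<open>c\<close>, in \<open>a\<close>, and in \<open>c\<close>. The middle step
  belongs to the theory \<open>b\<close> below \<open>a\<close> that \<open>a\<close> shares with the other nilpotent theory, since both
  sides vanish there. By lower modularity, steps in \<open>inf c a\<close> and in \<open>b\<close> connect the two ends,
  and the first of them that leaves the word \<open>y p z\<close> yields the identity.
\<close>

lemma lower_modular_UW:
  assumes lm: "\<And>b c. b \<le> a \<Longrightarrow> inf (sup c b) a = sup (inf c a) b"
    and m: "4 \<le> m" "epi_axioms m \<subseteq> idents a"
  shows "\<exists>k. (U_term (tpow (Var 0) m), W_term k (tpow (Var 0) m)) \<in> idents a"
proof (rule ccontr)
  let ?p = "tpow (Var 0) m" and ?q = "Mul (tpow (Var 0) (Suc m)) (Bar (Var 0))"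
  let ?b = "inf a (nil_th True m)" and ?c = "nil_th False m"
  assume "\<not> ?thesis"
  then have no: "(U_term ?p, W_term k ?p) \<notin> idents a" for k by blast
  have n: "5 \<le> Suc m" using m by simp
  note pq = omega_identity[OF m(2)]
  have h1: "(U_term ?p, W_term False ?p) \<in> idents ?c" unfolding nil_th_def
    by (rule UW_identified[OF n]) (simp_all add: letters_U_term letters_W_term)
  have h2: "(W_term False ?p, W_term False ?q) \<in> idents ?b"
    unfolding idents_inf nil_th_def
    by (intro IntI UW_term_cong(2)[OF pq] UW_zero[OF n]) (simp_all add: letters_W_term)
  have h3: "(W_term False ?q, U_term ?q) \<in> idents ?c" unfolding nil_th_def
    by (rule UW_zero[OF n]) simp_all
  have "(U_term ?p, U_term ?q) \<in> idents (sup ?c ?b)"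
    by (rule sup_trans3[OF in_sup(1)[OF h1] in_sup(2)[OF h2] in_sup(1)[OF h3]])
  then have "(U_term ?p, U_term ?q) \<in> idents (inf (sup ?c ?b) a)"
    using UW_term_cong(1)[OF pq] by (simp add: idents_inf)
  then have in_join: "(U_term ?p, U_term ?q) \<in> idents (sup (inf ?c a) ?b)"
    by (simp only: lm[of ?b ?c, OF inf_le1])
  let ?X = "{t. \<not> has_bar t \<and> letters t = Uw (Suc m)}"
  have closed: "t \<in> ?X" if s: "s \<in> ?X" and st: "(s, t) \<in> idents a" "(s, t) \<in> idents (nil_th k m)" for s t k
  proof -
    have t: "\<not> has_bar t \<and> (letters t = Uw (Suc m) \<or> letters t = Ww k (Suc m))"
      using nil_th_class[OF m(1)] s st by blast
    have "letters t \<noteq> Ww k (Suc m)"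
    proof
      assume "letters t = Ww k (Suc m)"
      then have "(t, W_term k ?p) \<in> idents a"
        using t by (intro same_word_identity) (simp_all add: letters_W_term)
      moreover have "(U_term ?p, s) \<in> idents a"
        using s by (intro same_word_identity) (simp_all add: letters_U_term)
      ultimately show False
        using no[of k] eq_theoryD(3)[OF eq_idents, OF eq_theoryD(3)[OF eq_idents, OF _ st(1)]] by blast
    qed
    then show "t \<in> ?X" using t by simp
  qed
  have "U_term ?q \<in> ?X"
  proof (rule sup_closed_set[OF in_join])
    show "U_term ?p \<in> ?X" by (simp add: letters_U_term)
    show "t \<in> ?X" if "s \<in> ?X" "(s, t) \<in> idents (inf ?c a)" for s t
      by (rule closed[OF that(1), where k = False]) (use that(2) in \<open>simp_all only: idents_inf Int_iff\<close>)
    show "t \<in> ?X" if "s \<in> ?X" "(s, t) \<in> idents ?b" for s t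
      by (rule closed[OF that(1), where k = True]) (use that(2) in \<open>simp_all only: idents_inf Int_iff\<close>)
  qed
  then show False by simp
qed

section \<open>Nil extensions of semilattices with central idempotents\<close>

text \<open>
  The idempotents of such an algebra are the values of pseudoinversion. They form a semilattice
  and an ideal, and pseudoinversion is a homomorphism onto them.
\<close>

locale nilsemi = epigrp +
  assumes bar_power: "x \<in> C \<Longrightarrow> bar S x = pw x n"
    and bar_absorb: "x \<in> C \<Longrightarrow> x \<cdot> bar S x = bar S x"
    and bar_central: "x \<in> C \<Longrightarrow> y \<in> C \<Longrightarrow> bar S x \<cdot> y = y \<cdot> bar S x"
    and bar_square: "x \<in> C \<Longrightarrow> y \<in> C \<Longrightarrow> bar S x \<cdot> y \<cdot> y = bar S x \<cdot> y"
begin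

lemma bar_bar_idem: "x \<in> C \<Longrightarrow> bar S x \<cdot> bar S x = bar S x"
  using om_idem[of x] bar_absorb[of x] by simp

lemma bar_bar: "x \<in> C \<Longrightarrow> bar S (bar S x) = bar S x"
  by (simp add: bar_fix bar_bar_idem)

lemma bar_pow: "x \<in> C \<Longrightarrow> y \<in> C \<Longrightarrow> bar S x \<cdot> pw y k = bar S x \<cdot> y"
proof (induction k)
  case (Suc k)
  then have "bar S x \<cdot> pw y (Suc k) = bar S x \<cdot> y \<cdot> y" by (simp add: assoc[symmetric])
  then show ?case using Suc by (simp add: bar_square)
qed simp

lemma bar_mult: "x \<in> C \<Longrightarrow> y \<in> C \<Longrightarrow> bar S x \<cdot> y = bar S x \<cdot> bar S y"
  using bar_pow[of x y n] bar_power[of y] by simp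

lemma bar_hom:
  assumes x: "x \<in> C" and y: "y \<in> C" shows "bar S (x \<cdot> y) = bar S x \<cdot> bar S y"
proof -
  define e f g where "e = bar S (x \<cdot> y)" and "f = bar S x" and "g = bar S y"
  have C: "e \<in> C" "f \<in> C" "g \<in> C" using x y by (auto simp: e_def f_def g_def)
  have "e = e \<cdot> (x \<cdot> y)" using bar_absorb[of "x \<cdot> y"] bar_central[of "x \<cdot> y" "x \<cdot> y"] x y by (simp add: e_def)
  also have "\<dots> = e \<cdot> x \<cdot> y" using C x y by (simp add: assoc)
  also have "e \<cdot> x = e \<cdot> f" using bar_mult[of "x \<cdot> y" x] x y by (simp add: e_def f_def)
  also have "e \<cdot> f \<cdot> y = e \<cdot> (f \<cdot> y)" using C x y by (simp add: assoc)
  also have "f \<cdot> y = f \<cdot> g" using bar_mult[of x y] x y by (simp add: f_def g_def)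
  finally have 1: "e = e \<cdot> (f \<cdot> g)" .
  have gy: "g \<cdot> y = g" "f \<cdot> x = f" "g \<cdot> x = x \<cdot> g"
    using bar_absorb[of y] bar_central[of y y] bar_absorb[of x] bar_central[of x x] bar_central[of y x] x y
    by (simp_all add: f_def g_def)
  have "f \<cdot> g \<cdot> (x \<cdot> y) = f \<cdot> (g \<cdot> x) \<cdot> y" using C x y by (simp add: assoc)
  also have "\<dots> = f \<cdot> x \<cdot> (g \<cdot> y)" unfolding gy(3) using C x y by (simp add: assoc)
  finally have "f \<cdot> g \<cdot> (x \<cdot> y) = f \<cdot> g" by (simp add: gy)
  moreover have "g \<cdot> (x \<cdot> y) = g \<cdot> e" using bar_mult[of y "x \<cdot> y"] x y by (simp add: g_def e_def)
  then have "f \<cdot> g \<cdot> (x \<cdot> y) = f \<cdot> g \<cdot> e" using C x y by (simp add: assoc)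
  ultimately have "f \<cdot> g = f \<cdot> g \<cdot> e" by simp
  moreover have "f \<cdot> g \<cdot> e = e \<cdot> (f \<cdot> g)" using bar_central[of "x \<cdot> y" "f \<cdot> g"] C x y by (simp add: e_def)
  ultimately show ?thesis using 1 by (simp add: e_def f_def g_def)
qed

definition absorbing :: "'a \<Rightarrow> bool" where "absorbing c \<longleftrightarrow> c \<in> C \<and> bar S c = c"

lemma absorbing_bar: "x \<in> C \<Longrightarrow> absorbing (bar S x)"
  by (simp add: absorbing_def bar_bar)

lemma absorbing_mult:
  assumes "absorbing c" "d \<in> C" shows "absorbing (c \<cdot> d)" "absorbing (d \<cdot> c)"
proof -
  have c: "c \<in> C" "bar S c = c" using assms(1) by (auto simp: absorbing_def)
  show "absorbing (c \<cdot> d)"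
    using bar_mult[of c d] bar_hom[of c d] c assms(2) by (simp add: absorbing_def)
  then show "absorbing (d \<cdot> c)" using bar_central[of c d] c assms(2) by simp
qed

text \<open>
  From \<open>c = c d\<close> follows \<open>c = c d\<^sup>k\<close> for all \<open>k\<close>, and some power of \<open>d\<close> is the idempotent \<open>bar d\<close>.
\<close>

lemma absorbing_fixed:
  assumes c: "c \<in> C" and d: "d \<in> C" and fx: "c = c \<cdot> d \<or> c = d \<cdot> c" shows "absorbing c"
  using fx
proof
  assume "c = c \<cdot> d"
  then have "c = c \<cdot> pw d k" for k
    by (induction k) (use c d assoc[of c "pw d _" d] in \<open>auto simp: assoc\<close>, metis assoc pow_closed)
  from this[of n] have "c = c \<cdot> bar S d" using bar_power[OF d] by simp
  then show ?thesis using absorbing_mult(2)[OF absorbing_bar[OF d] c] by simp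
next
  assume f: "c = d \<cdot> c"
  have "c = pw d k \<cdot> c" for k
    by (induction k) (use f c d in \<open>auto simp: assoc\<close>)
  from this[of n] have "c = bar S d \<cdot> c" using bar_power[OF d] by simp
  then show ?thesis using absorbing_mult(1)[OF absorbing_bar[OF d] c] by simp
qed

lemma absorbing_eval:
  assumes "\<And>i. v i \<in> C" "has_bar t \<or> (\<exists>z\<in>vars t. absorbing (v z))"
  shows "absorbing (eval_term S v t)"
  using assms(2)
proof (induction t)
  case (Mul s t)
  have C: "eval_term S v s \<in> C" "eval_term S v t \<in> C" using eval_closed[OF algebra] assms(1) by auto
  show ?case
  proof (cases "has_bar s \<or> (\<exists>z\<in>vars s. absorbing (v z))")
    case True
    then show ?thesis using absorbing_mult(1)[OF Mul.IH(1) C(2)] by simp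
  next
    case False
    then have "has_bar t \<or> (\<exists>z\<in>vars t. absorbing (v z))" using Mul.prems by auto
    then show ?thesis using absorbing_mult(2)[OF Mul.IH(2) C(1)] by simp
  qed
next
  case (Bar t)
  have "eval_term S v t \<in> C" using eval_closed[OF algebra] assms(1) by auto
  then show ?case using absorbing_bar by simp
qed auto

text \<open>
  Suppose that \<open>x y = s\<close> holds. If \<open>s\<close> has a bar, its value is absorbing. A variable of \<open>s\<close> other than
  \<open>x\<close> and \<open>y\<close>, or one of these two that is missing in \<open>s\<close>, can be given an absorbing value without
  changing \<open>x y\<close> or \<open>s\<close>. In the remaining case \<open>s\<close> spells a word of length at least 3 in both letters. Identifying
  \<open>x\<close> and \<open>y\<close> shows that \<open>x x\<close> equals a multiple of \<open>x x\<close>, so squares are absorbing. It is then enough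
  to find a square in \<open>s\<close>, or to read \<open>x y = s\<close> as \<open>x y = x y \<cdot> r\<close> or as \<open>x y = y \<cdot> x y\<close>; one of these
  occurs among the first four letters.
\<close>

lemma products_absorbing:
  assumes id: "\<And>v. (\<And>i. v i \<in> C) \<Longrightarrow> eval_term S v (Mul (Var 0) (Var 1)) = eval_term S v s"
    and s: "s \<noteq> Mul (Var 0) (Var 1)" "s \<noteq> Mul (Var 1) (Var 0)"
    and a: "a \<in> C" and b: "b \<in> C"
  shows "absorbing (a \<cdot> b)"
proof -
  define val where "val x y z i = (if i = 0 then x else if i = 1 then y else z)" for x y z :: 'a and i :: nat
  have valC: "val x y z i \<in> C" if "x \<in> C" "y \<in> C" "z \<in> C" for x y z i using that by (simp add: val_def)
  have ev: "x \<cdot> y = eval_term S (val x y z) s" if "x \<in> C" "y \<in> C" "z \<in> C" for x y z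
    using id[of "val x y z"] valC[OF that] by (simp add: val_def)
  have bar: "absorbing (bar S a)" "absorbing (bar S b)" using absorbing_bar a b by auto
  show ?thesis
  proof (cases "has_bar s \<or> \<not> vars s \<subseteq> {0, 1}")
    case True
    \<comment> \<open>All variables other than \<open>x\<close> and \<open>y\<close> get an absorbing value.\<close>
    then have "has_bar s \<or> (\<exists>z\<in>vars s. absorbing (val a b (bar S a) z))"
      using bar by (auto simp: val_def)
    then show ?thesis
      using absorbing_eval[of "val a b (bar S a)" s] valC ev[of a b "bar S a"] a b by simp
  next
    case False
    note no_bar_vars = this
    show ?thesis
    proof (cases "vars s = {0, 1}")
      case False
      then consider "0 \<notin> vars s" | "1 \<notin> vars s" using no_bar_vars by blast
      then show ?thesis
      proof cases
        case 1
        have "eval_term S (val a b a) s = eval_term S (val (bar S a) b a) s"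
          by (rule eval_cong) (use 1 in \<open>auto simp: val_def intro!: Nat.gr0I\<close>)
        then have "a \<cdot> b = bar S a \<cdot> b" using ev[of a b a] ev[of "bar S a" b a] a b by simp
        then show ?thesis using absorbing_mult(1)[OF bar(1) b] by simp
      next
        case 2
        have "eval_term S (val a b a) s = eval_term S (val a (bar S b) a) s"
          by (rule eval_cong) (use 2 in \<open>auto simp: val_def\<close>)
        then have "a \<cdot> b = a \<cdot> bar S b" using ev[of a b a] ev[of a "bar S b" a] a b by simp
        then show ?thesis using absorbing_mult(2)[OF bar(2) a] by simp
      qed
    next
      case True
      define w where "w = letters s"
      have wv: "set w = {0, 1}" using True set_letters w_def by metis
      have wp: "x \<cdot> y = word_prod S (map (val x y x) w)" if "x \<in> C" "y \<in> C" for x y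
        using ev[of x y x] eval_word[of "val x y x" s] valC no_bar_vars that by (simp add: w_def)
      have len: "3 \<le> length w"
      proof (rule ccontr)
        assume "\<not> 3 \<le> length w"
        then consider "w = []" | i where "w = [i]" | i j where "w = [i, j]"
          by (cases w; cases "tl w"; cases "tl (tl w)") auto
        then show False
        proof cases
          case 3
          then obtain p q where pq: "s = Mul p q" "letters p = [i]" "letters q = [j]"
            using no_bar_vars unfolding w_def
            by (cases s) (auto simp: append_eq_Cons_conv)
          have single: "p = Var i" if "letters p = [i]" "\<not> has_bar p" for p i
            using that by (cases p) (auto simp: append_eq_Cons_conv)
          have "s = Mul (Var i) (Var j)" using pq single no_bar_vars by auto
          then show False using wv 3 s by (auto simp: doubleton_eq_iff)
        qed (use wv in \<open>auto simp: w_def\<close>)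
      qed
      have square: "absorbing (x \<cdot> x)" if x: "x \<in> C" for x
      proof -
        obtain i j w' where w': "w = i # j # w'" "w' \<noteq> []" using len
          by (cases w; cases "tl w"; cases "tl (tl w)") auto
        have "map (val x x x) w = [x, x] @ map (val x x x) w'" using w' by (simp add: val_def)
        then have "x \<cdot> x = x \<cdot> x \<cdot> word_prod S (map (val x x x) w')"
          using wp[OF x x] word_prod_append[of "[x, x]" "map (val x x x) w'"] w'(2) x valC
          by (auto simp: val_def)
        moreover have "word_prod S (map (val x x x) w') \<in> C" using w'(2) valC x by (auto intro!: word_prod_closed)
        ultimately show ?thesis using absorbing_fixed x mul_closed by metis
      qed
      have factor: "absorbing (a \<cdot> b)" if w': "map (val a b a) w = p @ q @ r" "q \<noteq> []" "absorbing (word_prod S q)" for p q r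
      proof -
        have "set p \<union> (set q \<union> set r) = val a b a ` set w" using arg_cong[OF w'(1), of set] by simp
        moreover have "val a b a ` set w \<subseteq> C" using valC[OF a b a] by auto
        ultimately have C: "set p \<subseteq> C" "set q \<subseteq> C" "set r \<subseteq> C" by auto
        have "absorbing (word_prod S (q @ r))"
          using word_prod_append[of q r] w' C absorbing_mult(1) by (cases "r = []") auto
        then have "absorbing (word_prod S (p @ q @ r))"
          using word_prod_append[of p "q @ r"] w' C absorbing_mult(2) by (cases "p = []") auto
        then show ?thesis using wp[OF a b] w' by simp
      qed
      have tail: "absorbing (a \<cdot> b)" if "map (val a b a) w = [a, b] @ r" "r \<noteq> []" for r
      proof -
        have "insert a (insert b (set r)) = val a b a ` set w" using arg_cong[OF that(1), of set] by simp
        moreover have "val a b a ` set w \<subseteq> C" using valC[OF a b a] by auto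
        ultimately have C: "set r \<subseteq> C" by auto
        then have "a \<cdot> b = a \<cdot> b \<cdot> word_prod S r"
          using wp[OF a b] word_prod_append[of "[a, b]" r] that a b by auto
        then show ?thesis using absorbing_fixed[of "a \<cdot> b" "word_prod S r"] C that a b by auto
      qed
      obtain i j k w' where w': "w = i # j # k # w'" using len
        by (cases w; cases "tl w"; cases "tl (tl w)") auto
      have ijk: "i = 0 \<or> i = 1" "j = 0 \<or> j = 1" "k = 0 \<or> k = 1" "set w' \<subseteq> {0, 1}"
        using equalityD1[OF wv] unfolding w' by auto
      have val: "val a b a 0 = a" "val a b a (Suc 0) = b" by (simp_all add: val_def)
      show ?thesis
      proof (cases "i = j \<or> j = k")
        case True
        then show ?thesis
        proof
          assume "i = j"
          then show ?thesis
            using factor[of "[]" "[val a b a i, val a b a i]" "map (val a b a) (k # w')"]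
              square[OF valC[OF a b a]] w' by simp
        next
          assume "j = k"
          then show ?thesis
            using factor[of "[val a b a i]" "[val a b a j, val a b a j]" "map (val a b a) w'"]
              square[OF valC[OF a b a]] w' by simp
        qed
      next
        case False
        then consider "i = 0" "j = 1" "k = 0" | "i = 1" "j = 0" "k = 1" using ijk by auto
        then show ?thesis
        proof cases
          case 1 then show ?thesis using tail[of "a # map (val a b a) w'"] w' val by simp
        next
          case 2
          show ?thesis
          proof (cases w')
            case Nil
            then have "a \<cdot> b = b \<cdot> (a \<cdot> b)" using wp[OF a b] w' 2 val by simp
            then show ?thesis using absorbing_fixed[of "a \<cdot> b" b] a b by auto
          next
            case (Cons l w'')
            then consider "l = 0" | "l = 1" using ijk by auto
            then show ?thesis
            proof cases
              case 1
              have "word_prod S [b, a, b, a] = b \<cdot> a \<cdot> (b \<cdot> a)" using a b by (simp add: assoc)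
              then have "absorbing (word_prod S [b, a, b, a])" using square[of "b \<cdot> a"] a b by simp
              then show ?thesis
                using factor[of "[]" "[b, a, b, a]" "map (val a b a) w''"] w' 2 1 Cons val by simp
            next
              case l: 2
              show ?thesis
                using factor[of "[b, a]" "[b, b]" "map (val a b a) w''"] square[OF b] w' 2 l Cons val by simp
            qed
          qed
        qed
      qed
    qed
  qed
qed

text \<open>
  A term that is not a variable takes an absorbing value, which pseudoinversion fixes; and
  pseudoinversion carries the evaluation over to the semilattice of idempotents.
\<close>

lemma products_absorbing_identity:
  assumes prod: "\<And>a b. a \<in> C \<Longrightarrow> b \<in> C \<Longrightarrow> absorbing (a \<cdot> b)"
    and st: "s = t \<or> vars s = vars t \<and> s \<notin> range Var \<and> t \<notin> range Var"
    and v: "\<And>i. v i \<in> C"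
  shows "eval_term S v s = eval_term S v t"
proof -
  have C: "eval_term S v p \<in> C" for p using eval_closed[OF algebra v] .
  have nonvar: "eval_term S v p = bar S (eval_term S v p)" if "p \<notin> range Var" for p
    using that prod C absorbing_bar by (cases p) (auto simp: absorbing_def)
  have hom: "bar S (eval_term S v p) = eval_term S (\<lambda>i. bar S (v i)) p" for p
    by (induction p) (use C bar_hom in auto)
  have "eval_term S (\<lambda>i. bar S (v i)) s = eval_term S (\<lambda>i. bar S (v i)) t" if "vars s = vars t"
  proof (rule semilattice_eval[of "{e. absorbing e}", OF _ _ _ _ _ _ that])
    fix x y assume "x \<in> {e. absorbing e}" "y \<in> {e. absorbing e}"
    then have xy: "x \<in> C" "y \<in> C" "bar S x = x" "bar S y = y" "absorbing x" by (auto simp: absorbing_def)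
    show "x \<cdot> y \<in> {e. absorbing e}" using absorbing_mult(1) xy by simp
    show "x \<cdot> y = y \<cdot> x" using bar_central[of x y] xy by simp
  next
    fix x assume "x \<in> {e. absorbing e}"
    then have x: "x \<in> C" "bar S x = x" by (auto simp: absorbing_def)
    show "x \<cdot> x = x" using bar_bar_idem[of x] x by simp
    show "bar S x = x" by (rule x)
  qed (use v absorbing_bar in \<open>auto simp: absorbing_def\<close>)
  then show ?thesis using st nonvar hom by metis
qed

end

text \<open>
  Putting \<open>x = y = z\<close> shows that the powers of \<open>x\<close> become stationary, so that a power of \<open>x\<close> is the
  idempotent \<open>bar x\<close>. Then put \<open>bar x\<close> for \<open>x\<close> and, in turn, for \<open>z\<close> and \<open>y\<close>.
\<close>

lemma (in epigrp) nilsemiI: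
  assumes id: "\<And>x y z. x \<in> C \<Longrightarrow> y \<in> C \<Longrightarrow> z \<in> C \<Longrightarrow>
    y \<cdot> pw x n \<cdot> z = pw x n \<cdot> z \<cdot> (if k then y else z) \<cdot> y"
  shows "nilsemi S n"
proof -
  have bar_pw: "bar S x = pw x n" and bar_abs: "x \<cdot> bar S x = bar S x" if x: "x \<in> C" for x
  proof -
    have "x \<cdot> pw x n \<cdot> x = pw x n \<cdot> x \<cdot> x \<cdot> x" using id[OF x x x] by simp
    then have h: "pw x (Suc (Suc n)) = pw x (Suc (Suc (Suc n)))"
      using pow_add[OF x, of 0 n] by simp
    have b: "pw x (Suc (Suc n)) \<cdot> bar S x = pw x (Suc n)" "pw x (Suc (Suc (Suc n))) \<cdot> bar S x = pw x (Suc (Suc n))"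
      using bounded_epigroup_mono[OF bounded, of "Suc n"] bounded_epigroup_mono[OF bounded, of "Suc (Suc n)"] x
      unfolding bounded_epigroup_def by simp_all
    have "pw x (Suc n) = pw x (Suc (Suc n))" using b h by metis
    then have 1: "pw x n = pw x (Suc n)" using b(1) pow_index[OF x] by metis
    then have p: "pw x n \<cdot> bar S x = pw x n" using pow_index[OF x] by simp
    have "pw x n \<cdot> pw (bar S x) j = pw x n" for j
      by (induction j) (use p x in \<open>simp_all add: assoc[symmetric]\<close>)
    then have om: "om x = pw x n" using om_pow(1)[OF x, of n] by simp
    show 2: "bar S x = pw x n" using bar_inner[OF x] p om by simp
    show "x \<cdot> bar S x = bar S x" using om 2 by simp
  qed
  have e: "pw (bar S x) n = bar S x" if x: "x \<in> C" for x
    using bar_abs[OF x] om_idem[OF x] by (intro pow_idem) simp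
  have ide: "y \<cdot> bar S x \<cdot> z = bar S x \<cdot> z \<cdot> (if k then y else z) \<cdot> y" if "x \<in> C" "y \<in> C" "z \<in> C" for x y z
    using id[of "bar S x" y z] e that by simp
  have both: "bar S x \<cdot> y = y \<cdot> bar S x \<and> bar S x \<cdot> y \<cdot> y = bar S x \<cdot> y" if x: "x \<in> C" and y: "y \<in> C" for x y
  proof -
    let ?e = "bar S x"
    have E: "?e \<in> C" "?e \<cdot> ?e = ?e" using x bar_abs[OF x] om_idem[OF x] by auto
    have ee: "?e \<cdot> (?e \<cdot> w) = ?e \<cdot> w" if "w \<in> C" for w using E that assoc[of ?e ?e w] by simp
    have 1: "y \<cdot> ?e = (if k then ?e \<cdot> y \<cdot> y else ?e \<cdot> y)"
      using ide[OF x y E(1)] E y by (auto simp: assoc ee)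
    have 2: "?e \<cdot> y = (if k then ?e \<cdot> y \<cdot> ?e else ?e \<cdot> y \<cdot> y \<cdot> ?e)"
    proof -
      have "?e \<cdot> y \<cdot> ?e \<cdot> ?e = ?e \<cdot> y \<cdot> ?e" using E y by (simp add: assoc)
      then show ?thesis using ide[OF x E(1) y] unfolding E(2) by (cases k) simp_all
    qed
    show ?thesis
    proof (cases k)
      case True
      then have 3: "?e \<cdot> y = ?e \<cdot> (y \<cdot> ?e)" "y \<cdot> ?e = ?e \<cdot> (y \<cdot> y)" using 1 2 E y by (simp_all add: assoc)
      then have 4: "?e \<cdot> y = ?e \<cdot> (y \<cdot> y)" using ee[of "y \<cdot> y"] y by simp
      moreover have "?e \<cdot> y \<cdot> y = ?e \<cdot> (y \<cdot> y)" using E y by (simp add: assoc)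
      ultimately show ?thesis using 3(2) by metis
    next
      case False
      then have c: "y \<cdot> ?e = ?e \<cdot> y" using 1 by simp
      have "?e \<cdot> y = ?e \<cdot> y \<cdot> y \<cdot> ?e" using False 2 by (simp only: if_False)
      also have "\<dots> = ?e \<cdot> (y \<cdot> (y \<cdot> ?e))" using E y by (simp add: assoc)
      also have "y \<cdot> (y \<cdot> ?e) = ?e \<cdot> (y \<cdot> y)" using c E y by (metis assoc)
      finally have "?e \<cdot> y = ?e \<cdot> (y \<cdot> y)" using ee[of "y \<cdot> y"] y by simp
      moreover have "?e \<cdot> y \<cdot> y = ?e \<cdot> (y \<cdot> y)" using E y by (simp add: assoc)
      ultimately show ?thesis using c by metis
    qed
  qed
  show ?thesis by unfold_locales (use bar_pw bar_abs both in blast)+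
qed

lemma models_nilsemi:
  assumes UW: "(U_term (tpow (Var 0) m), W_term k (tpow (Var 0) m)) \<in> idents a"
    and ax: "epi_axioms m \<subseteq> idents a" and S: "S \<in> models (idents a)"
  shows "nilsemi S m"
proof -
  have b: "bounded_epigroup m S" by (rule theory_bounded_epigroup[OF ax S])
  then interpret epigrp S m by unfold_locales (simp_all add: bounded_epigroup_def)
  show ?thesis
  proof (rule nilsemiI[of k])
    fix x y z assume "x \<in> C" "y \<in> C" "z \<in> C"
    then have v: "(if i = 0 then x else if i = 1 then y else z) \<in> C" for i :: nat by simp
    from models_eval[OF S UW, where v = "\<lambda>i. if i = 0 then x else if i = 1 then y else z", OF v]
    show "mul S (mul S y (pw x m)) z = mul S (mul S (mul S (pw x m) z) (if k then y else z)) y"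
      by (auto simp: U_term_def W_term_def split: if_splits)
  qed
qed

lemma nilsemi_identities:
  assumes "\<And>S :: nat unary_alg. S \<in> models (idents a) \<Longrightarrow> nilsemi S m"
  shows "(Mul (tpow (Var 0) m) (Var 1), Mul (Var 0) (tpow (Var 1) m)) \<in> idents a"
    "(Mul (tpow (Var 0) m) (Var 1), Mul (tpow (Var 1) m) (Var 0)) \<in> idents a"
proof -
  have both: "mul S (pow_Suc S x m) y = mul S (bar S x) (bar S y)" "mul S x (pow_Suc S y m) = mul S (bar S x) (bar S y)"
      "mul S (pow_Suc S y m) x = mul S (bar S x) (bar S y)"
    if "S \<in> models (idents a)" "x \<in> carrier S" "y \<in> carrier S" for S :: "nat unary_alg" and x y
  proof -
    interpret nilsemi S m by (rule assms[OF that(1)])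
    note xy = that(2,3)
    have p: "pow_Suc S x m = bar S x" "pow_Suc S y m = bar S y" using bar_power xy by simp_all
    have c: "mul S (bar S x) (bar S y) = mul S (bar S y) (bar S x)" by (rule bar_central) (use xy in auto)
    show "mul S (pow_Suc S x m) y = mul S (bar S x) (bar S y)" unfolding p by (rule bar_mult[OF xy])
    show "mul S (pow_Suc S y m) x = mul S (bar S x) (bar S y)" unfolding p c by (rule bar_mult[OF xy(2,1)])
    then show "mul S x (pow_Suc S y m) = mul S (bar S x) (bar S y)"
      unfolding p by (simp only: bar_central[OF xy(2,1)])
  qed
  show "(Mul (tpow (Var 0) m) (Var 1), Mul (Var 0) (tpow (Var 1) m)) \<in> idents a"
    by (rule identity_by_models) (simp only: eval_term.simps eval_tpow both(1,2))
  show "(Mul (tpow (Var 0) m) (Var 1), Mul (tpow (Var 1) m) (Var 0)) \<in> idents a"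
    by (rule identity_by_models, unfold eval_term.simps eval_tpow)
      (rule trans[OF both(1) both(3)[symmetric]])
qed

lemma above_from_product_identity:
  assumes nil: "\<And>S :: nat unary_alg. S \<in> models (idents a) \<Longrightarrow> nilsemi S m"
    and id: "(Mul (Var 0) (Var 1), s) \<in> idents a"
    and s: "s \<noteq> Mul (Var 0) (Var 1)" "s \<noteq> Mul (Var 1) (Var 0)"
  shows "inf sl_th zm_th \<le> a"
  unfolding less_eq_epi_th_def
proof (rule subrelI)
  fix p q assume "(p, q) \<in> idents (inf sl_th zm_th)"
  then have pq: "p = q \<or> vars p = vars q \<and> p \<notin> range Var \<and> q \<notin> range Var"
    by (auto simp only: idents_inf Int_iff in_sl_th in_zm_th)
  show "(p, q) \<in> idents a"
  proof (rule identity_by_models)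
    fix S :: "nat unary_alg" and v :: "nat \<Rightarrow> nat"
    assume S: "S \<in> models (idents a)" and v: "\<And>i. v i \<in> carrier S"
    interpret nilsemi S m by (rule nil[OF S])
    have ev: "eval_term S w (Mul (Var 0) (Var 1)) = eval_term S w s" if "\<And>i. w i \<in> C" for w
      by (rule models_eval[OF S id that])
    have "absorbing (mul S x y)" if "x \<in> C" "y \<in> C" for x y
      by (rule products_absorbing[OF ev s that])
    then show "eval_term S v p = eval_term S v q" by (rule products_absorbing_identity[OF _ pq v])
  qed
qed

section \<open>Four small algebras\<close>

text \<open>
  In these algebras 0 is a zero. In the first, 1 is an idempotent with \<open>1 \<cdot> 2 = 2\<close>, and all other
  products of nonzero elements vanish; the second is its opposite. The third and the fourth are
  nilpotent with the product \<open>1 \<cdot> 2 = 3\<close>, commutative in the third. If \<open>x\<close> and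
  \<open>y\<close> get the values whose product does not vanish, few terms besides \<open>x y\<close> take the same value as \<open>x y\<close>.
\<close>

definition left_alg :: "nat unary_alg" where
  "left_alg = \<lparr>carrier = {0, 1, 2}, mul = (\<lambda>a b. if a = 1 then b else 0), bar = (\<lambda>a. if a = 1 then 1 else 0)\<rparr>"

definition right_alg :: "nat unary_alg" where
  "right_alg = \<lparr>carrier = {0, 1, 2}, mul = (\<lambda>a b. if b = 1 then a else 0), bar = (\<lambda>a. if a = 1 then 1 else 0)\<rparr>"

definition comm_nil_alg :: "nat unary_alg" where
  "comm_nil_alg = \<lparr>carrier = {0, 1, 2, 3}, mul = (\<lambda>a b. if a = 1 \<and> b = 2 \<or> a = 2 \<and> b = 1 then 3 else 0), bar = (\<lambda>a. 0)\<rparr>"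

definition word_nil_alg :: "nat unary_alg" where
  "word_nil_alg = \<lparr>carrier = {0, 1, 2, 3}, mul = (\<lambda>a b. if a = 1 \<and> b = 2 then 3 else 0), bar = (\<lambda>a. 0)\<rparr>"

lemmas small_alg_defs = left_alg_def right_alg_def comm_nil_alg_def word_nil_alg_def

lemma small_alg_simps [simp]:
  "mul left_alg a b = (if a = 1 then b else 0)" "bar left_alg a = Suc 0 \<longleftrightarrow> a = Suc 0" "bar left_alg a \<noteq> 2"
  "mul right_alg a b = (if b = 1 then a else 0)" "bar right_alg a = Suc 0 \<longleftrightarrow> a = Suc 0" "bar right_alg a \<noteq> 2"
  "mul comm_nil_alg a b = (if a = 1 \<and> b = 2 \<or> a = 2 \<and> b = 1 then 3 else 0)" "bar comm_nil_alg a = 0"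
  "mul word_nil_alg a b = (if a = 1 \<and> b = 2 then 3 else 0)" "bar word_nil_alg a = 0"
  by (simp_all add: small_alg_defs)

lemma bounded_small:
  "bounded_epigroup 1 left_alg" "bounded_epigroup 1 right_alg"
  "bounded_epigroup 1 comm_nil_alg" "bounded_epigroup 1 word_nil_alg"
  unfolding bounded_epigroup_def semigroup_21_def algebra_21_def by (auto simp: small_alg_defs)

lemmas in_small_th = bounded_small[THEN in_th_of]

abbreviation "XY \<equiv> Mul (Var 0) (Var 1)"
abbreviation "YX \<equiv> Mul (Var 1) (Var 0)"

lemma pow_small:
  "pow_Suc left_alg x m = (if x = 1 then 1 else if m = 0 then x else 0)"
  "pow_Suc right_alg x m = (if x = 1 then 1 else if m = 0 then x else 0)"
  "pow_Suc word_nil_alg x m = (if m = 0 then x else 0)"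
  by (induction m) auto

lemma left_th_pow:
  "(XY, Mul (tpow (Var 0) m) (Var 1)) \<in> idents (th_of left_alg)"
  "(Mul (tpow (Var 1) m) (Var 0), YX) \<in> idents (th_of left_alg)"
  by (auto simp: in_small_th pow_small)

lemma right_th_pow: "(Mul (Var 0) (tpow (Var 1) m), XY) \<in> idents (th_of right_alg)"
  by (auto simp: in_small_th pow_small)

lemma word_nil_th_pow:
  "1 \<le> m \<Longrightarrow> (Mul (tpow (Var 0) m) (Var 1), Mul (tpow (Var 1) m) (Var 0)) \<in> idents (th_of word_nil_alg)"
  by (auto simp: in_small_th pow_small)

lemma comm_nil_th_comm: "(XY, YX) \<in> idents (th_of comm_nil_alg)"
  by (auto simp: in_small_th)

definition two_gens :: "nat \<Rightarrow> nat \<Rightarrow> nat \<Rightarrow> nat" where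
  "two_gens p q i = (if i = 0 then p else if i = 1 then q else 0)"

lemma two_gens_simps [simp]: "two_gens p q 0 = p" "two_gens p q 1 = q" "two_gens p q (Suc 0) = q"
  by (simp_all add: two_gens_def)

lemma small_th_eval:
  "(s, t) \<in> idents (th_of left_alg) \<Longrightarrow> eval_term left_alg (two_gens 1 2) s = eval_term left_alg (two_gens 1 2) t"
  "(s, t) \<in> idents (th_of right_alg) \<Longrightarrow> eval_term right_alg (two_gens 2 1) s = eval_term right_alg (two_gens 2 1) t"
  "(s, t) \<in> idents (th_of comm_nil_alg) \<Longrightarrow> eval_term comm_nil_alg (two_gens 1 2) s = eval_term comm_nil_alg (two_gens 1 2) t"
  "(s, t) \<in> idents (th_of word_nil_alg) \<Longrightarrow> eval_term word_nil_alg (two_gens 1 2) s = eval_term word_nil_alg (two_gens 1 2) t"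
  by (simp_all only: in_small_th; erule allE; erule mp; simp add: two_gens_def small_alg_defs)+

lemma left_th_not_comm: "(XY, YX) \<notin> idents (th_of left_alg)"
proof
  assume "(XY, YX) \<in> idents (th_of left_alg)"
  then have "eval_term left_alg (two_gens 1 2) XY = eval_term left_alg (two_gens 1 2) YX" by (rule small_th_eval)
  then show False by simp
qed

lemma right_th_not_comm: "(XY, YX) \<notin> idents (th_of right_alg)"
proof
  assume "(XY, YX) \<in> idents (th_of right_alg)"
  then have "eval_term right_alg (two_gens 2 1) XY = eval_term right_alg (two_gens 2 1) YX" by (rule small_th_eval)
  then show False by simp
qed

lemma comm_nil_th_class:
  assumes "(XY, t) \<in> idents (th_of comm_nil_alg)" shows "t = XY \<or> t = YX"
proof -
  let ?e = "eval_term comm_nil_alg (two_gens 1 2)"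
  have "?e XY = ?e t" by (rule small_th_eval(3)[OF assms])
  then have e3: "?e t = 3" by simp
  have e1: "p = Var 0" if "?e p = 1" for p
    using that by (cases p) (auto simp: two_gens_def split: if_splits)
  have e2: "p = Var 1" if "?e p = 2" for p
    using that by (cases p) (auto simp: two_gens_def split: if_splits)
  show ?thesis using e3 e1 e2 by (cases t) (auto simp: two_gens_def split: if_splits)
qed

lemma word_nil_th_class:
  assumes "(XY, t) \<in> idents (th_of word_nil_alg)" shows "t = XY"
proof -
  let ?e = "eval_term word_nil_alg (two_gens 1 2)"
  have "?e XY = ?e t" by (rule small_th_eval(4)[OF assms])
  then have e3: "?e t = 3" by simp
  have e1: "p = Var 0" if "?e p = 1" for p
    using that by (cases p) (auto simp: two_gens_def split: if_splits)
  have e2: "p = Var 1" if "?e p = 2" for p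
    using that by (cases p) (auto simp: two_gens_def split: if_splits)
  show ?thesis using e3 e1 e2 by (cases t) (auto simp: two_gens_def split: if_splits)
qed

text \<open>
  In \<open>left_alg\<close> a term in the class of \<open>x y\<close> is a product with a single \<open>y\<close>, at its end, and in
  \<open>right_alg\<close> one with a single \<open>x\<close>, at its beginning.
\<close>

lemma left_right_th_class:
  assumes l: "(XY, t) \<in> idents (th_of left_alg)" and r: "(XY, t) \<in> idents (th_of right_alg)"
  shows "t = XY"
proof -
  let ?l = "eval_term left_alg (two_gens 1 2)" and ?r = "eval_term right_alg (two_gens 2 1)"
  have "?l XY = ?l t" "?r XY = ?r t" by (rule small_th_eval; use l r in simp)+
  then have t: "?l t = 2" "?r t = 2" by simp_all
  have l1: "vars p = {0}" if "?l p = 1" for p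
    using that
  proof (induction p)
    case (Var i) then show ?case by (simp add: two_gens_def split: if_splits)
  next
    case (Mul u w)
    then have "?l u = 1 \<and> ?l w = 1" by (simp split: if_splits)
    then show ?case using Mul.IH by simp
  next
    case (Bar u)
    then show ?case by simp
  qed
  have r1: "vars p = {1}" if "?r p = 1" for p
    using that
  proof (induction p)
    case (Var i) then show ?case by (simp add: two_gens_def split: if_splits)
  next
    case (Mul u w)
    then have "?r u = 1 \<and> ?r w = 1" by (simp split: if_splits)
    then show ?case using Mul.IH by simp
  next
    case (Bar u)
    then show ?case by simp
  qed
  have lr: "\<not> (?l p = 1 \<and> ?r p = 1)" for p using l1[of p] r1[of p] by auto
  have p: "p = Var 0" if "?l p = 1" "?r p = 2" for p
  proof (cases p)
    case (Mul u w) then show ?thesis using that lr[of w] by (auto split: if_splits)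
  qed (use that in \<open>auto simp: two_gens_def split: if_splits\<close>)
  have q: "q = Var 1" if "?l q = 2" "?r q = 1" for q
  proof (cases q)
    case (Mul u w) then show ?thesis using that lr[of u] by (auto split: if_splits)
  qed (use that in \<open>auto simp: two_gens_def split: if_splits\<close>)
  show ?thesis
  proof (cases t)
    case (Mul u w)
    then have "?l u = 1" "?l w = 2" "?r u = 2" "?r w = 1"
      using t by (auto split: if_splits)
    then show ?thesis using p q Mul by simp
  qed (use t in \<open>auto simp: two_gens_def split: if_splits\<close>)
qed

section \<open>The classification\<close>

definition collapsing :: "epi_th \<Rightarrow> nat \<Rightarrow> bool" where
  "collapsing a m \<longleftrightarrow> 1 \<le> m \<and> (\<forall>S :: nat unary_alg. S \<in> models (idents a) \<longrightarrow> nilsemi S m)"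

text \<open>
  Exponents being shifted, 4 stands for the fifth power, the least that \<open>power_factor\<close> admits.
\<close>

lemma large_index: "\<exists>m. 4 \<le> m \<and> epi_axioms m \<subseteq> idents a"
proof -
  obtain n where "epi_axioms n \<subseteq> idents a" using epi_idents[of a] by (auto simp: epi_theory_def)
  then have "epi_axioms (max 4 n) \<subseteq> idents a" using epi_axioms_mono[OF eq_idents] by simp
  then show ?thesis by (intro exI[of _ "max 4 n"]) simp
qed

lemma costandard_collapsing:
  assumes "\<And>b c. inf (sup a b) c = sup (inf a c) (inf b c)" shows "\<exists>m. collapsing a m"
proof -
  obtain m where m: "4 \<le> m" "epi_axioms m \<subseteq> idents a" using large_index by blast
  then show ?thesis
    using models_nilsemi[OF costandard_UW[OF assms m] m(2)] unfolding collapsing_def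
    by (intro exI[of _ m]) auto
qed

lemma lower_modular_collapsing:
  assumes "\<And>b c. b \<le> a \<Longrightarrow> inf (sup c b) a = sup (inf c a) b" shows "\<exists>m. collapsing a m"
proof -
  obtain m where m: "4 \<le> m" "epi_axioms m \<subseteq> idents a" using large_index by blast
  from lower_modular_UW[OF assms m]
  obtain k where "(U_term (tpow (Var 0) m), W_term k (tpow (Var 0) m)) \<in> idents a" by blast
  then show ?thesis
    using models_nilsemi[OF _ m(2)] m(1) unfolding collapsing_def by (intro exI[of _ m]) auto
qed

lemma collapsing_identities:
  assumes "collapsing a m"
  shows "(Mul (tpow (Var 0) m) (Var 1), Mul (Var 0) (tpow (Var 1) m)) \<in> idents a"
    "(Mul (tpow (Var 0) m) (Var 1), Mul (tpow (Var 1) m) (Var 0)) \<in> idents a"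
  using nilsemi_identities[of a m] assms unfolding collapsing_def by blast+

text \<open>
  Otherwise \<open>a\<close> relates \<open>x y\<close> at most to \<open>y x\<close>. Let \<open>b\<close> and \<open>c\<close> be the theories of \<open>left_alg\<close> and
  \<open>right_alg\<close>. The chain \<open>x y = x\<^sup>m y = x y\<^sup>m\<close> has a step in \<open>b\<close> and one in \<open>a\<close>, and its ends are related
  by \<open>c\<close>. But neither \<open>inf a c\<close> nor \<open>inf b c\<close> relates \<open>x y\<close> to another term.
\<close>

lemma costandard_above:
  assumes co: "\<And>b c. inf (sup a b) c = sup (inf a c) (inf b c)" shows "inf sl_th zm_th \<le> a"
proof (rule ccontr)
  assume no: "\<not> inf sl_th zm_th \<le> a"
  obtain m where m: "collapsing a m" using costandard_collapsing[OF co] by blast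
  have cl: "s = XY \<or> s = YX" if "(XY, s) \<in> idents a" for s
    using above_from_product_identity[of a m s] m no that unfolding collapsing_def by blast
  let ?b = "th_of left_alg" and ?c = "th_of right_alg" and ?t = "Mul (Var 0) (tpow (Var 1) m)"
  have bt: "(XY, ?t) \<in> idents (sup a ?b)"
    by (rule eq_theoryD(3)[OF eq_idents in_sup(2)[OF left_th_pow(1)] in_sup(1)[OF collapsing_identities(1)[OF m]]])
  have ct: "(XY, ?t) \<in> idents ?c" by (rule eq_theoryD(2)[OF eq_idents right_th_pow])
  have "(XY, ?t) \<in> idents (inf (sup a ?b) ?c)" using bt ct by (simp add: idents_inf)
  then have "(XY, ?t) \<in> idents (sup (inf a ?c) (inf ?b ?c))" by (simp only: co)
  then have "?t \<in> {XY}"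
  proof (rule sup_closed_set)
    show "q \<in> {XY}" if "p \<in> {XY}" "(p, q) \<in> idents (inf a ?c)" for p q
      using that cl[of q] right_th_not_comm by (auto simp: idents_inf)
    show "q \<in> {XY}" if "p \<in> {XY}" "(p, q) \<in> idents (inf ?b ?c)" for p q
      using that left_right_th_class[of q] by (auto simp: idents_inf)
  qed simp
  then show False using m by (cases m) (auto simp: collapsing_def)
qed

text \<open>
  Otherwise \<open>a\<close> relates \<open>x y\<close> at most to \<open>y x\<close>. The chain \<open>x y = x\<^sup>m y = y\<^sup>m x = y x\<close> has outer steps in the
  theory \<open>c\<close> of \<open>left_alg\<close>, which is not commutative, and the middle one in \<open>a\<close>. If \<open>x y = y x\<close> fails in
  \<open>a\<close>, adjoin to \<open>a\<close> the theory of \<open>comm_nil_alg\<close>: this adds \<open>x y = y x\<close> but nothing else to the class of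
  \<open>x y\<close>, against upper modularity. If \<open>x y = y x\<close> holds in \<open>a\<close>, intersect \<open>a\<close> with the theory of
  \<open>word_nil_alg\<close>: this keeps the middle step but isolates \<open>x y\<close>, against lower modularity.
\<close>

lemma modular_above:
  assumes um: "\<And>b c. a \<le> b \<Longrightarrow> sup (inf c b) a = inf (sup c a) b"
    and lm: "\<And>b c. b \<le> a \<Longrightarrow> inf (sup c b) a = sup (inf c a) b"
  shows "inf sl_th zm_th \<le> a"
proof (rule ccontr)
  assume no: "\<not> inf sl_th zm_th \<le> a"
  obtain m where m: "collapsing a m" using lower_modular_collapsing[OF lm] by blast
  have cl: "s = XY \<or> s = YX" if "(XY, s) \<in> idents a" for s
    using above_from_product_identity[of a m s] m no that unfolding collapsing_def by blast
  note h = collapsing_identities(2)[OF m]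
  let ?c = "th_of left_alg"
  show False
  proof (cases "(XY, YX) \<in> idents a")
    case False
    let ?k = "th_of comm_nil_alg"
    let ?b = "sup a ?k"
    have "(XY, YX) \<in> idents (sup ?c a)"
      by (rule sup_trans3[OF in_sup(1)[OF left_th_pow(1)] in_sup(2)[OF h] in_sup(1)[OF left_th_pow(2)]])
    moreover have "(XY, YX) \<in> idents ?b" by (rule in_sup(2)[OF comm_nil_th_comm])
    ultimately have "(XY, YX) \<in> idents (inf (sup ?c a) ?b)" by (simp add: idents_inf)
    then have "(XY, YX) \<in> idents (sup (inf ?c ?b) a)" using um[of ?b ?c] by simp
    then have "YX \<in> {XY}"
    proof (rule sup_closed_set)
      show "q \<in> {XY}" if "p \<in> {XY}" "(p, q) \<in> idents a" for p q
        using that cl[of q] False by auto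
      show "q \<in> {XY}" if pq: "p \<in> {XY}" "(p, q) \<in> idents (inf ?c ?b)" for p q
      proof -
        have "(XY, q) \<in> idents ?b" using pq by (simp add: idents_inf)
        then have "q \<in> {XY, YX}"
        proof (rule sup_closed_set)
          fix p q assume pq: "p \<in> {XY, YX}" "(p, q) \<in> idents a"
          define \<sigma> where "\<sigma> i = (if i = 0 then Var 1 else if i = 1 then Var 0 else Var i)" for i :: nat
          have inv: "subst \<sigma> (subst \<sigma> t) = t" for t by (induction t) (auto simp: \<sigma>_def)
          have sw: "subst \<sigma> XY = YX" "subst \<sigma> YX = XY" by (simp_all add: \<sigma>_def)
          show "q \<in> {XY, YX}"
          proof (cases "p = XY")
            case True then show ?thesis using cl[of q] pq by simp
          next
            case False
            then have p: "p = YX" using pq(1) by simp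
            have "(subst \<sigma> YX, subst \<sigma> q) \<in> idents a"
              using eq_theoryD(6)[OF eq_idents pq(2), of \<sigma>] unfolding p .
            then have "subst \<sigma> q = XY \<or> subst \<sigma> q = YX" using cl[of "subst \<sigma> q"] unfolding sw by simp
            then show ?thesis using inv[of q] sw by auto
          qed
        next
          fix p q assume pq: "p \<in> {XY, YX}" "(p, q) \<in> idents ?k"
          then have "(XY, q) \<in> idents ?k"
            using eq_theoryD(3)[OF eq_idents comm_nil_th_comm] by auto
          then show "q \<in> {XY, YX}" using comm_nil_th_class by blast
        qed simp
        moreover have "q \<noteq> YX" using pq left_th_not_comm by (auto simp: idents_inf)
        ultimately show ?thesis by simp
      qed
    qed simp
    then show False by simp
  next
    case True
    let ?b = "inf a (th_of word_nil_alg)"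
    have "(Mul (tpow (Var 0) m) (Var 1), Mul (tpow (Var 1) m) (Var 0)) \<in> idents ?b"
      using h word_nil_th_pow[of m] m by (simp add: idents_inf collapsing_def)
    then have "(XY, YX) \<in> idents (sup ?c ?b)"
      by (rule sup_trans3[OF in_sup(1)[OF left_th_pow(1)] in_sup(2) in_sup(1)[OF left_th_pow(2)]])
    then have "(XY, YX) \<in> idents (inf (sup ?c ?b) a)" using True by (simp add: idents_inf)
    then have "(XY, YX) \<in> idents (sup (inf ?c a) ?b)" using lm[of ?b ?c] by simp
    then have "YX \<in> {XY}"
    proof (rule sup_closed_set)
      show "q \<in> {XY}" if "p \<in> {XY}" "(p, q) \<in> idents (inf ?c a)" for p q
        using that cl[of q] left_th_not_comm by (auto simp: idents_inf)
      show "q \<in> {XY}" if "p \<in> {XY}" "(p, q) \<in> idents ?b" for p q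
        using that word_nil_th_class[of q] by (auto simp: idents_inf)
    qed simp
    then show False by simp
  qed
qed

lemma special_iff:
  "inf sl_th zm_th \<le> a \<longleftrightarrow>
   (let V = (var_of a :: 'a::infinite unary_alg set) in V = TRIV \<or> V = SL \<or> V = ZM \<or> V = join EPI SL ZM)"
proof -
  have "inf sl_th zm_th \<le> a \<longleftrightarrow> a = top_th \<or> a = sl_th \<or> a = zm_th \<or> a = inf sl_th zm_th"
    using above_sl_zm[of a] le_top_th by auto
  then show ?thesis
    by (simp only: Let_def var_of_inject[where 'a = 'a, symmetric] var_of_top var_of_sl var_of_zm var_of_inf)
qed

theorem theorem1p1:
  fixes V :: "('a::infinite) unary_alg set"
  assumes "epigroup_variety V"
  shows "(neutral_elem EPI V \<longleftrightarrow> costandard_elem EPI V)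
    \<and> (costandard_elem EPI V \<longleftrightarrow> lower_modular_elem EPI V \<and> upper_modular_elem EPI V)
    \<and> (lower_modular_elem EPI V \<and> upper_modular_elem EPI V
         \<longleftrightarrow> V = TRIV \<or> V = SL \<or> V = ZM \<or> V = SL \<squnion>\<^bsub>EPI\<^esub> ZM)"
proof -
  obtain a where V: "V = var_of a"
    using assms carrier_EPI[of V] by (auto simp: EPI_def)
  let ?d = "inf sl_th zm_th \<le> a"
  have d: "?d \<longleftrightarrow> V = TRIV \<or> V = SL \<or> V = ZM \<or> V = SL \<squnion>\<^bsub>EPI\<^esub> ZM"
    unfolding V using special_iff[of a, where 'a = 'a] by (simp only: Let_def)
  have dc: "dist_cancel a" if ?d using special_dist_cancel above_sl_zm that by blast
  have d_neutral: "?d \<Longrightarrow> neutral_elem EPI V"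
    unfolding V neutral_EPI using dist_cancel_median[OF dc] by blast
  have d_costandard: "?d \<Longrightarrow> costandard_elem EPI V"
    unfolding V costandard_EPI using dist_cancel_costandard[OF dc] by blast
  have neutral_modular: "neutral_elem EPI V \<Longrightarrow> lower_modular_elem EPI V \<and> upper_modular_elem EPI V"
    unfolding V neutral_EPI lower_modular_EPI upper_modular_EPI
    using median_modular[of a] by blast
  have costandard_d: "costandard_elem EPI V \<Longrightarrow> ?d"
    unfolding V costandard_EPI using costandard_above[of a] by blast
  have modular_d: "lower_modular_elem EPI V \<and> upper_modular_elem EPI V \<Longrightarrow> ?d"
    unfolding V lower_modular_EPI upper_modular_EPI using modular_above[of a] by blast
  show ?thesis
    using d d_neutral d_costandard neutral_modular costandard_d modular_d by blast
qed

end
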